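(* Let $q$ be any nonzero complex number and let $W$ be any $DY_q^{\infty}(sl_2)$-module. Then there exists one and only one structure of a $V_q$-module-at-infinity on $W$ with $$Y_W(e,x)=e(x),\qquad Y_W(f,x)=f(x),\qquad Y_W(h,x)=h(x).$$
   Context: All vector spaces are over $\mathbb C$; $\mathbb N=\{0,1,2,\dots\}$; $\delta(z)=\sum_{n\in\mathbb Z}z^n$; a power $(y+z)^n$ of a binomial is expanded in nonnegative powers of the second variable $z$. $U((x_1^{-1},x_2^{-1}))$ denotes $U[[x_1^{-1},x_2^{-1}]][x_1,x_2]$. For $A(x_1,x_2)\in\operatorname{Hom}(W,W((x_1^{-1},x_2^{-1})))$, $A|_{x_1=x_2+x_0}=A(x_2+x_0,x_2)=\big(e^{x_0\partial/\partial x_1}A(x_1,x_2)\big)|_{x_1=x_2}$. **Notation.** $e,f,h$ are the standard Chevalley generators of $sl_2$. For $u\in sl_2$, $n\in\mathbb Z$: $u(n)=u\otimes t^n$, $sl_2(n)=sl_2\otimes t^n$, $u(x)=\sum_{n\in\mathbb Z}u(n)x^{-n-1}$. $T$ is the tensor algebra over $sl_2\otimes\mathbb C[t,t^{-1}]$, $\mathbb Z$-graded by $\deg(u\otimes t^n)=n$, $T=\coprod_nT_n$. **$DY_q^\infty(sl_2)$-modules.** A $DY_q^\infty(sl_2)$-module is a $T$-module $W$ such that for every $w\in W$, $sl_2(n)w=0$ for $n$ sufficiently small (i.e. sufficiently negative), and such that on $W$: $$e(x_1)e(x_2)=\frac{x_1-x_2+q}{x_1-x_2-q}e(x_2)e(x_1),\quad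 f(x_1)f(x_2)=\frac{x_1-x_2-q}{x_1-x_2+q}f(x_2)f(x_1),$$ $$[e(x_1),f(x_2)]=-x_1^{-1}\delta\left(\frac{x_2}{x_1}\right)h(x_2),\quad h(x_1)h(x_2)=h(x_2)h(x_1),$$ $$h(x_1)e(x_2)=\frac{x_1-x_2+q}{x_1-x_2-q}e(x_2)h(x_1),\quad h(x_1)f(x_2)=\frac{x_1-x_2-q}{x_1-x_2+q}f(x_2)h(x_1),$$ where $(x_1-x_2\pm q)^{-1}=\sum_{i\in\mathbb N}(\mp q)^i(x_1-x_2)^{-i-1}\in\mathbb C[x_2][[x_1^{-1}]]$. **$V_q$.** A $DY_q(sl_2)$-module is a $T$-module $W$ such that for every $w$, $sl_2(n)w=0$ for $n$ sufficiently large, and on which $$e(x_1)e(x_2)=\frac{q+x_1-x_2}{-q+x_1-x_2}e(x_2)e(x_1),\quad f(x_1)f(x_2)=\frac{-q+x_1-x_2}{q+x_1-x_2}f(x_2)f(x_1),$$ $$[e(x_1),f(x_2)]=x_1^{-1}\delta\left(\frac{x_2}{x_1}\right)h(x_2),\quad h(x_1)h(x_2)=h(x_2)h(x_1),$$ $$h(x_1)e(x_2)=\frac{q+x_1-x_2}{-q+x_1-x_2}e(x_2)h(x_1),\quad h(x_1)f(x_2)=\frac{-q+x_1-x_2}{q+x_1-x_2}f(x_2)h(x_1),$$ where here $(\pm q+x_1-x_2)^{-1}=\sum_{i\in\mathbb N}(\pm q)^{-i-1}(x_2-x_1)^i\in\mathbb C[[x_1,x_2]]$. Let $d$ be the derivation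 of $T$ with $d(a\otimes t^n)=-n(a\otimes t^{n-1})$, $T_+=\sum_{n\ge1}T_n$, and $J=T\,\mathbb C[d]\,T_+$ (left ideal generated by all $d^iT_+$, $i\ge 0$). $V_q$ is the quotient $T$-module of $T/J$ modulo all the defining relations of $DY_q(sl_2)$-modules; $\mathbf 1$ is the image of $1$. The map $sl_2\to V_q$, $u\mapsto u(-1)\mathbf 1$, is injective and $sl_2$ is identified with its image. $V_q$ carries a unique structure of weak quantum vertex algebra (in particular of nonlocal vertex algebra) with vacuum $\mathbf 1$ and $Y(u,x)=u(x)$ for $u\in\{e,f,h\}$; this is the structure used in the claim. **Nonlocal vertex algebra.** A vector space $V$ with a linear map $Y:V\to\operatorname{Hom}(V,V((x)))$ and $\mathbf 1\in V$ such that $Y(\mathbf 1,x)v=v$, $Y(v,x)\mathbf 1\in V[[x]]$, $\lim_{x\to0}Y(v,x)\mathbf 1=v$, and for all $u,v,w$ there is $l\in\mathbb N$ with $(x_0+x_2)^lY(u,x_0+x_2)Y(v,x_2)w=(x_0+x_2)^lY(Y(u,x_0)v,x_2)w$. A weak quantum vertex algebra is a nonlocal vertex algebra such that for any $u,v\in V$ there are finitely many $u^{(i)},v^{(i)}\in V$, $f_i(x)\in\mathbb C((x))$ and $k\in\mathbb N$ with $(x_1-x_2)^kY(u,x_1)Y(v,x_2)=(x_1-x_2)^k\sum_if_i(x_2-x_1)Y(v^{(i)},x_2)Y(u^{(i)},x_1)$. **Module-at-infinity.** For a nonlocal vertex algebra $V$, a (left) $V$-module-at-infinity is a vector space $W$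 with a linear map $Y_W:V\to\operatorname{Hom}(W,W((x^{-1})))$ such that $Y_W(\mathbf 1,x)=1_W$ and for any $u,v\in V$ there is $k\in\mathbb N$ with $(x_1-x_2)^kY_W(u,x_1)Y_W(v,x_2)\in\operatorname{Hom}(W,W((x_1^{-1},x_2^{-1})))$ and $$x_0^kY_W(Y(u,x_0)v,x_2)=\big((x_1-x_2)^kY_W(u,x_1)Y_W(v,x_2)\big)|_{x_1=x_2+x_0}.$$ *)

theory Defs
  imports Complex_Main "HOL-Library.Poly_Mapping" "HOL-Library.Groups_Big_Fun"
    "HOL-Computational_Algebra.Formal_Laurent_Series"
begin

section \<open>Formal series\<close>

text \<open>A complex vector space is a type \<open>'v::ab_group_add\<close> with a scalar multiplication
  \<open>s :: complex \<Rightarrow> 'v \<Rightarrow> 'v\<close> such that \<open>vector_space s\<close> holds. A doubly infinite series in one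
  (two) variables is its coefficient function: \<open>a m\<close> is the coefficient of \<open>x\<^sup>m\<close>, and
  \<open>a m n\<close> that of \<open>x\<^sub>1\<^sup>m x\<^sub>2\<^sup>n\<close>. The index is always the exponent, not the mode index,
  so \<open>u(n)\<close> sits at exponent \<open>-n-1\<close>. An operator-valued series sends a vector to a series of
  vectors.\<close>

type_synonym 'v series = "int \<Rightarrow> 'v"
type_synonym 'v series2 = "int \<Rightarrow> int \<Rightarrow> 'v"

text \<open>Product of a scalar series with a series. \<^const>\<open>Sum_any\<close> is the sum of a finitely supported
  family and \<open>0\<close> otherwise; in all uses below the supports are finite.\<close>

definition ser_mult :: "(complex \<Rightarrow> 'v \<Rightarrow> 'v) \<Rightarrow> complex series2 \<Rightarrow> 'v::ab_group_add series2 \<Rightarrow> 'v series2"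
  where "ser_mult s g a = (\<lambda>m n. Sum_any (\<lambda>(i, j). s (g i j) (a (m - i) (n - j))))"

text \<open>\<open>binom_ser c p\<close> is \<open>(y + c z)\<^sup>p\<close> expanded in nonnegative powers of \<open>z\<close>; the first index belongs
  to \<open>y\<close>, the second to \<open>z\<close>.\<close>

definition binom_ser :: "complex \<Rightarrow> int \<Rightarrow> complex series2" where
  "binom_ser c p = (\<lambda>i j. if 0 \<le> j \<and> i + j = p then (of_int p gchoose nat j) * c ^ nat j else 0)"

text \<open>\<open>A(x\<^sub>1) B(x\<^sub>2)\<close> and \<open>B(x\<^sub>2) A(x\<^sub>1)\<close>; in both, the first index belongs to \<open>x\<^sub>1\<close>.\<close>

definition op_prod :: "('w \<Rightarrow> 'w series) \<Rightarrow> ('w \<Rightarrow> 'w series) \<Rightarrow> 'w \<Rightarrow> 'w series2" where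
  "op_prod A B w = (\<lambda>m n. A (B w n) m)"

definition op_rev_prod :: "('w \<Rightarrow> 'w series) \<Rightarrow> ('w \<Rightarrow> 'w series) \<Rightarrow> 'w \<Rightarrow> 'w series2" where
  "op_rev_prod B A w = (\<lambda>m n. B (A w m) n)"

text \<open>Membership in \<open>Hom(W, W((x)))\<close>, in \<open>Hom(W, W((x\<inverse>)))\<close> and in \<open>U((x\<^sub>1\<inverse>, x\<^sub>2\<inverse>))\<close>.\<close>

definition hom_laurent :: "(complex \<Rightarrow> 'w::ab_group_add \<Rightarrow> 'w) \<Rightarrow> ('w \<Rightarrow> 'w series) \<Rightarrow> bool" where
  "hom_laurent s A \<longleftrightarrow> (\<forall>n. Vector_Spaces.linear s s (\<lambda>w. A w n)) \<and> (\<forall>w. \<exists>N. \<forall>n<N. A w n = 0)"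

definition hom_laurent_inf :: "(complex \<Rightarrow> 'w::ab_group_add \<Rightarrow> 'w) \<Rightarrow> ('w \<Rightarrow> 'w series) \<Rightarrow> bool" where
  "hom_laurent_inf s A \<longleftrightarrow> (\<forall>n. Vector_Spaces.linear s s (\<lambda>w. A w n)) \<and> (\<forall>w. \<exists>N. \<forall>n>N. A w n = 0)"

definition laurent_inf2 :: "'u::zero series2 \<Rightarrow> bool" where
  "laurent_inf2 a \<longleftrightarrow> (\<exists>N. \<forall>m n. m > N \<or> n > N \<longrightarrow> a m n = 0)"

text \<open>For \<open>a(x\<^sub>1, x\<^sub>2) \<in> U((x\<^sub>1\<inverse>, x\<^sub>2\<inverse>))\<close>, \<open>shift_subst s a\<close> is
  \<open>a|\<^bsub>x1 = x2 + x0\<^esub> = (exp(x\<^sub>0 \<partial>/\<partial>x\<^sub>1) a)|\<^bsub>x1 = x2\<^esub>\<close>; first index: \<open>x\<^sub>0\<close>, second: \<open>x\<^sub>2\<close>.\<close>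

definition deriv1 :: "(complex \<Rightarrow> 'u \<Rightarrow> 'u) \<Rightarrow> 'u series2 \<Rightarrow> 'u series2" where
  "deriv1 s a = (\<lambda>m n. s (of_int (m + 1)) (a (m + 1) n))"

definition diag :: "'u::ab_group_add series2 \<Rightarrow> 'u series" where
  "diag a = (\<lambda>n. Sum_any (\<lambda>m. a m (n - m)))"

definition shift_subst :: "(complex \<Rightarrow> 'u::ab_group_add \<Rightarrow> 'u) \<Rightarrow> 'u series2 \<Rightarrow> 'u series2" where
  "shift_subst s a = (\<lambda>i n. if 0 \<le> i
     then s (1 / fact (nat i)) (diag ((deriv1 s ^^ nat i) a) n) else 0)"


section \<open>Vertex algebras and modules at infinity\<close>

text \<open>\<open>Y u v n\<close> is the coefficient of \<open>x\<^sup>n\<close> in \<open>Y(u, x) v\<close>.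
  For \<open>a(x\<^sub>1, x\<^sub>2)\<close>, the series \<open>a(x\<^sub>0 + x\<^sub>2, x\<^sub>2)\<close>; first index: \<open>x\<^sub>0\<close>, second: \<open>x\<^sub>2\<close>.\<close>

definition plus_subst :: "(complex \<Rightarrow> 'u::ab_group_add \<Rightarrow> 'u) \<Rightarrow> 'u series2 \<Rightarrow> 'u series2" where
  "plus_subst s a = (\<lambda>i n. Sum_any (\<lambda>(p, j). s (binom_ser 1 p i j) (a p (n - j))))"

definition nonlocal_vertex_algebra ::
  "(complex \<Rightarrow> 'v::ab_group_add \<Rightarrow> 'v) \<Rightarrow> ('v \<Rightarrow> 'v \<Rightarrow> 'v series) \<Rightarrow> 'v \<Rightarrow> bool" where
  "nonlocal_vertex_algebra s Y vac \<longleftrightarrow>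
     vector_space s \<and>
     (\<forall>v n. Vector_Spaces.linear s s (\<lambda>u. Y u v n)) \<and>
     (\<forall>u. hom_laurent s (Y u)) \<and>
     (\<forall>v n. Y vac v n = (if n = 0 then v else 0)) \<and>
     (\<forall>v. (\<forall>n<0. Y v vac n = 0) \<and> Y v vac 0 = v) \<and>
     (\<forall>u v w. \<exists>l::nat.
        ser_mult s (binom_ser 1 (int l)) (plus_subst s (op_prod (Y u) (Y v) w)) =
        ser_mult s (binom_ser 1 (int l)) (\<lambda>i n. Y (Y u v i) w n))"

text \<open>\<open>f(x\<^sub>2 - x\<^sub>1)\<close>, expanded in nonnegative powers of \<open>x\<^sub>1\<close>; the first index belongs to \<open>x\<^sub>1\<close>.\<close>

definition fls_diff :: "complex fls \<Rightarrow> complex series2" where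
  "fls_diff f = (\<lambda>i j. Sum_any (\<lambda>p. fls_nth f p * binom_ser (-1) p j i))"

definition weak_quantum_vertex_algebra ::
  "(complex \<Rightarrow> 'v::ab_group_add \<Rightarrow> 'v) \<Rightarrow> ('v \<Rightarrow> 'v \<Rightarrow> 'v series) \<Rightarrow> 'v \<Rightarrow> bool" where
  "weak_quantum_vertex_algebra s Y vac \<longleftrightarrow>
     nonlocal_vertex_algebra s Y vac \<and>
     (\<forall>u v. \<exists>(ts :: ('v \<times> 'v \<times> complex fls) list) (k::nat). \<forall>w.
        ser_mult s (binom_ser (-1) (int k)) (op_prod (Y u) (Y v) w) =
        ser_mult s (binom_ser (-1) (int k))
          (\<lambda>m n. \<Sum>(u', v', f)\<leftarrow>ts. ser_mult s (fls_diff f) (op_rev_prod (Y v') (Y u') w) m n))"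

definition module_at_infinity ::
  "(complex \<Rightarrow> 'v::ab_group_add \<Rightarrow> 'v) \<Rightarrow> ('v \<Rightarrow> 'v \<Rightarrow> 'v series) \<Rightarrow> 'v \<Rightarrow>
   (complex \<Rightarrow> 'w::ab_group_add \<Rightarrow> 'w) \<Rightarrow> ('v \<Rightarrow> 'w \<Rightarrow> 'w series) \<Rightarrow> bool" where
  "module_at_infinity sV Y vac sW YW \<longleftrightarrow>
     vector_space sW \<and>
     (\<forall>w n. Vector_Spaces.linear sV sW (\<lambda>v. YW v w n)) \<and>
     (\<forall>v. hom_laurent_inf sW (YW v)) \<and>
     (\<forall>w n. YW vac w n = (if n = 0 then w else 0)) \<and>
     (\<forall>u v. \<exists>k::nat. \<forall>w.
        (let a = ser_mult sW (binom_ser (-1) (int k)) (op_prod (YW u) (YW v) w) in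
         laurent_inf2 a \<and> (\<lambda>i n. YW (Y u v (i - int k)) w n) = shift_subst sW a))"


section \<open>The tensor algebra\<close>

text \<open>\<open>T\<close> is the tensor algebra of the vector space with basis \<open>u \<otimes> t\<^sup>n\<close>, \<open>u \<in> {e, f, h}\<close>,
  \<open>n \<in> \<int>\<close>, i.e. the free associative algebra on these elements: the monoid algebra of the free
  monoid \<open>word\<close>. The multiplication of \<^typ>\<open>'a \<Rightarrow>\<^sub>0 'b\<close> is convolution with respect to
  the (here noncommutative) addition of \<open>'a\<close>. The Lie bracket of \<open>sl\<^sub>2\<close> plays no role.\<close>

datatype sl2_gen = E | F | H

datatype word = Word (letters: "(sl2_gen \<times> int) list")

instantiation word :: monoid_add
begin
definition zero_word :: word where "0 = Word []"
definition plus_word :: "word \<Rightarrow> word \<Rightarrow> word" where "v + w = Word (letters v @ letters w)"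
instance by standard (simp_all add: zero_word_def plus_word_def)
end

type_synonym T = "word \<Rightarrow>\<^sub>0 complex"

definition T_scale :: "complex \<Rightarrow> T \<Rightarrow> T" where
  "T_scale c a = Poly_Mapping.single 0 c * a"

definition gen :: "sl2_gen \<Rightarrow> int \<Rightarrow> T" where
  "gen u n = Poly_Mapping.single (Word [(u, n)]) 1"

definition T_hom :: "int \<Rightarrow> T set" where
  "T_hom n = {a. \<forall>w \<in> Poly_Mapping.keys a. (\<Sum>(u, k)\<leftarrow>letters w. k) = n}"

definition T_plus :: "T set" where
  "T_plus = module.span T_scale (\<Union>n\<in>{1..}. T_hom n)"

text \<open>The derivation \<open>d\<close> with \<open>d(u \<otimes> t\<^sup>n) = -n (u \<otimes> t\<^sup>n\<^sup>-\<^sup>1)\<close>, by the Leibniz rule on words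
  and linear extension; see \<open>T_der_gen\<close>, \<open>T_der_add\<close> and \<open>T_der_mult\<close> below.\<close>

primrec der_word :: "(sl2_gen \<times> int) list \<Rightarrow> T" where
  "der_word [] = 0"
| "der_word (l # w) = T_scale (- of_int (snd l)) (gen (fst l) (snd l - 1)) * Poly_Mapping.single (Word w) 1
     + gen (fst l) (snd l) * der_word w"

definition T_der :: "T \<Rightarrow> T" where
  "T_der a = Sum_any (\<lambda>w. T_scale (Poly_Mapping.lookup a w) (der_word (letters w)))"

lemma T_scale_simps:
  "T_scale c (a + b) = T_scale c a + T_scale c b"
  "T_scale (c + c') a = T_scale c a + T_scale c' a"
  "T_scale c 0 = 0" "T_scale 0 a = 0"
  by (simp_all add: T_scale_def algebra_simps single_add)

lemma T_scale_mult_left: "T_scale c a * b = T_scale c (a * b)"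
  by (simp add: T_scale_def mult.assoc)

lemma T_single_induct [case_names single add]:
  assumes "\<And>w c. P (Poly_Mapping.single w c)" and "\<And>a b. P a \<Longrightarrow> P b \<Longrightarrow> P (a + b)"
  shows "P (a :: T)"
proof (induction a rule: update_induct)
  case const
  show ?case using assms(1)[of 0 0] by simp
next
  case (update a k v)
  have "Poly_Mapping.update k v a = Poly_Mapping.single k v + a"
    by (rule poly_mapping_eqI)
      (use update in \<open>auto simp: lookup_add lookup_update lookup_single when_def in_keys_iff\<close>)
  with update show ?case using assms by simp
qed

lemma single_0_commute: "Poly_Mapping.single 0 c * a = a * Poly_Mapping.single 0 (c :: complex)"
  for a :: T
  by (induction a rule: T_single_induct) (simp_all add: mult_single algebra_simps)

lemma T_scale_mult_right: "a * T_scale c b = T_scale c (a * b)"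
  by (metis T_scale_def mult.assoc single_0_commute)

lemma T_der_eq: "finite A \<Longrightarrow> Poly_Mapping.keys a \<subseteq> A \<Longrightarrow>
    T_der a = (\<Sum>w\<in>A. T_scale (Poly_Mapping.lookup a w) (der_word (letters w)))"
  unfolding T_der_def
  by (rule Sum_any.expand_superset) (auto simp: in_keys_iff subset_iff, metis T_scale_simps(4))

lemma T_der_single: "T_der (Poly_Mapping.single w c) = T_scale c (der_word (letters w))"
  by (subst T_der_eq[of "{w}"]) auto

lemma T_der_add: "T_der (a + b) = T_der a + T_der b"
proof -
  let ?A = "Poly_Mapping.keys a \<union> Poly_Mapping.keys b"
  have "Poly_Mapping.keys (a + b) \<subseteq> ?A" by (rule Poly_Mapping.keys_add)
  then show ?thesis
    by (simp add: T_der_eq[of ?A] lookup_add T_scale_simps sum.distrib)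
qed

lemma T_der_gen: "T_der (gen u n) = T_scale (- of_int n) (gen u (n - 1))"
proof -
  have "Poly_Mapping.single (Word []) 1 = (1 :: T)"
    by (simp flip: zero_word_def)
  then show ?thesis
    by (simp add: gen_def T_der_single T_scale_def)
qed

lemma der_word_append: "der_word (v @ w) =
    der_word v * Poly_Mapping.single (Word w) 1 + Poly_Mapping.single (Word v) 1 * der_word w"
proof (induction v)
  case Nil
  have "Poly_Mapping.single (Word []) 1 = (1 :: T)"
    by (simp flip: zero_word_def)
  then show ?case by simp
next
  case (Cons l v)
  have "gen (fst l) (snd l) * Poly_Mapping.single (Word v) 1 = Poly_Mapping.single (Word (l # v)) 1"
    "Poly_Mapping.single (Word v) 1 * Poly_Mapping.single (Word w) (1::complex) = Poly_Mapping.single (Word (v @ w)) 1"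
    by (simp_all add: gen_def mult_single plus_word_def)
  with Cons show ?case
    by (simp add: algebra_simps flip: mult.assoc) (simp add: mult.assoc)
qed

lemma T_der_mult: "T_der (a * b) = T_der a * b + a * T_der b"
proof (induction a rule: T_single_induct)
  case (single v c)
  show ?case
  proof (induction b rule: T_single_induct)
    case (single w c')
    have 1: "Poly_Mapping.single x k = T_scale k (Poly_Mapping.single x 1)" for x and k :: complex
      by (simp add: T_scale_def mult_single)
    have 2: "T_scale k (T_scale k' x) = T_scale (k * k') x" for k k' x
      by (simp add: T_scale_def mult_single flip: mult.assoc)
    have "T_der (Poly_Mapping.single v c * Poly_Mapping.single w c')
        = T_scale (c * c') (der_word (letters v @ letters w))"
      by (simp add: mult_single T_der_single plus_word_def)
    also have "\<dots> = T_der (Poly_Mapping.single v c) * Poly_Mapping.single w c'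
        + Poly_Mapping.single v c * T_der (Poly_Mapping.single w c')"
    proof -
      have "T_scale c (der_word (letters v)) * Poly_Mapping.single w c'
          = T_scale (c' * c) (der_word (letters v) * Poly_Mapping.single w 1)"
        by (subst 1) (simp only: T_scale_mult_left T_scale_mult_right 2)
      moreover have "Poly_Mapping.single v c * T_scale c' (der_word (letters w))
          = T_scale (c' * c) (Poly_Mapping.single v 1 * der_word (letters w))"
        by (subst 1) (simp only: T_scale_mult_left T_scale_mult_right 2)
      ultimately show ?thesis
        by (simp add: T_der_single der_word_append T_scale_simps mult.commute)
    qed
    finally show ?case .
  next
    case (add a b)
    then show ?case by (simp add: algebra_simps T_der_add)
  qed
next
  case (add a b)
  then show ?case by (simp add: algebra_simps T_der_add)
qed

definition T_left_ideal :: "T set \<Rightarrow> bool" where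
  "T_left_ideal I \<longleftrightarrow> 0 \<in> I \<and> (\<forall>a\<in>I. \<forall>b\<in>I. a + b \<in> I) \<and> (\<forall>a. \<forall>b\<in>I. a * b \<in> I)"

definition J_ideal :: "T set" where
  "J_ideal = T_left_ideal hull (\<Union>i. (T_der ^^ i) ` T_plus)"

lemma vector_space_T_scale: "vector_space T_scale"
  by standard (simp_all add: T_scale_def algebra_simps single_add mult_single flip: mult.assoc)

lemma T_left_ideal_J: "T_left_ideal J_ideal"
  unfolding J_ideal_def by (rule hull_in) (auto simp: T_left_ideal_def)

lemma T_left_ideal_minus: "T_left_ideal I \<Longrightarrow> a \<in> I \<Longrightarrow> - a \<in> I"
  unfolding T_left_ideal_def by (metis mult_minus1)


section \<open>The module \<open>T / J\<close>\<close>

definition J_rel :: "T \<Rightarrow> T \<Rightarrow> bool" where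
  "J_rel a b \<longleftrightarrow> a - b \<in> J_ideal"

quotient_type TJ = T / J_rel
proof (rule equivpI)
  have add: "a + b \<in> J_ideal" if "a \<in> J_ideal" "b \<in> J_ideal" for a b
    using T_left_ideal_J that by (simp add: T_left_ideal_def)
  show "reflp J_rel" using T_left_ideal_J by (simp add: reflp_def J_rel_def T_left_ideal_def)
  show "symp J_rel"
  proof (rule sympI)
    fix a b assume "J_rel a b"
    then show "J_rel b a"
      using T_left_ideal_minus[OF T_left_ideal_J, of "a - b"] by (simp add: J_rel_def)
  qed
  show "transp J_rel"
  proof (rule transpI)
    fix a b c assume "J_rel a b" "J_rel b c"
    then show "J_rel a c"
      using add[of "a - b" "b - c"] by (simp add: J_rel_def)
  qed
qed

instantiation TJ :: ab_group_add
begin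

lift_definition zero_TJ :: TJ is 0 .

lift_definition plus_TJ :: "TJ \<Rightarrow> TJ \<Rightarrow> TJ" is "(+)"
proof -
  fix a b c d assume "J_rel a b" "J_rel c d"
  then have "(a - b) + (c - d) \<in> J_ideal"
    using T_left_ideal_J by (simp add: J_rel_def T_left_ideal_def)
  then show "J_rel (a + c) (b + d)" by (simp add: J_rel_def algebra_simps)
qed

lift_definition uminus_TJ :: "TJ \<Rightarrow> TJ" is uminus
proof -
  fix a b assume "J_rel a b"
  then show "J_rel (- a) (- b)"
    using T_left_ideal_minus[OF T_left_ideal_J, of "a - b"] by (simp add: J_rel_def)
qed

definition minus_TJ :: "TJ \<Rightarrow> TJ \<Rightarrow> TJ" where "minus_TJ x y = x + - y"

instance
proof
  fix a b c :: TJ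
  have [simp]: "0 \<in> J_ideal" using T_left_ideal_J by (simp add: T_left_ideal_def)
  show "a + b + c = a + (b + c)" by transfer (simp add: J_rel_def algebra_simps)
  show "a + b = b + a" by transfer (simp add: J_rel_def algebra_simps)
  show "0 + a = a" by transfer (simp add: J_rel_def)
  show "- a + a = 0" by transfer (simp add: J_rel_def)
  show "a - b = a + - b" by (simp add: minus_TJ_def)
qed

end

lift_definition TJ_one :: TJ is 1 .

definition TJ_act :: "T \<Rightarrow> TJ \<Rightarrow> TJ" where
  "TJ_act a x = abs_TJ (a * rep_TJ x)"

lemma TJ_act_abs: "TJ_act a (abs_TJ b) = abs_TJ (a * b)"
proof -
  have "rep_TJ (abs_TJ b) - b \<in> J_ideal"
    by (metis J_rel_def Quotient3_TJ Quotient3_abs_rep TJ.abs_eq_iff)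
  then have "a * (rep_TJ (abs_TJ b) - b) \<in> J_ideal"
    using T_left_ideal_J by (auto simp: T_left_ideal_def)
  then show ?thesis
    unfolding TJ_act_def TJ.abs_eq_iff J_rel_def by (simp add: right_diff_distrib)
qed

definition TJ_scale :: "complex \<Rightarrow> TJ \<Rightarrow> TJ" where
  "TJ_scale c = TJ_act (Poly_Mapping.single 0 c)"


section \<open>\<open>T\<close>-modules and the defining relations\<close>

definition T_module :: "(complex \<Rightarrow> 'w::ab_group_add \<Rightarrow> 'w) \<Rightarrow> (T \<Rightarrow> 'w \<Rightarrow> 'w) \<Rightarrow> bool" where
  "T_module s act \<longleftrightarrow>
     (\<forall>w. Vector_Spaces.linear T_scale s (\<lambda>a. act a w)) \<and>
     (\<forall>a. Vector_Spaces.linear s s (act a)) \<and>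
     (\<forall>w. act 1 w = w) \<and> (\<forall>a b w. act (a * b) w = act a (act b w))"

lemma T_module_TJ: "T_module TJ_scale TJ_act"
proof -
  have ex: "\<exists>a. x = abs_TJ a" for x by (metis Quotient3_TJ Quotient3_abs_rep)
  have add: "abs_TJ a + abs_TJ b = abs_TJ (a + b)" for a b
    by (simp add: plus_TJ.abs_eq)
  have vs: "vector_space TJ_scale"
  proof
    fix a b :: complex and x y :: TJ
    obtain u v where uv: "x = abs_TJ u" "y = abs_TJ v" using ex by blast
    show "TJ_scale a (x + y) = TJ_scale a x + TJ_scale a y"
      "TJ_scale (a + b) x = TJ_scale a x + TJ_scale b x"
      "TJ_scale a (TJ_scale b x) = TJ_scale (a * b) x" "TJ_scale 1 x = x"
      by (simp_all add: uv TJ_scale_def TJ_act_abs add single_add algebra_simps mult_single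
          flip: mult.assoc)
  qed
  have act: "TJ_act (a * b) x = TJ_act a (TJ_act b x)" "TJ_act 1 x = x"
    "TJ_act (a + b) x = TJ_act a x + TJ_act b x" "TJ_act a (x + y) = TJ_act a x + TJ_act a y" for a b x y
    using ex[of x] ex[of y] by (auto simp: TJ_act_abs add algebra_simps)
  show ?thesis
    unfolding T_module_def Vector_Spaces.linear_iff
    using vs vector_space_T_scale
    by (simp add: act TJ_scale_def T_scale_def single_0_commute flip: act(1))
qed

lemma TJ_restricted: "\<exists>N. \<forall>n>N. \<forall>u. TJ_act (gen u n) x = 0"
proof -
  obtain a where a: "x = abs_TJ a" by (metis Quotient3_TJ Quotient3_abs_rep)
  have J: "T_left_ideal J_ideal" by (rule T_left_ideal_J)
  have "\<exists>N. \<forall>n>N. \<forall>u. gen u n * a \<in> J_ideal"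
  proof (induction a rule: T_single_induct)
    case (single w c)
    let ?d = "\<Sum>(u, k)\<leftarrow>letters w. k"
    have "gen u n * Poly_Mapping.single w c \<in> J_ideal" if "n > - ?d" for u n
    proof -
      have "gen u n * Poly_Mapping.single w c \<in> T_hom (n + ?d)"
        by (auto simp: gen_def mult_single T_hom_def plus_word_def split: if_splits)
      then have "gen u n * Poly_Mapping.single w c \<in> T_plus"
        unfolding T_plus_def
        using that vector_space_T_scale[folded module_iff_vector_space]
        by (intro module.span_base) auto
      then have "gen u n * Poly_Mapping.single w c \<in> (\<Union>i. (T_der ^^ i) ` T_plus)"
        by (intro UN_I[of 0]) auto
      then show ?thesis unfolding J_ideal_def by (rule subsetD[OF hull_subset])
    qed
    then show ?case by blast
  next
    case (add a b)
    then obtain M N where "\<forall>n>M. \<forall>u. gen u n * a \<in> J_ideal" "\<forall>n>N. \<forall>u. gen u n * b \<in> J_ideal"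
      by blast
    then have "\<forall>n>max M N. \<forall>u. gen u n * (a + b) \<in> J_ideal"
      using J by (simp add: T_left_ideal_def algebra_simps)
    then show ?case by blast
  qed
  moreover have "abs_TJ b = 0 \<longleftrightarrow> b \<in> J_ideal" for b
    by (simp add: zero_TJ_def TJ.abs_eq_iff J_rel_def)
  ultimately show ?thesis by (simp add: a TJ_act_abs)
qed

text \<open>\<open>u(x) = \<Sum>\<^sub>n u(n) x\<^sup>-\<^sup>n\<^sup>-\<^sup>1\<close>\<close>

definition current :: "(T \<Rightarrow> 'w \<Rightarrow> 'w) \<Rightarrow> sl2_gen \<Rightarrow> 'w \<Rightarrow> 'w series" where
  "current act u w = (\<lambda>k. act (gen u (- k - 1)) w)"

text \<open>\<open>x\<^sub>1 - x\<^sub>2 + c\<close>, and the two expansions of its inverse: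
  \<open>\<Sum>\<^sub>i (-c)\<^sup>i (x\<^sub>1 - x\<^sub>2)\<^sup>-\<^sup>i\<^sup>-\<^sup>1 \<in> \<complex>[x\<^sub>2][[x\<^sub>1\<inverse>]]\<close> and
  \<open>\<Sum>\<^sub>i c\<^sup>-\<^sup>i\<^sup>-\<^sup>1 (x\<^sub>2 - x\<^sub>1)\<^sup>i \<in> \<complex>[[x\<^sub>1, x\<^sub>2]]\<close>. In each coefficient at most one \<open>i\<close> contributes.\<close>

definition lin_ser :: "complex \<Rightarrow> complex series2" where
  "lin_ser c = (\<lambda>i j. binom_ser (-1) 1 i j + (if i = 0 \<and> j = 0 then c else 0))"

definition inv_lin_inf :: "complex \<Rightarrow> complex series2" where
  "inv_lin_inf c = (\<lambda>m n. Sum_any (\<lambda>i::nat. (- c) ^ i * binom_ser (-1) (- int i - 1) m n))"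

definition inv_lin_zero :: "complex \<Rightarrow> complex series2" where
  "inv_lin_zero c = (\<lambda>m n. Sum_any (\<lambda>i::nat. inverse c ^ (i + 1) * binom_ser (-1) (int i) n m))"

text \<open>\<open>(x\<^sub>1 - x\<^sub>2 + a) / (x\<^sub>1 - x\<^sub>2 + b)\<close>\<close>

definition ratio_inf :: "complex \<Rightarrow> complex \<Rightarrow> complex series2" where
  "ratio_inf a b = ser_mult (*) (lin_ser a) (inv_lin_inf b)"

definition ratio_zero :: "complex \<Rightarrow> complex \<Rightarrow> complex series2" where
  "ratio_zero a b = ser_mult (*) (lin_ser a) (inv_lin_zero b)"

text \<open>\<open>c x\<^sub>1\<inverse> \<delta>(x\<^sub>2 / x\<^sub>1)\<close>\<close>

definition delta_ser :: "complex \<Rightarrow> complex series2" where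
  "delta_ser c = (\<lambda>m n. if m = - n - 1 then c else 0)"

text \<open>The six defining relations as pairs (left-hand side, right-hand side). Both families have the
  same shape; \<open>r a b\<close> is the respective expansion of \<open>(x\<^sub>1 - x\<^sub>2 + a) / (x\<^sub>1 - x\<^sub>2 + b)\<close>, and \<open>\<epsilon>\<close>
  is the sign of the delta function.\<close>

definition DY_rels :: "(complex \<Rightarrow> complex \<Rightarrow> complex series2) \<Rightarrow> complex \<Rightarrow> complex \<Rightarrow>
   (complex \<Rightarrow> 'w::ab_group_add \<Rightarrow> 'w) \<Rightarrow> (T \<Rightarrow> 'w \<Rightarrow> 'w) \<Rightarrow>
   (('w \<Rightarrow> 'w series2) \<times> ('w \<Rightarrow> 'w series2)) set" where
  "DY_rels r \<epsilon> q s act =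
    (let e = current act E; f = current act F; h = current act H in
     {(op_prod e e, \<lambda>w. ser_mult s (r q (- q)) (op_rev_prod e e w)),
      (op_prod f f, \<lambda>w. ser_mult s (r (- q) q) (op_rev_prod f f w)),
      (\<lambda>w m n. op_prod e f w m n - op_rev_prod f e w m n,
       \<lambda>w. ser_mult s (delta_ser \<epsilon>) (\<lambda>m n. if m = 0 then h w n else 0)),
      (op_prod h h, op_rev_prod h h),
      (op_prod h e, \<lambda>w. ser_mult s (r q (- q)) (op_rev_prod e h w)),
      (op_prod h f, \<lambda>w. ser_mult s (r (- q) q) (op_rev_prod f h w))})"

definition DY_inf_module :: "complex \<Rightarrow> (complex \<Rightarrow> 'w::ab_group_add \<Rightarrow> 'w) \<Rightarrow> (T \<Rightarrow> 'w \<Rightarrow> 'w) \<Rightarrow> bool" where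
  "DY_inf_module q s act \<longleftrightarrow>
     T_module s act \<and>
     (\<forall>w. \<exists>N. \<forall>n<N. \<forall>u. act (gen u n) w = 0) \<and>
     (\<forall>(L, R) \<in> DY_rels ratio_inf (-1) q s act. L = R)"


section \<open>The vertex algebra \<open>V\<^sub>q\<close>\<close>

text \<open>\<open>Vq_kernel q\<close> is the submodule of \<open>T / J\<close> generated by all coefficients of the defining
  relations of \<open>DY\<^sub>q(sl\<^sub>2)\<close>-modules. The right-hand sides make sense on \<open>T / J\<close> because there
  \<open>u(n) w = 0\<close> for \<open>n\<close> large.\<close>

definition TJ_submodule :: "TJ set \<Rightarrow> bool" where
  "TJ_submodule N \<longleftrightarrow> 0 \<in> N \<and> (\<forall>x\<in>N. \<forall>y\<in>N. x + y \<in> N) \<and> (\<forall>a. \<forall>x\<in>N. TJ_act a x \<in> N)"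

definition Vq_kernel :: "complex \<Rightarrow> TJ set" where
  "Vq_kernel q = TJ_submodule hull
     {L w m n - R w m n | L R w m n. (L, R) \<in> DY_rels ratio_zero 1 q TJ_scale TJ_act}"

text \<open>Since \<open>Vq_kernel q\<close> depends on \<open>q\<close>, the quotient of \<open>T / J\<close> by it cannot be introduced as a
  type. \<open>is_Vq q s act pr\<close> says that the \<open>T\<close>-module \<open>(s, act)\<close> on \<open>'v\<close> is this quotient, with
  projection \<open>pr\<close>; its vacuum vector is \<open>pr TJ_one\<close>.\<close>

definition is_Vq :: "complex \<Rightarrow> (complex \<Rightarrow> 'v::ab_group_add \<Rightarrow> 'v) \<Rightarrow> (T \<Rightarrow> 'v \<Rightarrow> 'v) \<Rightarrow> (TJ \<Rightarrow> 'v) \<Rightarrow> bool" where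
  "is_Vq q s act pr \<longleftrightarrow>
     T_module s act \<and>
     Vector_Spaces.linear TJ_scale s pr \<and>
     (\<forall>a x. pr (TJ_act a x) = act a (pr x)) \<and>
     surj pr \<and> {x. pr x = 0} = Vq_kernel q"

text \<open>The image \<open>u(-1)\<^bold>1\<close> of \<open>u \<in> {e, f, h}\<close> in \<open>V\<^sub>q\<close>.\<close>

definition Vq_gen :: "(T \<Rightarrow> 'v \<Rightarrow> 'v) \<Rightarrow> (TJ \<Rightarrow> 'v) \<Rightarrow> sl2_gen \<Rightarrow> 'v" where
  "Vq_gen act pr u = act (gen u (-1)) (pr TJ_one)"

end

theory Submission
  imports Defs
begin

text \<open>A field on \<open>W\<close> is an element of \<open>Hom(W, W((x\<inverse>)))\<close>. If \<open>(x\<^sub>1 - x\<^sub>2)\<^sup>k a(x\<^sub>1) b(x\<^sub>2)\<close> is bounded,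
  then expanding it at \<open>x\<^sub>1 = x\<^sub>2 + x\<^sub>0\<close> and dividing by \<open>x\<^sub>0\<^sup>k\<close> gives products \<open>a\<^sub>n b\<close>, and the axioms
  of a module at infinity say that \<open>Y\<^sub>W\<close> is a homomorphism for these products. Starting from the
  identity field, the modes of \<open>e(x), f(x), h(x)\<close> generate a space of fields on which they satisfy
  the relations of \<open>DY\<^sub>q(sl\<^sub>2)\<close>: a relation on \<open>W\<close> between products of currents is applied
  to a third field and expanded in both variables around the third one. Words of positive degree kill the
  identity field, as one sees by moving a letter of nonnegative degree to the right, so the
  universal property of \<open>V\<^sub>q\<close> yields a map \<open>\<phi>\<close> from \<open>V\<^sub>q\<close> to fields which is compatible with the
  modes of the generators. That \<open>\<phi>\<close> respects \<open>Y(u, x)\<close> for all \<open>u\<close> follows by induction on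
  \<open>u\<close> from the weak associativity of \<open>V\<^sub>q\<close>, since the two expansions of a triple product agree up to
  powers of \<open>x\<^sub>0 + x\<^sub>2\<close>, which can be cancelled. Uniqueness holds because the generators generate \<open>V\<^sub>q\<close>.\<close>

text \<open>On \<open>W\<close> the coefficients of the relations are expanded in x1^-1, for
  \<open>V_q\<close> in nonnegative powers of both variables, so no relation can be transported as
  it stands. What survives is the identity with the denominator x1 - x2 + b cleared. After expansion
  about a third field it may be divided again, because b is q or -q, hence nonzero, and the modes
  are bounded below. The sign of the delta function changes as well: a(x1) b(x2) w has powers of x2
  bounded above, which is the region |x2| > |x1|, opposite to that of products in
  \<open>V_q\<close>, so the residue at x1 = x2 changes its sign. The main obstacle is that iterated
  products have to exist: a product of fields must again have a finite pole against every current,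
  uniformly in the vector. A mere bound on pole orders is not visibly inherited, since the relations
  work in one direction only. The stronger property \<open>passes\<close>, which tests a pair on
  Laurent polynomials in the variable of the left field instead of single vectors, is inherited
  (\<open>passes_fprod\<close>).\<close>

section \<open>Sums of finitely supported families\<close>

lemma finite_supp_mono: "finite {a. f a \<noteq> 0} \<Longrightarrow> (\<And>a. f a = 0 \<Longrightarrow> g a = 0) \<Longrightarrow> finite {a. g a \<noteq> 0}"
  by (erule rev_finite_subset) auto

lemma Sum_any_diff:
  fixes f g :: "'a \<Rightarrow> 'b::ab_group_add"
  assumes "finite {a. f a \<noteq> 0}" "finite {a. g a \<noteq> 0}"
  shows "Sum_any (\<lambda>a. f a - g a) = Sum_any f - Sum_any g"
proof -
  have "Sum_any (\<lambda>a. (f a - g a) + g a) = Sum_any (\<lambda>a. f a - g a) + Sum_any g"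
    using assms by (intro Sum_any.distrib) (auto intro: finite_subset[OF _ finite_UnI[OF assms]])
  then show ?thesis by simp
qed

lemma Sum_any_additive:
  assumes "finite {a. g a \<noteq> 0}" "\<And>x y. f (x + y) = f x + f y" "f 0 = 0"
  shows "f (Sum_any g) = Sum_any (\<lambda>a. f (g a))"
proof -
  have "f (sum g A) = (\<Sum>a\<in>A. f (g a))" if "finite A" for A
    using that by (induction A) (simp_all add: assms)
  moreover have "{a. f (g a) \<noteq> 0} \<subseteq> {a. g a \<noteq> 0}" using assms(3) by auto
  ultimately show ?thesis
    using assms(1) by (simp add: Sum_any.expand_superset[OF assms(1)])
qed

lemma Sum_any_shift: "Sum_any (\<lambda>j::int. g (j + c)) = Sum_any g"
  by (rule Sum_any.reindex_cong[of "\<lambda>j. j + c", symmetric])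
    (auto simp: fun_eq_iff bij_plus_right)

lemma Sum_any_superset: "finite A \<Longrightarrow> (\<And>x. x \<notin> A \<Longrightarrow> g x = 0) \<Longrightarrow> Sum_any g = sum g A"
  by (rule Sum_any.expand_superset) auto

lemma Sum_any_shift_prod:
  fixes g :: "int \<times> int \<Rightarrow> 'b::ab_group_add"
  shows "Sum_any (\<lambda>x. g (fst x - c, snd x - d)) = Sum_any g"
  by (rule Sum_any.reindex_cong[of "\<lambda>x. (fst x - c, snd x - d)", symmetric])
    (auto simp: fun_eq_iff intro!: bij_betw_byWitness[where f' = "\<lambda>x. (fst x + c, snd x + d)"])

text \<open>Neither end has to vanish: when \<open>x\<close> is eventually constant both ways, the
  differences have finite support and sum to the jump. Residues are computed this way, the jump
  being a commutator.\<close>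

lemma Sum_any_telescope:
  fixes x :: "int \<Rightarrow> 'b::ab_group_add"
  assumes "\<And>j. j < lo \<Longrightarrow> x j = a" "\<And>j. j \<ge> hi \<Longrightarrow> x j = b"
  shows "Sum_any (\<lambda>j. x (j - 1) - x j) = a - b"
proof -
  have "(\<Sum>j\<in>{lo..<lo + int n}. x (j - 1) - x j) = x (lo - 1) - x (lo + int n - 1)" for n
  proof (induction n)
    case (Suc n)
    have "{lo..<lo + int (Suc n)} = insert (lo + int n) {lo..<lo + int n}" by auto
    with Suc show ?case by (simp add: algebra_simps)
  qed simp
  \<comment> \<open>The extra 1 makes the last index \<open>lo + int n - 1\<close> reach
    \<open>hi\<close>, also when \<open>hi < lo\<close>.\<close>
  from this[of "nat (hi - lo) + 1"]
  have "(\<Sum>j\<in>{lo..<lo + int (nat (hi - lo) + 1)}. x (j - 1) - x j) = a - b"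
    using assms by (simp add: algebra_simps)
  moreover have "x (j - 1) - x j = 0" if "j \<notin> {lo..<lo + int (nat (hi - lo) + 1)}" for j
    using that assms(1)[of j] assms(1)[of "j - 1"] assms(2)[of j] assms(2)[of "j - 1"]
    by (cases "j < lo") (auto split: if_splits)
  then have "{j. x (j - 1) - x j \<noteq> 0} \<subseteq> {lo..<lo + int (nat (hi - lo) + 1)}" by blast
  ultimately show ?thesis
    by (subst Sum_any.expand_superset[of "{lo..<lo + int (nat (hi - lo) + 1)}"]) auto
qed


section \<open>Multiplication by differences of variables\<close>

text \<open>Multiplication by x1 - x2, and by x1 + x2 in \<open>pm\<close>. Written with shifts,
  they act on every double series without any summability condition; \<open>ser_mult_dm\<close> and
  \<open>ser_mult_pm\<close> match their powers with \<open>binom_ser\<close>.\<close>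

definition dm :: "'u::ab_group_add series2 \<Rightarrow> 'u series2" where
  "dm A = (\<lambda>m n. A (m - 1) n - A m (n - 1))"

definition pm :: "'u::ab_group_add series2 \<Rightarrow> 'u series2" where
  "pm A = (\<lambda>m n. A (m - 1) n + A m (n - 1))"

lemma dm_pow_diff: "(dm ^^ k) (\<lambda>m n. A m n - B m n) = (\<lambda>m n. (dm ^^ k) A m n - (dm ^^ k) B m n)"
  by (induction k) (simp_all add: dm_def algebra_simps fun_eq_iff)

lemma dm_pow_map:
  assumes "\<And>x y. f (x - y) = f x - f y"
  shows "(dm ^^ k) (\<lambda>m n. f (A m n)) = (\<lambda>m n. f ((dm ^^ k) A m n))"
  by (induction k) (simp_all add: dm_def fun_eq_iff assms)

lemma dm_pow_shift:
  "(dm ^^ k) (\<lambda>m n. A (m - a) (n - b)) = (\<lambda>m n. (dm ^^ k) A (m - a) (n - b))"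
  by (induction k) (simp_all add: dm_def fun_eq_iff algebra_simps)

lemma dm_pow_vanish1: "(\<And>m n. m > N \<Longrightarrow> A m n = 0) \<Longrightarrow> m > N + int k \<Longrightarrow> (dm ^^ k) A m n = 0"
  by (induction k arbitrary: m n) (simp_all add: dm_def)

lemma dm_pow_vanish2: "(\<And>m n. n > N \<Longrightarrow> A m n = 0) \<Longrightarrow> n > N + int k \<Longrightarrow> (dm ^^ k) A m n = 0"
  by (induction k arbitrary: m n) (simp_all add: dm_def)

lemma pm_pow_diff: "(pm ^^ k) (\<lambda>m n. A m n - B m n) = (\<lambda>m n. (pm ^^ k) A m n - (pm ^^ k) B m n)"
  by (induction k) (simp_all add: pm_def algebra_simps fun_eq_iff)

lemma pm_pow_map:
  assumes "\<And>x y. f (x + y) = f x + f y"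
  shows "(pm ^^ k) (\<lambda>m n. f (A m n)) = (\<lambda>m n. f ((pm ^^ k) A m n))"
  by (induction k) (simp_all add: pm_def fun_eq_iff assms)

lemma pm_pow_shift:
  "(pm ^^ k) (\<lambda>m n. A (m - a) (n - b)) = (\<lambda>m n. (pm ^^ k) A (m - a) (n - b))"
  by (induction k) (simp_all add: pm_def fun_eq_iff algebra_simps)

text \<open>A vanishing product with x1 + x2 gives \<open>B m (n - 1) = - B (m - 1) n\<close>, so
  each row is determined by the one before it, and the rows below \<open>m0\<close> are zero. The
  lower bound in x1 has to be uniform in the exponent of x2.\<close>

lemma pm_cancel:
  assumes low: "\<And>m n. m < m0 \<Longrightarrow> A m n = 0" and "(pm ^^ k) A = (\<lambda>m n. 0)"
  shows "A m n = 0"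
proof -
  have one: "B = (\<lambda>m n. 0)" if "\<And>m n. m < m0 \<Longrightarrow> B m n = 0" "pm B = (\<lambda>m n. 0)" for B :: "'a series2"
  proof -
    have rec: "B m (n - 1) = - B (m - 1) n" for m n
      using fun_cong[OF fun_cong[OF that(2), of m], of n] by (simp add: pm_def eq_neg_iff_add_eq_0 add.commute)
    have "\<forall>n. B (m0 + int i) n = 0" for i
    proof (induction i)
      case 0
      show ?case using rec[of m0 "_ + 1"] that(1)[of "m0 - 1"] by simp
    next
      case (Suc i)
      show ?case using rec[of "m0 + int (Suc i)" "_ + 1"] Suc by (simp add: algebra_simps)
    qed
    from this[of "nat (_ - m0)"] that(1) show ?thesis
      by (metis (no_types, opaque_lifting) add_diff_cancel_left' diff_add_cancel diff_ge_0_iff_ge int_nat_eq linorder_not_less add.commute)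
  qed
  have low': "(pm ^^ k) A m n = 0" if "m < m0" for k m n
    using that by (induction k arbitrary: m n) (simp_all add: pm_def low)
  have "A = (\<lambda>m n. 0)"
    using assms(2)
  proof (induction k)
    case (Suc k)
    have "(pm ^^ k) A = (\<lambda>m n. 0)"
      by (rule one) (use low' Suc.prems in auto)
    then show ?case by (rule Suc.IH)
  qed simp
  then show ?thesis by simp
qed


section \<open>Three variables\<close>

text \<open>Multiplication by y - x, y - z and x - z, where \<open>S i j n\<close> is the
  coefficient of y^i x^j z^n.\<close>

definition D12 :: "(int \<Rightarrow> 'u::ab_group_add series2) \<Rightarrow> int \<Rightarrow> 'u series2" where
  "D12 S = (\<lambda>i j n. S (i - 1) j n - S i (j - 1) n)"
definition D13 :: "(int \<Rightarrow> 'u::ab_group_add series2) \<Rightarrow> int \<Rightarrow> 'u series2" where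
  "D13 S = (\<lambda>i j n. S (i - 1) j n - S i j (n - 1))"
definition D23 :: "(int \<Rightarrow> 'u::ab_group_add series2) \<Rightarrow> int \<Rightarrow> 'u series2" where
  "D23 S = (\<lambda>i j n. S i (j - 1) n - S i j (n - 1))"

lemma D12_pow: "(D12 ^^ k) S = (\<lambda>i j n. (dm ^^ k) (\<lambda>i j. S i j n) i j)"
  by (induction k) (simp_all add: D12_def dm_def)
lemma D13_pow: "(D13 ^^ k) S = (\<lambda>i j n. (dm ^^ k) (\<lambda>i n. S i j n) i n)"
  by (induction k) (simp_all add: D13_def dm_def)
lemma D23_pow: "(D23 ^^ k) S = (\<lambda>i. (dm ^^ k) (S i))"
  by (induction k) (simp_all add: D23_def dm_def)

lemma funpow_swap: "(\<And>x. f (g x) = g (f x)) \<Longrightarrow> (f ^^ k) ((g ^^ l) x) = (g ^^ l) ((f ^^ k) x)"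
  for f g :: "'a \<Rightarrow> 'a"
proof (induction k)
  case (Suc k)
  have "f ((g ^^ l) y) = (g ^^ l) (f y)" for y
    by (induction l) (simp_all add: Suc.prems)
  with Suc show ?case by simp
qed simp

lemma D12_D13: "D12 (D13 S) = D13 (D12 S)"
  and D12_D23: "D12 (D23 S) = D23 (D12 S)"
  and D13_D23: "D13 (D23 S) = D23 (D13 S)"
  by (simp_all add: D12_def D13_def D23_def fun_eq_iff algebra_simps)

definition bdd3 :: "(int \<Rightarrow> 'u::zero series2) \<Rightarrow> bool" where
  "bdd3 G \<longleftrightarrow> (\<exists>N. \<forall>i j n. i > N \<or> j > N \<or> n > N \<longrightarrow> G i j n = 0)"


text \<open>The y-degree is bounded only after clearing the poles along y = x and y = z, the degrees
  in x and z only after clearing x = z. Since the multiplications commute, both bounds hold for the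
  full product; clearing y = x and y = z costs at most \<open>a + b\<close> in x and z.\<close>

lemma bdd3I:
  assumes y: "\<And>i j n. i > N \<Longrightarrow> (D12 ^^ a) ((D13 ^^ b) S) i j n = 0"
    and xz: "\<And>i j n. j > M \<or> n > M \<Longrightarrow> (D23 ^^ c) S i j n = 0"
  shows "bdd3 ((D12 ^^ a) ((D13 ^^ b) ((D23 ^^ c) S)))"
proof -
  have 1: "(D12 ^^ a) ((D13 ^^ b) ((D23 ^^ c) S)) = (D23 ^^ c) ((D12 ^^ a) ((D13 ^^ b) S))"
    by (simp add: funpow_swap[of D12 D23, OF D12_D23] funpow_swap[of D13 D23, OF D13_D23])
  have v1: "(D12 ^^ a) ((D13 ^^ b) ((D23 ^^ c) S)) i j n = 0" if "i > N" for i j n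
  proof -
    have "(D23 ^^ c) K i j n = 0" if "\<And>j n. K i j n = 0" for K :: "int \<Rightarrow> 'a series2" and c i j n
      using that by (induction c arbitrary: j n) (simp_all add: D23_def)
    with y that show ?thesis unfolding 1 by blast
  qed
  have v2: "(D12 ^^ a) ((D13 ^^ b) ((D23 ^^ c) S)) i j n = 0" if "j > M + int a + int b \<or> n > M + int a + int b" for i j n
  proof -
    have b: "(D13 ^^ b) K i j n = 0" if "\<And>i j n. j > M \<or> n > M \<Longrightarrow> K i j n = 0" "j > M + int b \<or> n > M + int b"
      for K :: "int \<Rightarrow> 'a series2" and M b i j n
      using that by (induction b arbitrary: i j n) (auto simp: D13_def)
    have a: "(D12 ^^ b) K i j n = 0" if "\<And>i j n. j > M \<or> n > M \<Longrightarrow> K i j n = 0" "j > M + int b \<or> n > M + int b"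
      for K :: "int \<Rightarrow> 'a series2" and M b i j n
      using that by (induction b arbitrary: i j n) (auto simp: D12_def)
    show ?thesis
      by (rule a[where M = "M + int b"]) (use b[OF xz] that in \<open>auto simp: algebra_simps\<close>)
  qed
  show ?thesis unfolding bdd3_def
    by (rule exI[of _ "max N (M + int a + int b)"]) (use v1 v2 in auto)
qed


section \<open>Poles along the diagonal\<close>

text \<open>A pole of order at most \<open>k\<close> along x1 = x2. \<open>A\<close> itself may have
  unbounded exponents; only the cleared series is bounded. The order is kept as a parameter because
  it must be uniform in the vector later.\<close>

definition merk :: "nat \<Rightarrow> 'u::ab_group_add series2 \<Rightarrow> bool" where
  "merk k A \<longleftrightarrow> laurent_inf2 ((dm ^^ k) A)"

definition mer :: "'u::ab_group_add series2 \<Rightarrow> bool" where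
  "mer A \<longleftrightarrow> (\<exists>k. merk k A)"

lemma laurent_inf2I: "(\<And>m n. m > N \<Longrightarrow> A m n = 0) \<Longrightarrow> (\<And>m n. n > M \<Longrightarrow> A m n = 0) \<Longrightarrow> laurent_inf2 A"
  unfolding laurent_inf2_def by (intro exI[of _ "max N M"]) auto

lemma laurent_inf2_diff: "laurent_inf2 A \<Longrightarrow> laurent_inf2 B \<Longrightarrow> laurent_inf2 (\<lambda>m n. A m n - B m n)"
  for A :: "'u::ab_group_add series2"
  unfolding laurent_inf2_def
proof (elim exE)
  fix M N assume "\<forall>m n. m > M \<or> n > M \<longrightarrow> A m n = 0" "\<forall>m n. m > N \<or> n > N \<longrightarrow> B m n = 0"
  then show "\<exists>N. \<forall>m n. m > N \<or> n > N \<longrightarrow> A m n - B m n = 0" by (intro exI[of _ "max M N"]) simp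
qed

lemma laurent_inf2_shift: "laurent_inf2 A \<Longrightarrow> laurent_inf2 (\<lambda>m n. A (m - a) (n - b))"
  unfolding laurent_inf2_def
proof (elim exE)
  fix N assume "\<forall>m n. m > N \<or> n > N \<longrightarrow> A m n = 0"
  then show "\<exists>N. \<forall>m n. m > N \<or> n > N \<longrightarrow> A (m - a) (n - b) = 0"
    by (intro exI[of _ "max (N + a) (N + b)"]) auto
qed

lemma laurent_inf2_map: "f 0 = 0 \<Longrightarrow> laurent_inf2 A \<Longrightarrow> laurent_inf2 (\<lambda>m n. f (A m n))"
  unfolding laurent_inf2_def by metis

lemma laurent_inf2_dm: "laurent_inf2 A \<Longrightarrow> laurent_inf2 (dm A)"
  using laurent_inf2_diff[OF laurent_inf2_shift[of A 1 0] laurent_inf2_shift[of A 0 1]]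
  by (simp add: dm_def)

lemma merk_mono: "merk k A \<Longrightarrow> k \<le> l \<Longrightarrow> merk l A"
proof (induction l)
  case (Suc l)
  then show ?case
    by (cases "k = Suc l") (auto simp: merk_def intro: laurent_inf2_dm)
qed simp

lemma merk_diff: "merk k A \<Longrightarrow> merk k B \<Longrightarrow> merk k (\<lambda>m n. A m n - B m n)"
  by (simp add: merk_def dm_pow_diff laurent_inf2_diff)

lemma merk_shift: "merk k A \<Longrightarrow> merk k (\<lambda>m n. A (m - a) (n - b))"
  by (simp add: merk_def dm_pow_shift laurent_inf2_shift)

lemma merk_map: "(\<And>x y. f (x - y) = f x - f y) \<Longrightarrow> merk k A \<Longrightarrow> merk k (\<lambda>m n. f (A m n))"
proof -
  assume *: "\<And>x y. f (x - y) = f x - f y" and "merk k A"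
  have "f 0 = 0" using *[of 0 0] by simp
  with * \<open>merk k A\<close> show ?thesis by (simp add: merk_def dm_pow_map laurent_inf2_map)
qed

lemma merk_dm: "merk k (dm A) \<longleftrightarrow> merk (Suc k) A"
  by (simp add: merk_def funpow_swap1)

lemma mer_diff: "mer A \<Longrightarrow> mer B \<Longrightarrow> mer (\<lambda>m n. A m n - B m n)"
  unfolding mer_def using merk_diff[OF merk_mono merk_mono] by (metis max.cobounded1 max.cobounded2)

lemma merk_uminus: "merk k A \<Longrightarrow> merk k (\<lambda>m n. - A m n)"
  by (rule merk_map) auto

lemma merk_add: "merk k A \<Longrightarrow> merk k B \<Longrightarrow> merk k (\<lambda>m n. A m n + B m n)"
  using merk_diff[of k A "\<lambda>m n. - B m n"] merk_uminus[of k B] by simp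

lemma mer_add: "mer A \<Longrightarrow> mer B \<Longrightarrow> mer (\<lambda>m n. A m n + B m n)"
  unfolding mer_def using merk_add[OF merk_mono merk_mono] by (metis max.cobounded1 max.cobounded2)

lemma mer_shift: "mer A \<Longrightarrow> mer (\<lambda>m n. A (m - a) (n - b))"
  unfolding mer_def using merk_shift by blast

lemma mer_shift1: "mer A \<Longrightarrow> mer (\<lambda>m n. A (m - 1) n)"
  and mer_shift2: "mer A \<Longrightarrow> mer (\<lambda>m n. A m (n - 1))"
  using mer_shift[of A 1 0] mer_shift[of A 0 1] by simp_all

lemma mer_dm: "mer (dm A) \<longleftrightarrow> mer A"
  unfolding mer_def merk_dm by (meson merk_mono lessI less_imp_le)

section \<open>Taylor expansion along the diagonal\<close>

text \<open>The coefficient of x0^R z^(m-R) in (z + x0)^m, extended by zero to negative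
  \<open>R\<close> so that Pascal's rule holds for all integers.\<close>

definition ib :: "int \<Rightarrow> int \<Rightarrow> complex" where
  "ib m R = (if R < 0 then 0 else of_int m gchoose nat R)"

lemma ib_neg [simp]: "R < 0 \<Longrightarrow> ib m R = 0"
  by (simp add: ib_def)

lemma ib_pascal: "ib (m + 1) R = ib m R + ib m (R - 1)"
proof -
  consider "R < 0" | "R = 0" | k where "R = int (Suc k)"
    by (metis int_nat_eq linorder_not_less nat_0_iff not0_implies_Suc order_le_less zero_less_nat_eq of_nat_0)
  then show ?thesis
  proof cases
    case 3
    then show ?thesis using gbinomial_Suc_Suc[of "of_int m :: complex" k]
      by (simp add: ib_def nat_add_distrib add.commute)
  qed (simp_all add: ib_def)
qed

text \<open>Coefficient form of y d/dy = (z + x0) d/dx0 under y = z + x0.\<close>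

lemma ib_mult: "of_int m * ib m R = of_int (R + 1) * ib m (R + 1) + of_int R * ib m R"
proof (cases "R < 0")
  case True
  then show ?thesis by (cases "R = - 1") (auto simp: ib_def)
next
  case False
  then obtain k where k: "R = int k" by (metis nonneg_int_cases linorder_not_less)
  show ?thesis
    using gbinomial_mult_1[of "of_int m :: complex" k]
    by (simp add: k ib_def nat_add_distrib algebra_simps)
qed

text \<open>Trinomial revision pulls out \<open>ib i m\<close>, and Vandermonde sums the rest. Up to
  a power of z, both sides are the coefficient of x0^m x2^n in (z + x2 + x0)^i (z + x2)^k; the left
  side expands in p = x0 + x2 before splitting p.\<close>

lemma ib_trinomial:
  assumes "m \<ge> 0"
  shows "(\<Sum>j\<le>n. (of_int (m + int j) gchoose j) * (ib i (m + int j) * ib k (int n - int j))) =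
    ib i m * ib (i + k - m) (int n)"
proof -
  have "(of_int (m + int j) gchoose j) * (ib i (m + int j) * ib k (int n - int j)) =
      ib i m * ((of_int (i - m) gchoose j) * (of_int k gchoose (n - j)))" if "j \<le> n" for j
  proof -
    have "(of_int i gchoose (nat m + j)) * (of_nat (nat m + j) gchoose j) =
       ((of_int i :: complex) gchoose nat m) * (of_int i - of_nat (nat m) gchoose j)"
    proof -
      have "(of_nat (nat m + j) gchoose j :: complex) = of_nat (nat m + j) gchoose nat m"
        unfolding binomial_gbinomial[symmetric] using binomial_symmetric[of j "nat m + j"] by simp
      then show ?thesis
        using gbinomial_trinomial_revision[of "nat m" "nat m + j" "of_int i :: complex"] by simp
    qed
    then show ?thesis using assms that
      by (simp add: ib_def nat_add_distrib of_nat_diff nat_diff_distrib algebra_simps)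
  qed
  then have "(\<Sum>j\<le>n. (of_int (m + int j) gchoose j) * (ib i (m + int j) * ib k (int n - int j))) =
     ib i m * (\<Sum>j\<le>n. (of_int (i - m) gchoose j) * (of_int k gchoose (n - j)))"
    by (simp add: sum_distrib_left)
  also have "(\<Sum>j\<le>n. ((of_int (i - m) :: complex) gchoose j) * (of_int k gchoose (n - j))) = ib (i + k - m) (int n)"
    using gbinomial_Vandermonde[of "of_int (i - m) :: complex" "of_int k" n]
    by (simp add: ib_def atLeast0AtMost algebra_simps)
  finally show ?thesis .
qed

locale cvec = vector_space s for s :: "complex \<Rightarrow> 'w::ab_group_add \<Rightarrow> 'w"
begin

text \<open>The substitution x1 = x2 + x0 in a bounded series, one binomial expansion per power of
  x1; \<open>shift_subst_tay0\<close> identifies it with exp(x0 d/dx1) restricted to the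
  diagonal.\<close>

definition tay0 :: "'w series2 \<Rightarrow> 'w series2" where
  "tay0 A = (\<lambda>R n. Sum_any (\<lambda>j. s (ib j R) (A j (n + R - j))))"

text \<open>\<open>tay A R n\<close> is the coefficient of \<open>x\<^sub>0\<^sup>R z\<^sup>n\<close> in \<open>A(z + x\<^sub>0, z)\<close>, where \<open>A\<close> may have a pole at
  \<open>x\<^sub>1 = x\<^sub>2\<close>: if \<open>(x\<^sub>1 - x\<^sub>2)\<^sup>k A\<close> is bounded then its expansion is divided by \<open>x\<^sub>0\<^sup>k\<close>.\<close>

definition tay :: "'w series2 \<Rightarrow> 'w series2" where
  "tay A = (\<lambda>R n. let k = (SOME k. merk k A) in tay0 ((dm ^^ k) A) (R + int k) n)"

lemma tay0_finite: "laurent_inf2 A \<Longrightarrow> finite {j. s (c j) (A j (d - j)) \<noteq> 0}"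
  unfolding laurent_inf2_def
proof (elim exE)
  fix N assume N: "\<forall>m n. m > N \<or> n > N \<longrightarrow> A m n = 0"
  show ?thesis
    by (rule finite_subset[of _ "{d - N..N}"]) (use N in \<open>auto simp: not_less[symmetric]\<close>)
qed

text \<open>After the substitution x1 - x2 is x0; in coefficients this is Pascal's rule.\<close>

lemma tay0_dm:
  assumes "laurent_inf2 A"
  shows "tay0 (dm A) R n = tay0 A (R - 1) n"
proof -
  define t where "t j = A j (n + R - 1 - j)" for j
  have fin: "finite {j. s (c j) (t j) \<noteq> 0}" for c
    unfolding t_def by (rule tay0_finite[OF assms])
  have fin1: "finite {j. s (c j) (t (j - 1)) \<noteq> 0}" for c
  proof -
    have "{j. s (c j) (t (j - 1)) \<noteq> 0} = (\<lambda>j. j + 1) ` {j. s (c (j + 1)) (t j) \<noteq> 0}"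
      by (force simp: image_iff)
    then show ?thesis using fin by simp
  qed
  have "tay0 (dm A) R n = Sum_any (\<lambda>j. s (ib j R) (t (j - 1)) - s (ib j R) (t j))"
    by (simp add: tay0_def dm_def t_def scale_right_diff_distrib algebra_simps)
  also have "\<dots> = Sum_any (\<lambda>j. s (ib j R) (t (j - 1))) - Sum_any (\<lambda>j. s (ib j R) (t j))"
    by (rule Sum_any_diff[OF fin1 fin])
  also have "Sum_any (\<lambda>j. s (ib j R) (t (j - 1))) = Sum_any (\<lambda>j. s (ib (j + 1) R) (t j))"
    using Sum_any_shift[of "\<lambda>j. s (ib j R) (t (j - 1))" 1] by simp
  also have "\<dots> - Sum_any (\<lambda>j. s (ib j R) (t j)) =
      Sum_any (\<lambda>j. s (ib (j + 1) R) (t j) - s (ib j R) (t j))"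
    by (rule Sum_any_diff[OF fin fin, symmetric])
  also have "\<dots> = tay0 A (R - 1) n"
    by (simp add: tay0_def t_def ib_pascal algebra_simps)
  finally show ?thesis .
qed

lemma tay0_dm_pow: "laurent_inf2 A \<Longrightarrow> tay0 ((dm ^^ k) A) (R + int k) n = tay0 A R n"
proof (induction k arbitrary: R)
  case (Suc k)
  have "laurent_inf2 ((dm ^^ k) A)" using Suc.prems by (induction k) (simp_all add: laurent_inf2_dm)
  then show ?case using Suc by (simp add: tay0_dm algebra_simps)
qed simp

text \<open>The choice of \<open>k\<close> does not matter: each further factor x1 - x2 shifts the
  expansion by one power of x0, and the division by x0^k undoes the shift.\<close>

lemma tay_eq:
  assumes "merk k A"
  shows "tay A R n = tay0 ((dm ^^ k) A) (R + int k) n"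
proof -
  have *: "tay0 ((dm ^^ l) A) (R + int l) n = tay0 ((dm ^^ k) A) (R + int k) n"
    if "merk k A" "k \<le> l" for k l
  proof -
    have "(dm ^^ l) A = (dm ^^ (l - k)) ((dm ^^ k) A)"
      using that(2) by (metis comp_apply funpow_add le_add_diff_inverse2)
    moreover have "R + int l = (R + int k) + int (l - k)" using that(2) by simp
    ultimately show ?thesis
      using tay0_dm_pow[of "(dm ^^ k) A" "l - k" "R + int k"] that by (simp only: merk_def)
  qed
  define l where "l = (SOME k. merk k A)"
  have "merk l A" unfolding l_def by (rule someI[of "\<lambda>k. merk k A", OF assms])
  then have "tay0 ((dm ^^ l) A) (R + int l) n = tay0 ((dm ^^ k) A) (R + int k) n"
    using *[of l k] *[of k l] assms by (cases "l \<le> k") auto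
  then show ?thesis by (simp add: tay_def l_def)
qed

lemma tay_eq_tay0: "laurent_inf2 A \<Longrightarrow> tay A = tay0 A"
  by (intro ext) (simp add: tay_eq[of 0] merk_def)

lemma tay_low: "merk k A \<Longrightarrow> R < - int k \<Longrightarrow> tay A R n = 0"
  by (simp add: tay_eq tay0_def)

text \<open>Substitution preserves the total degree, which is at most \<open>2 * N\<close> for the
  cleared series.\<close>

lemma tay_bound: "merk k A \<Longrightarrow> (\<And>m n. m > N \<or> n > N \<Longrightarrow> (dm ^^ k) A m n = 0) \<Longrightarrow>
    n > 2 * N - R - int k \<Longrightarrow> tay A R n = 0"
proof -
  assume *: "merk k A" "\<And>m n. m > N \<or> n > N \<Longrightarrow> (dm ^^ k) A m n = 0" "n > 2 * N - R - int k"
  have "(dm ^^ k) A j (n + (R + int k) - j) = 0" for j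
    by (rule *(2)) (use *(3) in linarith)
  then show ?thesis using *(1) by (simp add: tay_eq tay0_def)
qed

lemma tay_upper: "mer A \<Longrightarrow> \<exists>M. \<forall>n>M. tay A R n = 0"
proof -
  assume "mer A"
  then obtain k where k: "merk k A" by (auto simp: mer_def)
  then obtain N where N: "\<And>m n. m > N \<or> n > N \<Longrightarrow> (dm ^^ k) A m n = 0"
    unfolding merk_def laurent_inf2_def by blast
  show ?thesis using tay_bound[OF k N] by blast
qed

lemma tay_dm: "mer A \<Longrightarrow> tay (dm A) R n = tay A (R - 1) n"
proof -
  assume "mer A"
  then obtain k where k: "merk k A" by (auto simp: mer_def)
  then have "merk k (dm A)" using merk_dm merk_mono le_SucI by blast
  then have "tay (dm A) R n = tay0 ((dm ^^ Suc k) A) (R + int k) n"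
    by (simp add: tay_eq funpow_swap1)
  also have "\<dots> = tay0 ((dm ^^ k) A) (R - 1 + int k) n"
    using k tay0_dm[of "(dm ^^ k) A" "R + int k"] by (simp add: merk_def algebra_simps)
  finally show ?thesis using k by (simp add: tay_eq)
qed

lemma tay_diff:
  assumes "mer A" "mer B"
  shows "tay (\<lambda>m n. A m n - B m n) R n = tay A R n - tay B R n"
proof -
  obtain k where k: "merk k A" "merk k B"
    using assms unfolding mer_def by (meson merk_mono max.cobounded1 max.cobounded2)
  show ?thesis
    unfolding tay_eq[OF k(1)] tay_eq[OF k(2)] tay_eq[OF merk_diff[OF k]] tay0_def dm_pow_diff
      scale_right_diff_distrib
    by (rule Sum_any_diff; rule tay0_finite) (use k in \<open>auto simp: merk_def\<close>)
qed

lemma tay_map: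
  assumes "Vector_Spaces.linear s s f" "mer A"
  shows "tay (\<lambda>m n. f (A m n)) R n = f (tay A R n)"
proof -
  interpret f: Vector_Spaces.linear s s f by fact
  obtain k where k: "merk k A" using assms(2) by (auto simp: mer_def)
  have "tay (\<lambda>m n. f (A m n)) R n = Sum_any (\<lambda>j. f (s (ib j (R + int k)) ((dm ^^ k) A j (n + (R + int k) - j))))"
    unfolding tay_eq[OF merk_map[of f, OF f.diff k]] tay0_def dm_pow_map[of f, OF f.diff] by (simp add: f.scale)
  also have "\<dots> = f (tay A R n)"
    unfolding tay_eq[OF k] tay0_def
    by (rule Sum_any_additive[symmetric]; (rule tay0_finite)?)
      (use k in \<open>simp_all add: f.add f.zero merk_def\<close>)
  finally show ?thesis .
qed

lemma linear_scale_s: "Vector_Spaces.linear s s (s c)"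
  by (simp add: Vector_Spaces.linear_iff vector_space_axioms scale_right_distrib mult.commute)

lemma linear_uminus: "Vector_Spaces.linear s s uminus"
  by (simp add: Vector_Spaces.linear_iff vector_space_axioms)

lemma tay_scale: "mer A \<Longrightarrow> tay (\<lambda>m n. s c (A m n)) R n = s c (tay A R n)"
  by (rule tay_map[OF linear_scale_s])

lemma mer_uminus: "mer A \<Longrightarrow> mer (\<lambda>m n. - A m n)"
  unfolding mer_def using merk_uminus by blast

lemma tay_add:
  assumes "mer A" "mer B"
  shows "tay (\<lambda>m n. A m n + B m n) R n = tay A R n + tay B R n"
  using tay_diff[OF assms(1) mer_uminus[OF assms(2)]] tay_map[OF linear_uminus assms(2)] by simp

lemma tay_zero [simp]: "tay (\<lambda>m n. 0) R n = 0"
  by (simp add: tay_eq_tay0 laurent_inf2_def tay0_def)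

lemma tay_shift2: "mer A \<Longrightarrow> tay (\<lambda>m n. A m (n - c)) R n = tay A R (n - c)"
proof -
  assume "mer A"
  then obtain k where k: "merk k A" by (auto simp: mer_def)
  show ?thesis
    unfolding tay_eq[OF k] tay_eq[OF merk_shift[OF k, of 0 c, simplified]]
    using dm_pow_shift[of k A 0 c] by (simp add: tay0_def algebra_simps)
qed

lemma tay_shift1: "mer A \<Longrightarrow> tay (\<lambda>m n. A (m - 1) n) R n = tay A R (n - 1) + tay A (R - 1) n"
proof -
  assume A: "mer A"
  have "tay (\<lambda>m n. dm A m n + A m (n - 1)) R n = tay A (R - 1) n + tay A R (n - 1)"
    using A by (simp add: tay_add mer_dm mer_shift2 tay_dm tay_shift2)
  then show ?thesis by (simp add: dm_def add.commute)
qed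

lemma mer_map: "Vector_Spaces.linear s s f \<Longrightarrow> mer A \<Longrightarrow> mer (\<lambda>m n. f (A m n))"
  unfolding mer_def using merk_map[of f] module_hom.diff[of s s f]
  by (metis module_hom_iff_linear)

text \<open>The operator x1 d/dx1 becomes (x2 + x0) d/dx0. It does not commute with clearing the
  pole, so the pole order is lowered one at a time: with \<open>B\<close> the weighted series, (x1 -
  x2) B is the weighted series of (x1 - x2) A minus x1 A.\<close>

lemma tay_mult_index:
  assumes "mer A"
  shows "mer (\<lambda>m n. s (of_int m) (A m n)) \<and>
    tay (\<lambda>m n. s (of_int m) (A m n)) R n = s (of_int (R + 1)) (tay A (R + 1) (n - 1)) + s (of_int R) (tay A R n)"
proof -
  have "\<forall>A. merk k A \<longrightarrow> mer (\<lambda>m n. s (of_int m) (A m n)) \<and>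
    (\<forall>R n. tay (\<lambda>m n. s (of_int m) (A m n)) R n =
       s (of_int (R + 1)) (tay A (R + 1) (n - 1)) + s (of_int R) (tay A R n))" for k
  proof (induction k)
    case 0
    show ?case
    proof (intro allI impI conjI)
      fix A :: "'w series2" and R n
      assume "merk 0 A"
      then have A: "laurent_inf2 A" by (simp add: merk_def)
      then have A': "laurent_inf2 (\<lambda>m n. s (of_int m) (A m n))" unfolding laurent_inf2_def by force
      then show "mer (\<lambda>m n. s (of_int m) (A m n))" by (auto simp: mer_def merk_def intro!: exI[of _ 0])
      have "tay0 (\<lambda>m n. s (of_int m) (A m n)) R n =
        Sum_any (\<lambda>j. s (of_int (R + 1)) (s (ib j (R + 1)) (A j (n + R - j))) + s (of_int R) (s (ib j R) (A j (n + R - j))))"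
        unfolding tay0_def using ib_mult[of _ R]
        by (simp add: mult.commute flip: scale_left_distrib)
      also have "\<dots> = Sum_any (\<lambda>j. s (of_int (R + 1)) (s (ib j (R + 1)) (A j (n + R - j)))) +
          Sum_any (\<lambda>j. s (of_int R) (s (ib j R) (A j (n + R - j))))"
        unfolding scale_scale by (intro Sum_any.distrib tay0_finite A)
      also have "Sum_any (\<lambda>j. s (of_int (R + 1)) (s (ib j (R + 1)) (A j (n + R - j)))) = s (of_int (R + 1)) (tay0 A (R + 1) (n - 1))"
        unfolding tay0_def
        using Sum_any_additive[of "\<lambda>j. s (ib j (R + 1)) (A j (n + R - j))" "s (of_int (R + 1))"] tay0_finite[OF A]
        by (simp add: scale_right_distrib algebra_simps)
      also have "Sum_any (\<lambda>j. s (of_int R) (s (ib j R) (A j (n + R - j)))) = s (of_int R) (tay0 A R n)"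
        unfolding tay0_def
        using Sum_any_additive[of "\<lambda>j. s (ib j R) (A j (n + R - j))" "s (of_int R)"] tay0_finite[OF A]
        by (simp add: scale_right_distrib)
      finally show "tay (\<lambda>m n. s (of_int m) (A m n)) R n =
         s (of_int (R + 1)) (tay A (R + 1) (n - 1)) + s (of_int R) (tay A R n)"
        by (simp add: tay_eq_tay0 A A')
    qed
  next
    case (Suc k)
    show ?case
    proof (intro allI impI)
      fix A :: "'w series2"
      assume A: "merk (Suc k) A"
      then have mA: "mer A" and dA: "merk k (dm A)" by (auto simp: mer_def merk_dm)
      then have mdA: "mer (dm A)" by (simp add: mer_dm)
      define B where "B = (\<lambda>m n. s (of_int m) (A m n))"
      have dB: "dm B = (\<lambda>m n. s (of_int m) (dm A m n) - A (m - 1) n)"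
        by (simp add: B_def dm_def fun_eq_iff scale_right_diff_distrib scale_left_diff_distrib algebra_simps)
      have IH: "mer (\<lambda>m n. s (of_int m) (dm A m n))"
        "tay (\<lambda>m n. s (of_int m) (dm A m n)) R n =
         s (of_int (R + 1)) (tay (dm A) (R + 1) (n - 1)) + s (of_int R) (tay (dm A) R n)" for R n
        using Suc dA by blast+
      have "mer (dm B)" unfolding dB by (intro mer_diff IH mer_shift1 mA)
      then have B: "mer B" by (simp add: mer_dm)
      have "tay B R n = s (of_int (R + 1)) (tay A (R + 1) (n - 1)) + s (of_int R) (tay A R n)" for R n
      proof -
        have "tay B R n = tay (dm B) (R + 1) n" using tay_dm[OF B, of "R + 1"] by simp
        also have "\<dots> = s (of_int (R + 2)) (tay (dm A) (R + 2) (n - 1)) + s (of_int (R + 1)) (tay (dm A) (R + 1) n)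
            - (tay A (R + 1) (n - 1) + tay A R n)"
          unfolding dB tay_diff[OF IH(1) mer_shift1[OF mA]] IH(2) tay_shift1[OF mA] by (simp add: algebra_simps)
        also have "\<dots> = s (of_int (R + 1)) (tay A (R + 1) (n - 1)) + s (of_int R) (tay A R n)"
        proof -
          have "of_int (R + 2) = of_int (R + 1) + (1 :: complex)" "of_int (R + 1) = of_int R + (1 :: complex)"
            by simp_all
          moreover have "R + 2 - 1 = R + 1" "R + 1 - 1 = R" by simp_all
          ultimately show ?thesis
            unfolding tay_dm[OF mA] by (simp only: scale_left_distrib scale_one) (simp add: algebra_simps)
        qed
        finally show ?thesis .
      qed
      with B show "mer (\<lambda>m n. s (of_int m) (A m n)) \<and>
        (\<forall>R n. tay (\<lambda>m n. s (of_int m) (A m n)) R n =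
           s (of_int (R + 1)) (tay A (R + 1) (n - 1)) + s (of_int R) (tay A R n))"
        unfolding B_def by blast
    qed
  qed
  moreover obtain k where "merk k A" using assms by (auto simp: mer_def)
  ultimately show ?thesis by simp
qed


section \<open>Iterated expansions\<close>

text \<open>\<open>psub A\<close> is \<open>A(x\<^sub>0 + x\<^sub>2, x\<^sub>2)\<close>. In three variables, \<open>S i j n\<close> is the coefficient of
  \<open>y\<^sup>i x\<^sup>j z\<^sup>n\<close>; \<open>t1\<close> expands at \<open>x = z\<close> and then at \<open>y = z\<close>, whereas \<open>t2\<close> expands at \<open>y = x\<close> and
  then at \<open>x = z\<close>.\<close>

definition psub :: "'w series2 \<Rightarrow> 'w series2" where
  "psub A = (\<lambda>m n. Sum_any (\<lambda>j::nat. s (of_int (m + int j) gchoose j) (A (m + int j) (n - int j))))"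

lemma psub_sum:
  assumes "\<And>P R. R < R0 \<Longrightarrow> A P R = 0" "n - R0 \<le> int J"
  shows "psub A m n = (\<Sum>j\<le>J. s (of_int (m + int j) gchoose j) (A (m + int j) (n - int j)))"
  unfolding psub_def
proof (rule Sum_any.expand_superset)
  have "A (m + int j) (n - int j) = 0" if "j > J" for j
    by (rule assms(1)) (use that assms(2) in linarith)
  then show "{j. s (of_int (m + int j) gchoose j) (A (m + int j) (n - int j)) \<noteq> 0} \<subseteq> {..J}"
    by (auto simp: not_le[symmetric])
qed simp

lemma psub_diff:
  assumes "\<And>P R. R < R0 \<Longrightarrow> A P R = 0" "\<And>P R. R < R0 \<Longrightarrow> B P R = 0"
  shows "psub (\<lambda>m n. A m n - B m n) m n = psub A m n - psub B m n"
proof -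
  have "n - R0 \<le> int (nat (n - R0))" by simp
  from psub_sum[of R0 A, OF assms(1) this] psub_sum[of R0 B, OF assms(2) this]
    psub_sum[of R0 "\<lambda>m n. A m n - B m n", OF _ this]
  show ?thesis by (simp add: assms scale_right_diff_distrib sum_subtractf)
qed

lemma psub_shift1:
  assumes "\<And>P R. R < R0 \<Longrightarrow> A P R = 0"
  shows "psub (\<lambda>m n. A (m - 1) n) m n = psub A (m - 1) n + psub A m (n - 1)"
proof -
  define J where "J = nat (n - R0)"
  have J: "n - R0 \<le> int (Suc J)" "n - 1 - R0 \<le> int J" by (auto simp: J_def)
  let ?a = "\<lambda>j. A (m - 1 + int j) (n - int j)"
  have p: "of_int (m + 1 + int j) gchoose Suc j = (of_int (m + int j) gchoose j) + (of_int (m + int j) gchoose Suc j :: complex)" for j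
    using gbinomial_Suc_Suc[of "of_int (m + int j) :: complex" j] by (simp add: algebra_simps)
  have "psub (\<lambda>m n. A (m - 1) n) m n = (\<Sum>j\<le>Suc J. s (of_int (m + int j) gchoose j) (?a j))"
    using psub_sum[of R0 "\<lambda>m n. A (m - 1) n" n "Suc J" m] assms J by (simp add: algebra_simps)
  also have "\<dots> = ?a 0 + (\<Sum>j\<le>J. s (of_int (m + int j) gchoose j) (?a (Suc j)) + s (of_int (m + int j) gchoose Suc j) (?a (Suc j)))"
    unfolding sum.atMost_Suc_shift using p by (simp add: algebra_simps)
  also have "\<dots> = (\<Sum>j\<le>J. s (of_int (m + int j) gchoose j) (A (m + int j) (n - 1 - int j)))
       + (\<Sum>j\<le>Suc J. s (of_int (m - 1 + int j) gchoose j) (?a j))"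
    unfolding sum.atMost_Suc_shift[of _ J] sum.distrib by (simp add: algebra_simps)
  also have "\<dots> = psub A m (n - 1) + psub A (m - 1) n"
    using psub_sum[of R0 A "n - 1" J m] psub_sum[of R0 A n "Suc J" "m - 1"] assms J by (simp add: algebra_simps)
  finally show ?thesis by (simp add: add.commute)
qed

lemma psub_shift2: "psub (\<lambda>m n. A m (n - 1)) m n = psub A m (n - 1)"
  by (simp add: psub_def algebra_simps)

text \<open>Under x0 -> x0 + x2 the factor x0 - x2 becomes x0.\<close>

lemma psub_dm:
  assumes "\<And>P R. R < R0 \<Longrightarrow> A P R = 0"
  shows "psub (dm A) m n = psub A (m - 1) n"
proof -
  have "psub (dm A) m n = psub (\<lambda>m n. A (m - 1) n) m n - psub (\<lambda>m n. A m (n - 1)) m n"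
    unfolding dm_def by (rule psub_diff[of R0]) (auto intro: assms)
  then show ?thesis using psub_shift1[of R0 A, OF assms] by (simp add: psub_shift2)
qed

definition t1 :: "(int \<Rightarrow> 'w series2) \<Rightarrow> int \<Rightarrow> int \<Rightarrow> int \<Rightarrow> 'w" where
  "t1 S P R = tay (\<lambda>i n. tay (S i) R n) P"

definition tay12 :: "(int \<Rightarrow> 'w series2) \<Rightarrow> int \<Rightarrow> 'w series2" where
  "tay12 S m = (\<lambda>k n. tay (\<lambda>i j. S i j n) m k)"

definition t2 :: "(int \<Rightarrow> 'w series2) \<Rightarrow> int \<Rightarrow> int \<Rightarrow> int \<Rightarrow> 'w" where
  "t2 S m n = tay (tay12 S m) n"

text \<open>All three exponents are at most \<open>M\<close> and add up to \<open>N + P + R\<close>,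
  so each is at least \<open>N + P + R - 2 * M\<close>; this gives the finite window
  \<open>B\<close>.\<close>

lemma tay0_tay0:
  assumes "\<And>i j n. i > M \<or> j > M \<or> n > M \<Longrightarrow> G i j n = 0" and B: "B = {N + P + R - 2 * M..M}"
  shows "tay0 (\<lambda>i n. tay0 (G i) R n) P N =
    (\<Sum>i\<in>B. \<Sum>j\<in>B. s (ib i P * ib j R) (G i j (N + P + R - i - j)))"
proof -
  have inner: "tay0 (G i) R (N + P - i) = (\<Sum>j\<in>B. s (ib j R) (G i j (N + P + R - i - j)))" for i
  proof -
    have z: "G i j (N + P + R - i - j) = 0" if "j \<notin> B" for j
      by (rule assms(1)) (use that B in auto)
    have "Sum_any (\<lambda>j. s (ib j R) (G i j (N + P + R - i - j))) = (\<Sum>j\<in>B. s (ib j R) (G i j (N + P + R - i - j)))"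
      by (rule Sum_any_superset) (use z in \<open>simp_all add: B\<close>)
    then show ?thesis by (simp add: tay0_def algebra_simps)
  qed
  have "s (ib i P) (tay0 (G i) R (N + P - i)) = 0" if "i \<notin> B" for i
  proof -
    have "G i j (N + P + R - i - j) = 0" for j
      by (rule assms(1)) (use that B in auto)
    then show ?thesis unfolding inner by simp
  qed
  then have "tay0 (\<lambda>i n. tay0 (G i) R n) P N = (\<Sum>i\<in>B. s (ib i P) (tay0 (G i) R (N + P - i)))"
    by (subst tay0_def, intro Sum_any_superset) (auto simp: B)
  then show ?thesis unfolding inner by (simp add: scale_sum_right)
qed

lemma bdd3_slice1: "bdd3 G \<Longrightarrow> laurent_inf2 (G i)"
  and bdd3_slice3: "bdd3 G \<Longrightarrow> laurent_inf2 (\<lambda>i j. G i j n)"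
  unfolding bdd3_def laurent_inf2_def by blast+

lemma bdd3_tay:
  assumes "bdd3 G"
  shows "laurent_inf2 (\<lambda>i n. tay (G i) R n)" "laurent_inf2 (tay12 G m)"
proof -
  obtain M where M: "\<And>i j n. i > M \<or> j > M \<or> n > M \<Longrightarrow> G i j n = 0" using assms by (auto simp: bdd3_def)
  have k: "merk 0 (G i)" "merk 0 (\<lambda>i j. G i j n)" for i n
    using bdd3_slice1[OF assms] bdd3_slice3[OF assms] by (simp_all add: merk_def)
  have z: "G i = (\<lambda>m n. 0)" if "i > M" for i using M that by blast
  have z': "(\<lambda>i j. G i j n) = (\<lambda>m n. 0)" if "n > M" for n using M that by blast
  have t: "tay (G i) R n = 0" if "n > 2 * M - R" for i n
    by (rule tay_bound[OF k(1), of M]) (use M that in auto)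
  have t': "tay (\<lambda>i j. G i j n) m k = 0" if "k > 2 * M - m" for k n
    by (rule tay_bound[OF k(2), of M]) (use M that in auto)
  show "laurent_inf2 (\<lambda>i n. tay (G i) R n)"
    by (rule laurent_inf2I[of M _ "2 * M - R"]) (use z t in auto)
  show "laurent_inf2 (tay12 G m)" unfolding tay12_def
    by (rule laurent_inf2I[of "2 * M - m" _ M]) (use z' t' in auto)
qed

lemma t1_bdd3: "bdd3 G \<Longrightarrow> t1 G P R N = tay0 (\<lambda>i n. tay0 (G i) R n) P N"
  using bdd3_tay(1)[of G R] by (simp add: t1_def tay_eq_tay0 bdd3_slice1)

lemma t2_bdd3: "bdd3 G \<Longrightarrow> t2 G m n N = tay0 (\<lambda>k n. tay0 (\<lambda>i j. G i j n) m k) n N"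
  using bdd3_tay(2)[of G m] by (simp add: t2_def tay12_def tay_eq_tay0 bdd3_slice3)

lemma t1_low_bdd3: "bdd3 G \<Longrightarrow> P < 0 \<or> R < 0 \<Longrightarrow> t1 G P R N = 0"
proof -
  assume G: "bdd3 G" and PR: "P < 0 \<or> R < 0"
  obtain M where M: "\<And>i j n. i > M \<or> j > M \<or> n > M \<Longrightarrow> G i j n = 0" using G by (auto simp: bdd3_def)
  show ?thesis using PR by (auto simp: t1_bdd3[OF G] tay0_tay0[of M G, OF M refl])
qed

text \<open>Expanding y and x about the same z involves two independent binomials, so the double sum
  is symmetric.\<close>

lemma t1_swap_bdd3:
  assumes "bdd3 G"
  shows "t1 G P R N = t1 (\<lambda>j i n. G i j n) R P N"
proof -
  obtain M where M: "\<And>i j n. i > M \<or> j > M \<or> n > M \<Longrightarrow> G i j n = 0" using assms by (auto simp: bdd3_def)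
  define B where "B = {N + P + R - 2 * M..M}"
  have B': "B = {N + R + P - 2 * M..M}" by (simp add: B_def algebra_simps)
  have b: "bdd3 (\<lambda>j i n. G i j n)" using assms unfolding bdd3_def by blast
  have M': "\<And>i j n. i > M \<or> j > M \<or> n > M \<Longrightarrow> G j i n = 0" using M by blast
  have "t1 G P R N = (\<Sum>i\<in>B. \<Sum>j\<in>B. s (ib i P * ib j R) (G i j (N + P + R - i - j)))"
    using tay0_tay0[of M G, OF M B_def] by (simp add: t1_bdd3[OF assms])
  also have "\<dots> = (\<Sum>j\<in>B. \<Sum>i\<in>B. s (ib i P * ib j R) (G i j (N + P + R - i - j)))"
    by (rule sum.swap)
  also have "\<dots> = (\<Sum>j\<in>B. \<Sum>i\<in>B. s (ib j R * ib i P) (G i j (N + R + P - j - i)))"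
    by (simp add: algebra_simps)
  also have "\<dots> = t1 (\<lambda>j i n. G i j n) R P N"
    using tay0_tay0[of M "\<lambda>j i n. G i j n", OF M' B'] by (simp add: t1_bdd3[OF b])
  finally show ?thesis .
qed

text \<open>Expanding y about x first leaves the power \<open>i + j - m\<close> of x, which is then
  expanded about z; hence the second binomial depends on \<open>m\<close>.\<close>

lemma tay0_tay0_diag:
  assumes M: "\<And>i j n. i > M \<or> j > M \<or> n > M \<Longrightarrow> G i j n = 0" and B: "B = {N + m + n - 2 * M..M}"
  shows "tay0 (\<lambda>k n. tay0 (\<lambda>i j. G i j n) m k) n N =
    (\<Sum>i\<in>B. \<Sum>j\<in>B. s (ib i m * ib (i + j - m) n) (G i j (N + m + n - i - j)))"
proof -
  define g where "g i k = s (ib i m * ib k n) (G i (k + m - i) (N + n - k))" for i k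
  \<comment> \<open>\<open>k + m\<close> is the sum of the exponents of y and x, each of which lies
    in \<open>B\<close>.\<close>
  define K where "K = {2 * (N + m + n - 2 * M) - m..2 * M - m}"
  have zF: "g i k = 0" if "i \<notin> B" for i k
  proof -
    have "G i (k + m - i) (N + n - k) = 0" by (rule M) (use that B in auto)
    then show ?thesis by (simp add: g_def)
  qed
  have zK: "g i k = 0" if "k \<notin> K" for i k
  proof -
    have "G i (k + m - i) (N + n - k) = 0" by (rule M) (use that K_def in auto)
    then show ?thesis by (simp add: g_def)
  qed
  have inner: "s (ib k n) (tay0 (\<lambda>i j. G i j (N + n - k)) m k) = (\<Sum>i\<in>B. g i k)" for k
  proof -
    have "G i (k + m - i) (N + n - k) = 0" if "i \<notin> B" for i by (rule M) (use that B in auto)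
    then have "tay0 (\<lambda>i j. G i j (N + n - k)) m k = (\<Sum>i\<in>B. s (ib i m) (G i (k + m - i) (N + n - k)))"
      unfolding tay0_def by (intro Sum_any_superset) (auto simp: B)
    then show ?thesis by (simp add: g_def scale_sum_right mult.commute)
  qed
  have "tay0 (\<lambda>k n. tay0 (\<lambda>i j. G i j n) m k) n N = (\<Sum>k\<in>K. \<Sum>i\<in>B. g i k)"
  proof -
    have "Sum_any (\<lambda>k. \<Sum>i\<in>B. g i k) = (\<Sum>k\<in>K. \<Sum>i\<in>B. g i k)"
      by (rule Sum_any_superset) (use zK in \<open>auto simp: K_def\<close>)
    then show ?thesis using inner by (subst tay0_def) simp
  qed
  also have "\<dots> = (\<Sum>i\<in>B. \<Sum>k\<in>K. g i k)" by (rule sum.swap)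
  also have "\<dots> = (\<Sum>i\<in>B. \<Sum>j\<in>B. s (ib i m * ib (i + j - m) n) (G i j (N + m + n - i - j)))"
  proof (rule sum.cong[OF refl])
    fix i assume "i \<in> B"
    have z: "g i (j + (i - m)) = 0" if "j \<notin> B" for j
    proof -
      have "G i j (N + n + m - i - j) = 0" by (rule M) (use that B in auto)
      then show ?thesis by (simp add: g_def algebra_simps)
    qed
    have "(\<Sum>k\<in>K. g i k) = Sum_any (g i)"
      by (rule Sum_any_superset[symmetric]) (use zK in \<open>auto simp: K_def\<close>)
    also have "\<dots> = Sum_any (\<lambda>j. g i (j + (i - m)))" by (rule Sum_any_shift[symmetric])
    also have "\<dots> = (\<Sum>j\<in>B. g i (j + (i - m)))"
      by (rule Sum_any_superset) (use z in \<open>auto simp: B\<close>)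
    finally show "(\<Sum>k\<in>K. g i k) = (\<Sum>j\<in>B. s (ib i m * ib (i + j - m) n) (G i j (N + m + n - i - j)))"
      by (simp add: g_def algebra_simps)
  qed
  finally show ?thesis .
qed

text \<open>Associativity in the absence of poles: all sums are finite, and after exchanging them
  the coefficient identity is \<open>ib_trinomial\<close>.\<close>

lemma psub_bdd3:
  assumes "bdd3 G"
  shows "psub (\<lambda>P R. t1 G P R N) m n = t2 G m n N"
proof -
  obtain M where M: "\<And>i j n. i > M \<or> j > M \<or> n > M \<Longrightarrow> G i j n = 0" using assms by (auto simp: bdd3_def)
  define B where "B = {N + m + n - 2 * M..M}"
  define J where "J = nat n"
  let ?G = "\<lambda>i j. G i j (N + m + n - i - j)"
  have low: "t1 G P R N = 0" if "R < 0" for P R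
    using that by (simp add: t1_low_bdd3[OF assms])
  have h: "t1 G (m + int j) (n - int j) N = (\<Sum>i\<in>B. \<Sum>k\<in>B. s (ib i (m + int j) * ib k (n - int j)) (?G i k))" for j
    using tay0_tay0[of M G B N "m + int j" "n - int j", OF M] by (simp add: t1_bdd3[OF assms] B_def algebra_simps)
  have id: "(\<Sum>j\<le>J. (of_int (m + int j) gchoose j) * (ib i (m + int j) * ib k (n - int j))) = ib i m * ib (i + k - m) n" for i k
  proof -
    consider "m < 0" | "n < 0" | "m \<ge> 0" "n \<ge> 0" by linarith
    then show ?thesis
    proof cases
      case 1
      \<comment> \<open>For \<open>m < 0\<close>, either m + j < 0 kills
        \<open>ib i (m + int j)\<close>, or 0 \<le> m + j < j kills the binomial in front.\<close>
      have "(of_int (m + int j) gchoose j) * (ib i (m + int j) * ib k (n - int j)) = 0" for j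
      proof (cases "m + int j < 0")
        case False
        then have "of_int (m + int j) gchoose j = (of_nat (nat (m + int j) choose j) :: complex)"
          unfolding binomial_gbinomial by simp
        moreover have "nat (m + int j) < j" using 1 False by linarith
        ultimately show ?thesis by (simp add: binomial_eq_0)
      qed simp
      then show ?thesis using 1 by (subst sum.neutral) (blast, simp)
    next
      case 2
      then show ?thesis by (simp add: J_def)
    next
      case 3
      then show ?thesis using ib_trinomial[where m = m and n = J and i = i and k = k] by (simp add: J_def)
    qed
  qed
  have "psub (\<lambda>P R. t1 G P R N) m n =
     (\<Sum>j\<le>J. s (of_int (m + int j) gchoose j) (\<Sum>i\<in>B. \<Sum>k\<in>B. s (ib i (m + int j) * ib k (n - int j)) (?G i k)))"
    by (subst psub_sum[of 0 _ n J]) (use low h in \<open>auto simp: J_def\<close>)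
  also have "\<dots> = (\<Sum>j\<le>J. \<Sum>i\<in>B. \<Sum>k\<in>B. s ((of_int (m + int j) gchoose j) * (ib i (m + int j) * ib k (n - int j))) (?G i k))"
    by (simp add: scale_sum_right)
  also have "\<dots> = (\<Sum>i\<in>B. \<Sum>j\<le>J. \<Sum>k\<in>B. s ((of_int (m + int j) gchoose j) * (ib i (m + int j) * ib k (n - int j))) (?G i k))"
    by (rule sum.swap)
  also have "\<dots> = (\<Sum>i\<in>B. \<Sum>k\<in>B. \<Sum>j\<le>J. s ((of_int (m + int j) gchoose j) * (ib i (m + int j) * ib k (n - int j))) (?G i k))"
    by (rule sum.cong[OF refl sum.swap])
  also have "\<dots> = (\<Sum>i\<in>B. \<Sum>k\<in>B. s (ib i m * ib (i + k - m) n) (?G i k))"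
    unfolding scale_sum_left[symmetric] id ..
  also have "\<dots> = t2 G m n N"
    using tay0_tay0_diag[of M G B N m n, OF M B_def] by (simp add: t2_bdd3[OF assms])
  finally show ?thesis .
qed

text \<open>\<open>good3\<close> collects what is needed to form both iterated expansions; it is stable under
  multiplication by differences of variables.\<close>

definition good3 :: "(int \<Rightarrow> 'w series2) \<Rightarrow> bool" where
  "good3 S \<longleftrightarrow> (\<exists>a. \<forall>n. merk a (\<lambda>i j. S i j n)) \<and> (\<exists>c. \<forall>i. merk c (S i)) \<and>
     (\<forall>R. mer (\<lambda>i n. tay (S i) R n))"

lemma good3D:
  assumes "good3 S"
  shows "mer (\<lambda>i j. S i j n)" "mer (S i)" "mer (\<lambda>i n. tay (S i) R n)"
  using assms unfolding good3_def mer_def by blast+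

text \<open>Here x is already z plus a small variable with exponent \<open>R\<close>, so
  multiplication by x splits into a shift of \<open>n\<close> and a shift of
  \<open>R\<close>.\<close>

lemma tay_D12:
  assumes "good3 S"
  shows "(\<lambda>i. tay (D12 S i) R) =
    (\<lambda>i n. tay (S (i - 1)) R n - (tay (S i) R (n - 1) + tay (S i) (R - 1) n))"
  unfolding D12_def using good3D(2)[OF assms]
  by (intro ext) (simp add: tay_diff mer_shift1 tay_shift1)

lemma tay_D13: "good3 S \<Longrightarrow> (\<lambda>i. tay (D13 S i) R) = dm (\<lambda>i. tay (S i) R)"
  unfolding D13_def dm_def using good3D(2)[of S]
  by (intro ext) (simp add: tay_diff mer_shift2 tay_shift2)

lemma tay_D23: "good3 S \<Longrightarrow> tay (D23 S i) R = tay (S i) (R - 1)"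
  unfolding D23_def using good3D(2)[of S] tay_dm[of "S i"] by (intro ext) (simp add: dm_def)

lemma merk_slice_D:
  shows "merk a (\<lambda>i j. S i j n) \<Longrightarrow> merk a (\<lambda>i j. D12 S i j n)"
    "(\<And>n. merk a (\<lambda>i j. S i j n)) \<Longrightarrow> merk a (\<lambda>i j. D13 S i j n)"
    "(\<And>n. merk a (\<lambda>i j. S i j n)) \<Longrightarrow> merk a (\<lambda>i j. D23 S i j n)"
proof -
  show "merk a (\<lambda>i j. D12 S i j n)" if "merk a (\<lambda>i j. S i j n)"
    unfolding D12_def
    using merk_diff[OF merk_shift[OF that, of 1 0] merk_shift[OF that, of 0 1]] by simp
  assume *: "\<And>n. merk a (\<lambda>i j. S i j n)"
  show "merk a (\<lambda>i j. D13 S i j n)" unfolding D13_def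
    using merk_diff[OF merk_shift[OF *[of n], of 1 0] *[of "n - 1"]] by simp
  show "merk a (\<lambda>i j. D23 S i j n)" unfolding D23_def
    using merk_diff[OF merk_shift[OF *[of n], of 0 1] *[of "n - 1"]] by simp
qed

lemma good3_D:
  assumes "good3 S"
  shows "good3 (D12 S)" "good3 (D13 S)" "good3 (D23 S)"
proof -
  obtain a c where a: "\<And>n. merk a (\<lambda>i j. S i j n)" and c: "\<And>i. merk c (S i)"
    using assms by (auto simp: good3_def)
  have m: "mer (\<lambda>i n. tay (S i) R n)" for R using good3D(3)[OF assms] .
  have c': "merk c (\<lambda>j n. S i (j - 1) n)" "merk c (\<lambda>j n. S i j (n - 1))" for i
    using merk_shift[OF c, of i 1 0] merk_shift[OF c, of i 0 1] by simp_all
  have "merk c (D12 S i)" "merk c (D13 S i)" "merk c (D23 S i)" for i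
    unfolding D12_def D13_def D23_def by (intro merk_diff c c')+
  moreover have "mer (\<lambda>i n. tay (D12 S i) R n)" "mer (\<lambda>i n. tay (D13 S i) R n)" "mer (\<lambda>i n. tay (D23 S i) R n)" for R
    unfolding tay_D12[OF assms] tay_D13[OF assms] tay_D23[OF assms]
    using m mer_shift1[OF m] mer_shift2[OF m] by (auto simp: mer_dm intro!: mer_diff mer_add)
  ultimately show "good3 (D12 S)" "good3 (D13 S)" "good3 (D23 S)"
    unfolding good3_def using merk_slice_D a by blast+
qed

text \<open>The coordinates of \<open>t1\<close> are y - z with exponent \<open>P\<close> and x - z
  with exponent \<open>R\<close>, so y - x is their difference. In the coordinates y - x and x - z
  of \<open>t2\<close> it is y - z that becomes a sum (\<open>t2_D13\<close>).\<close>

lemma t1_D12: "good3 S \<Longrightarrow> t1 (D12 S) P R N = t1 S (P - 1) R N - t1 S P (R - 1) N"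
proof -
  assume S: "good3 S"
  have m: "mer (\<lambda>i n. tay (S i) R n)" for R using good3D(3)[OF S] .
  have "t1 (D12 S) P R N = tay (\<lambda>i n. tay (S (i - 1)) R n) P N -
      (tay (\<lambda>i n. tay (S i) R (n - 1)) P N + tay (\<lambda>i n. tay (S i) (R - 1) n) P N)"
    unfolding t1_def tay_D12[OF S] using m mer_shift1[OF m] mer_shift2[OF m]
    by (simp add: tay_diff tay_add mer_add)
  then show ?thesis
    unfolding t1_def using tay_shift1[OF m] tay_shift2[OF m] by simp
qed

lemma t1_D13: "good3 S \<Longrightarrow> t1 (D13 S) P R N = t1 S (P - 1) R N"
  unfolding t1_def by (simp add: tay_D13 good3D(3) tay_dm)

lemma t1_D23: "good3 S \<Longrightarrow> t1 (D23 S) P R N = t1 S P (R - 1) N"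
  unfolding t1_def by (simp add: tay_D23)

lemma t1_low2: "good3 S \<Longrightarrow> \<exists>c. \<forall>P R. R < c \<longrightarrow> t1 S P R N = 0"
proof -
  assume "good3 S"
  then obtain c where c: "\<And>i. merk c (S i)" by (auto simp: good3_def)
  have "t1 S P R N = 0" if "R < - int c" for P R
    using tay_low[OF c that] by (simp add: t1_def)
  then show ?thesis by blast
qed

lemma tay12_D12:
  assumes "\<And>n. mer (\<lambda>i j. S i j n)"
  shows "tay12 (D12 S) m = tay12 S (m - 1)"
  unfolding tay12_def D12_def using tay_dm[OF assms] by (intro ext) (simp add: dm_def)

lemma tay12_D13:
  assumes "\<And>n. mer (\<lambda>i j. S i j n)"
  shows "tay12 (D13 S) m = (\<lambda>k n. dm (tay12 S m) k n + tay12 S (m - 1) k n)"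
  unfolding tay12_def D13_def dm_def
  using tay_diff[OF mer_shift1[OF assms] assms] tay_shift1[OF assms]
  by (intro ext) (simp add: algebra_simps)

lemma tay12_D23:
  assumes "\<And>n. mer (\<lambda>i j. S i j n)"
  shows "tay12 (D23 S) m = dm (tay12 S m)"
proof -
  have "tay (\<lambda>i j. S i (j - 1) n) R k = tay (\<lambda>i j. S i j n) R (k - 1)" for n R k
    using tay_shift2[OF assms[of n], where c = 1 and R = R and n = k] .
  then show ?thesis
    unfolding tay12_def D23_def dm_def using tay_diff[OF mer_shift2[OF assms] assms]
    by (intro ext) simp
qed

lemma tay12_low: "(\<And>n. merk e (\<lambda>i j. S i j n)) \<Longrightarrow> m < - int e \<Longrightarrow> tay12 S m = (\<lambda>k n. 0)"
  unfolding tay12_def by (intro ext tay_low)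

lemma merk_zero: "merk k (\<lambda>m n. 0)"
  using merk_mono[of 0 "\<lambda>m n. 0" k] by (simp add: merk_def laurent_inf2_def)

text \<open>Here \<open>K\<close> is chosen before \<open>S\<close>: in a module at infinity the pole order must not depend on the
  vector to which the fields are applied.\<close>

lemma tay12_merk:
  "\<exists>K. \<forall>S. (\<forall>n. merk e (\<lambda>i j. S i j n)) \<longrightarrow> bdd3 ((D12 ^^ a) ((D13 ^^ b) ((D23 ^^ c) S))) \<longrightarrow> merk K (tay12 S m)"
proof (induction c arbitrary: m)
  case 0
  show ?case
  proof (induction b arbitrary: m)
    case 0
    show ?case
    proof (induction a arbitrary: m)
      case 0
      show ?case by (rule exI[of _ 0]) (auto simp: merk_def intro: bdd3_tay)
    next
      case (Suc a)
      from Suc[of "m + 1"] obtain K where K: "\<And>S. \<forall>n. merk e (\<lambda>i j. S i j n) \<Longrightarrow>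
        bdd3 ((D12 ^^ a) S) \<Longrightarrow> merk K (tay12 S (m + 1))" by auto
      show ?case
      proof (intro exI[of _ K] allI impI)
        fix S :: "int \<Rightarrow> 'w series2" assume S: "\<forall>n. merk e (\<lambda>i j. S i j n)"
          "bdd3 ((D12 ^^ Suc a) ((D13 ^^ 0) ((D23 ^^ 0) S)))"
        have "merk K (tay12 (D12 S) (m + 1))"
          by (rule K) (use S merk_slice_D(1) in \<open>auto simp: funpow_swap1\<close>)
        moreover have "mer (\<lambda>i j. S i j n)" for n using S(1) by (auto simp: mer_def)
        ultimately show "merk K (tay12 S m)" using tay12_D12[of S "m + 1"] by simp
      qed
    qed
  next
    case (Suc b)
    note IHb = Suc
    \<comment> \<open>As y - z = (x - z) + (y - x), the pole order at \<open>m\<close> is governed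
      by that of \<open>D13 S\<close> at \<open>m\<close> and that of \<open>S\<close> at
      \<open>m - 1\<close>. The inner induction on \<open>r\<close> climbs from
      \<open>m = - e - 1\<close>, where the expansion vanishes by \<open>tay12_low\<close>.\<close>
    have *: "\<exists>K. \<forall>S. (\<forall>n. merk e (\<lambda>i j. S i j n)) \<longrightarrow> bdd3 ((D12 ^^ a) ((D13 ^^ Suc b) S)) \<longrightarrow>
      merk K (tay12 S (int r - int e - 1))" for r
    proof (induction r)
      case 0
      show ?case
      proof (intro exI[of _ 0] allI impI)
        fix S :: "int \<Rightarrow> 'w series2" assume S: "\<forall>n. merk e (\<lambda>i j. S i j n)"
        show "merk 0 (tay12 S (int 0 - int e - 1))" using tay12_low[of e S] S by (simp add: merk_zero)
      qed
    next
      case (Suc r)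
      let ?m = "int (Suc r) - int e - 1"
      from IHb[of ?m] obtain K1 where K1: "\<And>S. \<forall>n. merk e (\<lambda>i j. S i j n) \<Longrightarrow>
        bdd3 ((D12 ^^ a) ((D13 ^^ b) S)) \<Longrightarrow> merk K1 (tay12 S ?m)" by auto
      from Suc obtain K2 where K2: "\<And>S. \<forall>n. merk e (\<lambda>i j. S i j n) \<Longrightarrow>
        bdd3 ((D12 ^^ a) ((D13 ^^ Suc b) S)) \<Longrightarrow> merk K2 (tay12 S (?m - 1))" by auto
      show ?case
      proof (intro exI[of _ "Suc (max K1 K2)"] allI impI)
        fix S :: "int \<Rightarrow> 'w series2" assume S: "\<forall>n. merk e (\<lambda>i j. S i j n)"
          "bdd3 ((D12 ^^ a) ((D13 ^^ Suc b) S))"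
        have "merk K1 (tay12 (D13 S) ?m)"
          by (rule K1) (use S merk_slice_D(2) in \<open>auto simp: funpow_swap1\<close>)
        moreover have "merk K2 (tay12 S (?m - 1))" by (rule K2) fact+
        ultimately have "merk (max K1 K2) (\<lambda>k n. tay12 (D13 S) ?m k n - tay12 S (?m - 1) k n)"
          by (intro merk_diff) (auto elim: merk_mono)
        moreover have "(\<lambda>k n. tay12 (D13 S) ?m k n - tay12 S (?m - 1) k n) = dm (tay12 S ?m)"
        proof -
          have "mer (\<lambda>i j. S i j n)" for n using S(1) by (auto simp: mer_def)
          from tay12_D13[OF this] show ?thesis by (simp add: fun_eq_iff)
        qed
        ultimately show "merk (Suc (max K1 K2)) (tay12 S ?m)" by (simp add: merk_dm)
      qed
    qed
    show ?case
    proof (cases "m < - int e")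
      case True
      show ?thesis
      proof (intro exI[of _ 0] allI impI)
        fix S :: "int \<Rightarrow> 'w series2" assume S: "\<forall>n. merk e (\<lambda>i j. S i j n)"
        show "merk 0 (tay12 S m)" using tay12_low[of e S m] S True by (simp add: merk_zero)
      qed
    next
      case False
      then have "m = int (nat (m + int e + 1)) - int e - 1" by simp
      with *[of "nat (m + int e + 1)"] show ?thesis by simp
    qed
  qed
next
  case (Suc c)
  from Suc[of m] obtain K where K: "\<And>S. \<forall>n. merk e (\<lambda>i j. S i j n) \<Longrightarrow>
      bdd3 ((D12 ^^ a) ((D13 ^^ b) ((D23 ^^ c) S))) \<Longrightarrow> merk K (tay12 S m)" by auto
  show ?case
  proof (intro exI[of _ "Suc K"] allI impI)
    fix S :: "int \<Rightarrow> 'w series2" assume S: "\<forall>n. merk e (\<lambda>i j. S i j n)"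
      "bdd3 ((D12 ^^ a) ((D13 ^^ b) ((D23 ^^ Suc c) S)))"
    have "merk K (tay12 (D23 S) m)"
      by (rule K) (use S merk_slice_D(3) in \<open>auto simp: funpow_swap1\<close>)
    moreover have "mer (\<lambda>i j. S i j n)" for n using S(1) by (auto simp: mer_def)
    ultimately show "merk (Suc K) (tay12 S m)" using tay12_D23[of S m] by (simp add: merk_dm)
  qed
qed


lemma tay_D13_pow:
  assumes "\<And>i. mer (S i)"
  shows "(\<forall>i. mer ((D13 ^^ b) S i)) \<and> (\<lambda>i. tay ((D13 ^^ b) S i) R) = (dm ^^ b) (\<lambda>i. tay (S i) R)"
proof (induction b)
  case (Suc b)
  let ?K = "(D13 ^^ b) S"
  have m: "mer (?K i)" for i using Suc by blast
  have "mer (D13 ?K i)" for i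
    unfolding D13_def[of ?K] by (intro mer_diff m mer_shift2)
  moreover have "(\<lambda>i. tay (D13 ?K i) R) = dm (\<lambda>i. tay (?K i) R)"
    unfolding D13_def[of ?K] dm_def
    by (intro ext) (simp add: tay_diff m mer_shift2 tay_shift2)
  ultimately show ?case using Suc by simp
qed (use assms in simp)

lemma t1_clear_poles:
  assumes "bdd3 ((D13 ^^ b) ((D23 ^^ c) C))" "\<And>i. merk c (C i)"
  shows "t1 C P R N = t1 ((D13 ^^ b) ((D23 ^^ c) C)) (P + int b) (R + int c) N"
proof -
  let ?K = "(D23 ^^ c) C"
  have K: "laurent_inf2 (?K i)" for i using assms(2) by (simp add: D23_pow merk_def)
  then have mK: "mer (?K i)" for i by (auto simp: mer_def merk_def intro: exI[of _ 0])
  have 1: "(\<lambda>i. tay (C i) R) = (\<lambda>i. tay (?K i) (R + int c))"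
    using K by (intro ext) (simp add: tay_eq[OF assms(2)] tay_eq_tay0 D23_pow)
  have 2: "(dm ^^ b) (\<lambda>i. tay (?K i) (R + int c)) = (\<lambda>i. tay ((D13 ^^ b) ?K i) (R + int c))"
    using tay_D13_pow[of ?K, OF mK] by simp
  have b: "laurent_inf2 (\<lambda>i. tay ((D13 ^^ b) ?K i) (R + int c))"
    using bdd3_tay(1)[OF assms(1)] .
  then have "merk b (\<lambda>i. tay (?K i) (R + int c))" by (simp add: merk_def 2)
  from tay_eq[OF this] show ?thesis unfolding t1_def 1 2 tay_eq_tay0[OF b] .
qed

text \<open>With poles along y = z and x = z only, clearing them shifts \<open>P\<close> by
  \<open>b\<close> and \<open>R\<close> by \<open>c\<close>, and the bounded remainder may be
  expanded in either order. A pole along y = x has to be cleared beforehand.\<close>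

lemma fubini:
  assumes bdd: "bdd3 ((D13 ^^ b) ((D23 ^^ c) C))" and "\<And>i. merk c (C i)" "\<And>j. merk b (\<lambda>i n. C i j n)"
  shows "t1 C P R N = t1 (\<lambda>j i n. C i j n) R P N"
proof -
  let ?G = "(D13 ^^ b) ((D23 ^^ c) C)"
  have "?G = (D23 ^^ c) ((D13 ^^ b) C)" by (rule funpow_swap[of D13 D23, OF D13_D23])
  then have G: "(D13 ^^ c) ((D23 ^^ b) (\<lambda>j i n. C i j n)) = (\<lambda>j i n. ?G i j n)"
    by (simp add: D13_pow D23_pow)
  have "bdd3 (\<lambda>j i n. ?G i j n)" using bdd unfolding bdd3_def by blast
  then have "t1 (\<lambda>j i n. C i j n) R P N = t1 (\<lambda>j i n. ?G i j n) (R + int c) (P + int b) N"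
    using t1_clear_poles[of c b "\<lambda>j i n. C i j n"] assms(3) by (simp add: G)
  then show ?thesis
    using t1_clear_poles[OF bdd assms(2)] t1_swap_bdd3[OF bdd] by simp
qed

lemma tay12_mer:
  assumes "good3 S" "bdd3 ((D12 ^^ a) ((D13 ^^ b) ((D23 ^^ c) S)))"
  shows "mer (tay12 S m)"
  using assms tay12_merk[of _ a b c m] unfolding good3_def mer_def by blast

lemma t2_D12: "good3 S \<Longrightarrow> t2 (D12 S) m = t2 S (m - 1)"
  unfolding t2_def using tay12_D12[of S, OF good3D(1)[of S]] by simp

lemma t2_D13: "good3 S \<Longrightarrow> (\<And>m. mer (tay12 S m)) \<Longrightarrow> t2 (D13 S) m n N = t2 S m (n - 1) N + t2 S (m - 1) n N"
  unfolding t2_def using tay12_D13[of S, OF good3D(1)[of S]] by (simp add: tay_add mer_dm tay_dm)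

lemma t2_D23: "good3 S \<Longrightarrow> (\<And>m. mer (tay12 S m)) \<Longrightarrow> t2 (D23 S) m n N = t2 S m (n - 1) N"
  unfolding t2_def using tay12_D23[of S, OF good3D(1)[of S]] by (simp add: tay_dm)

text \<open>Associativity up to powers of \<open>x\<^sub>0 + x\<^sub>2\<close>: both expansions of \<open>S(z + t + \<rho>, z + t, z)\<close> agree
  after the pole along \<open>y = z\<close>, that is, at \<open>t + \<rho> = 0\<close>, is cleared.\<close>

lemma psub_t1_t2:
  assumes "good3 S" "bdd3 ((D12 ^^ a) ((D13 ^^ b) ((D23 ^^ c) S)))"
  shows "(pm ^^ b) (psub (\<lambda>P R. t1 S P R N)) = (pm ^^ b) (\<lambda>m n. t2 S m n N)"
  using assms
proof (induction c arbitrary: S)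
  case 0
  then show ?case
  proof (induction b arbitrary: S)
    case 0
    then show ?case
    proof (induction a arbitrary: S)
      case 0
      then show ?case using psub_bdd3[of S N] by (simp add: fun_eq_iff)
    next
      case (Suc a)
      obtain r where r: "\<And>P R. R < r \<Longrightarrow> t1 S P R N = 0" using t1_low2[OF Suc.prems(1)] by blast
      have "psub (\<lambda>P R. t1 (D12 S) P R N) = (\<lambda>m n. t2 (D12 S) m n N)"
        using Suc.IH[of "D12 S"] Suc.prems good3_D(1) by (simp add: funpow_swap1)
      moreover have "(\<lambda>P R. t1 (D12 S) P R N) = dm (\<lambda>P R. t1 S P R N)"
        using t1_D12[OF Suc.prems(1)] by (simp add: dm_def)
      ultimately have "psub (\<lambda>P R. t1 S P R N) (m - 1) n = t2 S (m - 1) n N" for m n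
        using psub_dm[of r "\<lambda>P R. t1 S P R N" m n, OF r] t2_D12[OF Suc.prems(1)]
        by (metis (no_types, lifting))
      from this[of "_ + 1"] show ?case by (simp add: fun_eq_iff)
    qed
  next
    case (Suc b)
    obtain r where r: "\<And>P R. R < r \<Longrightarrow> t1 S P R N = 0" using t1_low2[OF Suc.prems(1)] by blast
    have m: "mer (tay12 S m)" for m using tay12_mer[OF Suc.prems] .
    have "(pm ^^ b) (psub (\<lambda>P R. t1 (D13 S) P R N)) = (pm ^^ b) (\<lambda>m n. t2 (D13 S) m n N)"
      using Suc.IH[of "D13 S"] Suc.prems good3_D(2) by (simp add: funpow_swap1)
    moreover have "(\<lambda>m n. t2 (D13 S) m n N) = pm (\<lambda>m n. t2 S m n N)"
      using t2_D13[OF Suc.prems(1) m] by (simp add: pm_def add.commute)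
    moreover have "psub (\<lambda>P R. t1 (D13 S) P R N) = pm (psub (\<lambda>P R. t1 S P R N))"
      using t1_D13[OF Suc.prems(1)] psub_shift1[of r "\<lambda>P R. t1 S P R N", OF r] by (simp add: pm_def fun_eq_iff)
    ultimately show ?case by (simp add: funpow_swap1)
  qed
next
  case (Suc c)
  have m: "mer (tay12 S m)" for m using tay12_mer[OF Suc.prems] .
  have "(pm ^^ b) (psub (\<lambda>P R. t1 (D23 S) P R N)) = (pm ^^ b) (\<lambda>m n. t2 (D23 S) m n N)"
    using Suc.IH[of "D23 S"] Suc.prems good3_D(3) by (simp add: funpow_swap1)
  moreover have "(\<lambda>m n. t2 (D23 S) m n N) = (\<lambda>m n. t2 S m (n - 1) N)"
    using t2_D23[OF Suc.prems(1) m] by simp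
  moreover have "psub (\<lambda>P R. t1 (D23 S) P R N) = (\<lambda>m n. psub (\<lambda>P R. t1 S P R N) m (n - 1))"
    using t1_D23[OF Suc.prems(1)] psub_shift2[of "\<lambda>P R. t1 S P R N"] by (simp add: fun_eq_iff)
  ultimately have "(pm ^^ b) (psub (\<lambda>P R. t1 S P R N)) m (n - 1) = (pm ^^ b) (\<lambda>m n. t2 S m n N) m (n - 1)" for m n
    using pm_pow_shift[of b "psub (\<lambda>P R. t1 S P R N)" 0 1] pm_pow_shift[of b "\<lambda>m n. t2 S m n N" 0 1]
    by (simp add: fun_eq_iff)
  from this[of _ "_ + 1"] show ?case by (simp add: fun_eq_iff)
qed

text \<open>Restriction to y = x, possible because the slices in y and x have no pole. The terms
  with \<open>P + R = n\<close> form the coefficient of t^n for y - z = x - z = t; in the other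
  coordinates only the zeroth power of y - x is left. The pole along y = z leaves no remainder,
  since the term \<open>t2 S (- 1)\<close> vanishes.\<close>

lemma Sum_any_t1:
  assumes "good3 S" "\<And>n. laurent_inf2 (\<lambda>i j. S i j n)" "bdd3 ((D13 ^^ b) ((D23 ^^ c) S))"
  shows "Sum_any (\<lambda>P. t1 S P (n - P) N) = t2 S 0 n N"
  using assms
proof (induction c arbitrary: S n)
  case 0
  then show ?case
  proof (induction b arbitrary: S n)
    case 0
    then have S: "bdd3 S" by simp
    note low = t1_low_bdd3[OF S]
    have "Sum_any (\<lambda>P. t1 S P (n - P) N) = (\<Sum>P\<in>int ` {..nat n}. t1 S P (n - P) N)"
    proof (rule Sum_any_superset)
      fix P assume P: "P \<notin> int ` {..nat n}"
      have "P < 0 \<or> n - P < 0"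
      proof (rule ccontr)
        assume "\<not> ?thesis"
        then have "P = int (nat P)" "nat P \<le> nat n" by auto
        with P show False by blast
      qed
      then show "t1 S P (n - P) N = 0" by (rule low)
    qed simp
    also have "\<dots> = (\<Sum>j\<le>nat n. t1 S (int j) (n - int j) N)"
      by (simp add: sum.reindex)
    also have "\<dots> = psub (\<lambda>P R. t1 S P R N) 0 n"
    proof -
      have "(of_nat j gchoose j :: complex) = 1" for j
        using binomial_gbinomial[of j j, where 'a = complex] by simp
      then show ?thesis by (subst psub_sum[of 0 _ n "nat n"]) (use low in auto)
    qed
    finally show ?case using psub_bdd3[OF S] by simp
  next
    case (Suc b)
    have "bdd3 ((D12 ^^ 0) ((D13 ^^ Suc b) ((D23 ^^ 0) S)))" using Suc.prems by simp
    then have m: "mer (tay12 S m)" for m using tay12_mer[OF Suc.prems(1)] by blast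
    have k: "\<And>n. merk 0 (\<lambda>i j. S i j n)" using Suc.prems(2) by (simp add: merk_def)
    then have "merk 0 (\<lambda>i j. D13 S i j n)" for n by (rule merk_slice_D(2))
    then have "Sum_any (\<lambda>P. t1 (D13 S) P (n + 1 - P) N) = t2 (D13 S) 0 (n + 1) N"
      using Suc.IH[of "D13 S" "n + 1"] Suc.prems good3_D(2) by (simp add: funpow_swap1 merk_def)
    moreover have "tay12 S (- 1) = (\<lambda>m n. 0)" by (rule tay12_low[OF k]) simp
    then have "t2 S (- 1) (n + 1) N = 0" by (simp add: t2_def)
    moreover have "Sum_any (\<lambda>P. t1 S (P - 1) (n + 1 - P) N) = Sum_any (\<lambda>P. t1 S P (n - P) N)"
      using Sum_any_shift[of "\<lambda>P. t1 S (P - 1) (n + 1 - P) N" 1] by simp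
    ultimately show ?case
      using t2_D13[OF Suc.prems(1) m] t1_D13[OF Suc.prems(1)] by simp
  qed
next
  case (Suc c)
  have "bdd3 ((D12 ^^ 0) ((D13 ^^ b) ((D23 ^^ Suc c) S)))" using Suc.prems by simp
  then have m: "mer (tay12 S m)" for m using tay12_mer[OF Suc.prems(1)] by blast
  have "merk 0 (\<lambda>i j. D23 S i j n)" for n
    by (rule merk_slice_D(3)) (use Suc.prems(2) in \<open>simp add: merk_def\<close>)
  then have "Sum_any (\<lambda>P. t1 (D23 S) P (n + 1 - P) N) = t2 (D23 S) 0 (n + 1) N"
    using Suc.IH[of "D23 S" "n + 1"] Suc.prems good3_D(3) by (simp add: funpow_swap1 merk_def)
  then show ?case
    using t2_D23[OF Suc.prems(1) m] t1_D23[OF Suc.prems(1)] by (simp add: algebra_simps)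
qed


section \<open>Products of fields\<close>

text \<open>One \<open>k\<close> serves all vectors \<open>w\<close>, as the module axiom
  demands.\<close>

definition compat :: "('w \<Rightarrow> 'w series) \<Rightarrow> ('w \<Rightarrow> 'w series) \<Rightarrow> bool" where
  "compat a b \<longleftrightarrow> (\<exists>k. \<forall>w. merk k (op_prod a b w))"

text \<open>Indexed by the exponent of x0; in mode notation this is the product of \<open>a\<close>
  and \<open>b\<close> with index \<open>- R - 1\<close>.\<close>

definition fprod :: "int \<Rightarrow> ('w \<Rightarrow> 'w series) \<Rightarrow> ('w \<Rightarrow> 'w series) \<Rightarrow> 'w \<Rightarrow> 'w series" where
  "fprod R a b w n = tay (op_prod a b w) R n"

definition triple :: "('w \<Rightarrow> 'w series) \<Rightarrow> ('w \<Rightarrow> 'w series) \<Rightarrow> ('w \<Rightarrow> 'w series) \<Rightarrow> 'w \<Rightarrow> int \<Rightarrow> 'w series2" where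
  "triple a b c w = (\<lambda>i j n. a (b (c w n) j) i)"

definition vac :: "'w \<Rightarrow> 'w series" where
  "vac w n = (if n = 0 then w else 0)"

lemma hli_linear: "hom_laurent_inf s a \<Longrightarrow> Vector_Spaces.linear s s (\<lambda>w. a w n)"
  by (simp add: hom_laurent_inf_def)

lemma linearI: "(\<And>x y. f (x + y) = f x + f y) \<Longrightarrow> (\<And>c x. f (s c x) = s c (f x)) \<Longrightarrow> Vector_Spaces.linear s s f"
  by (simp add: Vector_Spaces.linear_iff vector_space_axioms)

lemma hli_simps:
  assumes "hom_laurent_inf s a"
  shows "a (x + y) n = a x n + a y n" "a (x - y) n = a x n - a y n" "a 0 n = 0" "a (s c x) n = s c (a x n)"
    "a (- x) n = - a x n"
proof -
  interpret l: Vector_Spaces.linear s s "\<lambda>w. a w n" by (rule hli_linear[OF assms])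
  show "a (x + y) n = a x n + a y n" "a (x - y) n = a x n - a y n" "a 0 n = 0" "a (s c x) n = s c (a x n)"
    "a (- x) n = - a x n"
    by (fact l.add l.diff l.zero l.scale l.neg)+
qed

lemma hli_upper: "hom_laurent_inf s a \<Longrightarrow> \<exists>M. \<forall>n>M. a w n = 0"
  by (simp add: hom_laurent_inf_def)

lemma hli_vac: "hom_laurent_inf s vac"
  unfolding hom_laurent_inf_def by (auto simp: vac_def intro!: linearI exI[of _ 0])

lemma compatD: "compat a b \<Longrightarrow> mer (op_prod a b w)"
  unfolding compat_def mer_def by blast

lemma op_prod_linear:
  assumes "hom_laurent_inf s a" "hom_laurent_inf s b"
  shows "op_prod a b (x + y) = (\<lambda>m n. op_prod a b x m n + op_prod a b y m n)"
    "op_prod a b (s c x) = (\<lambda>m n. s c (op_prod a b x m n))"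
  by (simp_all add: op_prod_def hli_simps[OF assms(1)] hli_simps[OF assms(2)])

lemma fprod_linear:
  assumes "hom_laurent_inf s a" "hom_laurent_inf s b" "compat a b"
  shows "Vector_Spaces.linear s s (\<lambda>w. fprod R a b w n)"
  by (rule linearI)
    (simp_all add: fprod_def op_prod_linear[OF assms(1,2)] tay_add tay_scale compatD[OF assms(3)])

lemma hli_fprod:
  assumes "hom_laurent_inf s a" "hom_laurent_inf s b" "compat a b"
  shows "hom_laurent_inf s (fprod R a b)"
  unfolding hom_laurent_inf_def
  using fprod_linear[OF assms] tay_upper[OF compatD[OF assms(3)]] by (simp add: fprod_def)

lemma fprod_low: "compat a b \<Longrightarrow> \<exists>c. \<forall>R<c. fprod R a b = (\<lambda>w n. 0)"
proof -
  assume "compat a b"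
  then obtain k where k: "\<And>w. merk k (op_prod a b w)" by (auto simp: compat_def)
  show ?thesis by (rule exI[of _ "- int k"]) (auto simp: fprod_def fun_eq_iff tay_low[OF k])
qed

lemma fprod_zero: "hom_laurent_inf s a \<Longrightarrow> fprod R a (\<lambda>w n. 0) = (\<lambda>w n. 0)"
  by (simp add: fprod_def op_prod_def fun_eq_iff hli_simps)

lemma triple_slice:
  assumes "compat a b" "compat b c" "hom_laurent_inf s a"
  shows "mer (\<lambda>i j. triple a b c w i j n)" "mer (triple a b c w i)"
    "tay (triple a b c w i) R n = a (fprod R b c w n) i"
proof -
  have 1: "(\<lambda>i j. triple a b c w i j n) = op_prod a b (c w n)" by (simp add: triple_def op_prod_def)
  show "mer (\<lambda>i j. triple a b c w i j n)" unfolding 1 by (rule compatD[OF assms(1)])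
  have 2: "triple a b c w i = (\<lambda>j n. a (op_prod b c w j n) i)" by (simp add: triple_def op_prod_def)
  show "mer (triple a b c w i)" unfolding 2 by (rule mer_map[OF hli_linear[OF assms(3)] compatD[OF assms(2)]])
  show "tay (triple a b c w i) R n = a (fprod R b c w n) i"
    unfolding 2 fprod_def by (rule tay_map[OF hli_linear[OF assms(3)] compatD[OF assms(2)]])
qed

lemma good3_triple:
  assumes "compat a b" "compat b c" "\<And>R. compat a (fprod R b c)" "hom_laurent_inf s a"
  shows "good3 (triple a b c w)"
proof -
  have 1: "(\<lambda>i j. triple a b c w i j n) = op_prod a b (c w n)" for n by (simp add: triple_def op_prod_def)
  have 2: "triple a b c w i = (\<lambda>j n. a (op_prod b c w j n) i)" for i by (simp add: triple_def op_prod_def)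
  have 3: "(\<lambda>i n. tay (triple a b c w i) R n) = op_prod a (fprod R b c) w" for R
    unfolding triple_slice(3)[OF assms(1,2,4)] by (simp add: op_prod_def)
  obtain k where "\<And>w. merk k (op_prod b c w)" using assms(2) by (auto simp: compat_def)
  then have "merk k (triple a b c w i)" for i
    unfolding 2 by (intro merk_map[of "\<lambda>x. a x i"]) (simp_all add: hli_simps[OF assms(4)])
  moreover obtain l where "\<And>w. merk l (op_prod a b w)" using assms(1) by (auto simp: compat_def)
  moreover have "mer (op_prod a (fprod R b c) w)" for R by (rule compatD[OF assms(3)])
  ultimately show ?thesis
    unfolding good3_def 1 3 by auto
qed

lemma t1_triple:
  assumes "compat a b" "compat b c" "hom_laurent_inf s a"
  shows "t1 (triple a b c w) P R N = fprod P a (fprod R b c) w N"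
  unfolding t1_def triple_slice(3)[OF assms] by (simp add: fprod_def op_prod_def)

lemma tay12_triple: "tay12 (triple a b c w) m = op_prod (fprod m a b) c w"
  by (simp add: tay12_def triple_def op_prod_def fprod_def)

lemma t2_triple: "t2 (triple a b c w) m n N = fprod n (fprod m a b) c w N"
  by (simp add: t2_def tay12_triple fprod_def)

lemma compat_vac: "hom_laurent_inf s b \<Longrightarrow> compat vac b"
  unfolding compat_def
proof (intro exI allI)
  fix w assume "hom_laurent_inf s b"
  then obtain M where "\<forall>n>M. b w n = 0" using hli_upper by blast
  then show "merk 0 (op_prod vac b w)"
    unfolding merk_def by (intro laurent_inf2I[of 0 _ M]) (auto simp: op_prod_def vac_def)
qed

lemma fprod_vac:
  assumes "hom_laurent_inf s b"
  shows "fprod R vac b w n = (if R = 0 then b w n else 0)"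
proof -
  obtain M where "\<forall>n>M. b w n = 0" using assms hli_upper by blast
  then have "laurent_inf2 (op_prod vac b w)"
    by (intro laurent_inf2I[of 0 _ M]) (auto simp: op_prod_def vac_def)
  then have "fprod R vac b w n = Sum_any (\<lambda>j. s (ib j R) (if j = 0 then b w (n + R - j) else 0))"
    unfolding fprod_def by (simp add: tay_eq_tay0 tay0_def op_prod_def vac_def)
  also have "\<dots> = Sum_any (\<lambda>j::int. if j = 0 then s (ib 0 R) (b w (n + R)) else 0)"
    by (intro arg_cong[of _ _ Sum_any] ext) simp
  also have "\<dots> = s (ib 0 R) (b w (n + R))" by (rule Sum_any.delta)
  also have "ib 0 R = (if R = 0 then 1 else 0)"
    by (cases "nat R") (auto simp: ib_def)
  finally show ?thesis by simp
qed

definition fder :: "('w \<Rightarrow> 'w series) \<Rightarrow> 'w \<Rightarrow> 'w series" where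
  "fder a w n = s (of_int (n + 1)) (a w (n + 1))"

text \<open>Substitution preserves the total degree, and clearing a pole of order \<open>k\<close>
  shifts it by \<open>k\<close>; hence weighting by the total degree commutes with the
  expansion.\<close>

lemma tay_mult_degree:
  assumes "mer A"
  shows "mer (\<lambda>m n. s (of_int (m + n)) (A m n))"
    "tay (\<lambda>m n. s (of_int (m + n)) (A m n)) R n = s (of_int (n + R)) (tay A R n)"
proof -
  obtain k where k: "merk k A" using assms by (auto simp: mer_def)
  let ?B = "\<lambda>m n. s (of_int (m + n)) (A m n)"
  have dm: "(dm ^^ k) ?B = (\<lambda>m n. s (of_int (m + n - int k)) ((dm ^^ k) A m n))" for k
    by (induction k) (simp_all add: dm_def fun_eq_iff scale_right_diff_distrib algebra_simps)
  have B: "merk k ?B"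
    using k unfolding merk_def dm laurent_inf2_def by force
  then show "mer ?B" by (auto simp: mer_def)
  let ?g = "\<lambda>j. s (ib j (R + int k)) ((dm ^^ k) A j (n + (R + int k) - j))"
  have "tay ?B R n = Sum_any (\<lambda>j. s (of_int (n + R)) (?g j))"
    unfolding tay_eq[OF B] tay0_def dm by (simp add: algebra_simps)
  also have "\<dots> = s (of_int (n + R)) (Sum_any ?g)"
    by (rule Sum_any_additive[symmetric], rule tay0_finite)
      (use k in \<open>simp_all add: merk_def scale_right_distrib\<close>)
  finally show "tay ?B R n = s (of_int (n + R)) (tay A R n)"
    unfolding tay_eq[OF k] tay0_def .
qed

text \<open>Leibniz rule for a(x2 + x0) b(x2) in x2: on the factor \<open>a\<close> the derivative
  is d/dx0, which produces the coefficient \<open>R + 1\<close>.\<close>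

lemma fder_fprod:
  assumes "hom_laurent_inf s a" "compat a b"
  shows "fder (fprod R a b) w n = s (of_int (R + 1)) (fprod (R + 1) a b w n) + fprod R a (fder b) w n"
proof -
  let ?A = "op_prod a b w"
  have A: "mer ?A" by (rule compatD[OF assms(2)])
  define B where "B = (\<lambda>m n. s (of_int m) (?A m n))"
  define C where "C = (\<lambda>m n. s (of_int (m + n)) (?A m n))"
  have B: "mer B" "tay B R n = s (of_int (R + 1)) (tay ?A (R + 1) (n - 1)) + s (of_int R) (tay ?A R n)" for R n
    using tay_mult_index[OF A] unfolding B_def by blast+
  have C: "mer C" "tay C R n = s (of_int (n + R)) (tay ?A R n)" for R n
    using tay_mult_degree[OF A] unfolding C_def by blast+
  \<comment> \<open>The exponent of x2 is written as the total degree minus the exponent of x1,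
    because both of these weights have known expansions.\<close>
  have "op_prod a (fder b) w = (\<lambda>m n. (\<lambda>m n. C m n - B m n) m (n - (- 1)))"
    by (simp add: op_prod_def fder_def C_def B_def fun_eq_iff hli_simps[OF assms(1)] algebra_simps
        flip: scale_left_diff_distrib)
  then have "fprod R a (fder b) w n = tay C R (n + 1) - tay B R (n + 1)"
    using tay_shift2[OF mer_diff[OF C(1) B(1)], where R = R and c = "- 1" and n = n] tay_diff[OF C(1) B(1)]
    by (simp add: fprod_def)
  then show ?thesis
    unfolding B C by (simp add: fder_def fprod_def scale_left_distrib algebra_simps)
qed

end

section \<open>The rational coefficient functions\<close>

definition esgn :: "int \<Rightarrow> complex" where
  "esgn n = (if even n then 1 else - 1)"

lemma esgn_pred: "esgn (n - 1) = - esgn n"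
  by (simp add: esgn_def)

lemma esgn_power: "n \<ge> 0 \<Longrightarrow> (- 1) ^ nat n = esgn n"
  by (auto simp: esgn_def even_nat_iff minus_one_power_iff)

lemma inv_lin_inf_eq:
  "inv_lin_inf c m n = (if m + n < 0 then (- c) ^ nat (- m - n - 1) * ib (m + n) n * esgn n else 0)"
proof (cases "m + n < 0 \<and> 0 \<le> n")
  case True
  have "inv_lin_inf c m n = Sum_any (\<lambda>i. if i = nat (- m - n - 1) then (- c) ^ i * binom_ser (- 1) (- int i - 1) m n else 0)"
    unfolding inv_lin_inf_def
    by (intro arg_cong[of _ _ Sum_any] ext) (use True in \<open>auto simp: binom_ser_def\<close>)
  also have "\<dots> = (- c) ^ nat (- m - n - 1) * binom_ser (- 1) (m + n) m n"
    using True by (simp add: Sum_any.delta)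
  finally show ?thesis using True by (simp add: binom_ser_def ib_def esgn_power)
next
  case False
  then have "inv_lin_inf c m n = Sum_any (\<lambda>i::nat. 0)"
    unfolding inv_lin_inf_def by (intro arg_cong[of _ _ Sum_any] ext) (auto simp: binom_ser_def)
  with False show ?thesis by auto
qed

text \<open>Pascal's rule in negative total degree, and the constant term 1 in total degree zero:
  the series is inverse to x1 - x2 + c.\<close>

lemma inv_lin_inf_rec: "inv_lin_inf c (m - 1) n - inv_lin_inf c m (n - 1) + c * inv_lin_inf c m n =
    (if m = 0 \<and> n = 0 then 1 else 0)"
proof -
  have p: "ib (m + n) n = ib (m + n - 1) n + ib (m + n - 1) (n - 1)"
    using ib_pascal[of "m + n - 1" n] by simp
  have z: "ib 0 n = (if n = 0 then 1 else 0)" by (cases "nat n") (auto simp: ib_def)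
  consider "m + n < 0" | "m + n = 0" | "m + n > 0" by linarith
  then show ?thesis
  proof cases
    case 1
    have e: "nat (- m - n) = Suc (nat (- m - n - 1))" using 1 by simp
    have "- (m - 1) - n - 1 = - m - n" "- m - (n - 1) - 1 = - m - n" "m - 1 + n = m + n - 1" "m + (n - 1) = m + n - 1"
      by simp_all
    then show ?thesis using 1 unfolding inv_lin_inf_eq
      by (simp only: e) (auto simp: p esgn_pred algebra_simps)
  next
    case 2
    then have m: "m = - n" by simp
    have "ib (- 1) n + ib (- 1) (n - 1) = (if n = 0 then 1 else 0)" using p z by (simp add: m)
    then have "esgn n * (ib (- 1) n + ib (- 1) (n - 1)) = (if n = 0 then 1 else 0)" by (simp add: esgn_def)
    then show ?thesis unfolding inv_lin_inf_eq by (auto simp: m esgn_pred algebra_simps)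
  next
    case 3
    then show ?thesis unfolding inv_lin_inf_eq by auto
  qed
qed

lemma inv_lin_inf_supp: "inv_lin_inf c m n \<noteq> 0 \<Longrightarrow> m < 0 \<and> 0 \<le> n \<and> n < - m"
  unfolding inv_lin_inf_eq by (cases "n < 0") (auto split: if_splits)

lemma inv_lin_zero_eq:
  "inv_lin_zero c m n = (if 0 \<le> m + n then inverse c ^ (nat (m + n) + 1) * ib (m + n) m * esgn m else 0)"
proof (cases "0 \<le> m + n \<and> 0 \<le> m")
  case True
  have "inv_lin_zero c m n = Sum_any (\<lambda>i. if i = nat (m + n) then inverse c ^ (i + 1) * binom_ser (- 1) (int i) n m else 0)"
    unfolding inv_lin_zero_def
    by (intro arg_cong[of _ _ Sum_any] ext) (use True in \<open>auto simp: binom_ser_def\<close>)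
  also have "\<dots> = inverse c ^ (nat (m + n) + 1) * binom_ser (- 1) (m + n) n m"
    using True by (simp add: Sum_any.delta)
  finally show ?thesis using True by (simp add: binom_ser_def ib_def esgn_power add.commute)
next
  case False
  then have "inv_lin_zero c m n = Sum_any (\<lambda>i::nat. 0)"
    unfolding inv_lin_zero_def by (intro arg_cong[of _ _ Sum_any] ext) (auto simp: binom_ser_def)
  with False show ?thesis by auto
qed

lemma ib_nat_eq_0: "0 \<le> x \<Longrightarrow> x < R \<Longrightarrow> ib x R = 0"
proof -
  assume "0 \<le> x" "x < R"
  then have "of_int x gchoose nat R = (of_nat (nat x choose nat R) :: complex)"
    unfolding binomial_gbinomial by simp
  then show ?thesis using \<open>0 \<le> x\<close> \<open>x < R\<close> by (simp add: ib_def binomial_eq_0)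
qed

lemma inv_lin_zero_supp: "inv_lin_zero c m n \<noteq> 0 \<Longrightarrow> 0 \<le> m \<and> 0 \<le> n"
  unfolding inv_lin_zero_eq using ib_nat_eq_0[of "m + n" m]
  by (cases "m < 0"; cases "n < 0") (auto split: if_splits)

lemma inv_lin_zero_rec:
  assumes "c \<noteq> 0"
  shows "inv_lin_zero c (m - 1) n - inv_lin_zero c m (n - 1) + c * inv_lin_zero c m n =
    (if m = 0 \<and> n = 0 then 1 else 0)"
proof -
  have p: "ib (m + n) m = ib (m + n - 1) m + ib (m + n - 1) (m - 1)"
    using ib_pascal[of "m + n - 1" m] by simp
  have z: "ib 0 m = (if m = 0 then 1 else 0)" by (cases "nat m") (auto simp: ib_def)
  consider "m + n < 0" | "m + n = 0" | "m + n > 0" by linarith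
  then show ?thesis
  proof cases
    case 1
    then show ?thesis unfolding inv_lin_zero_eq by auto
  next
    case 2
    then have m: "n = - m" by simp
    show ?thesis unfolding inv_lin_zero_eq using z assms by (auto simp: m esgn_def)
  next
    case 3
    have e: "nat (m + n) = Suc (nat (m + n - 1))" using 3 by simp
    have i: "m - 1 + n = m + n - 1" "m + (n - 1) = m + n - 1" by simp_all
    have "c * (inverse c ^ (nat (m + n) + 1) * ib (m + n) m * esgn m) = inverse c ^ nat (m + n) * ib (m + n) m * esgn m"
      using assms by simp
    then show ?thesis using 3 unfolding inv_lin_zero_eq i
      by (simp add: e p esgn_pred algebra_simps)
  qed
qed

lemma lin_ser_mult: "ser_mult (*) (lin_ser a) I m n = I (m - 1) n - I m (n - 1) + a * I m n"
proof -
  have b: "binom_ser (- 1) 1 i j = (if i = 1 \<and> j = 0 then 1 else if i = 0 \<and> j = 1 then - 1 else 0)" for i j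
  proof -
    consider "j < 0" | "j = 0" | "j = 1" | "j > 1" by linarith
    then show ?thesis
    proof cases
      case 4
      have "(of_int 1 gchoose nat j :: complex) = 0" using ib_nat_eq_0[of 1 j] 4 by (simp add: ib_def)
      with 4 show ?thesis by (auto simp: binom_ser_def)
    qed (auto simp: binom_ser_def)
  qed
  have "ser_mult (*) (lin_ser a) I m n = (\<Sum>(i, j)\<in>{(1, 0), (0, 1), (0, 0)}. lin_ser a i j * I (m - i) (n - j))"
    unfolding ser_mult_def by (rule Sum_any_superset) (auto simp: lin_ser_def b split: if_splits)
  then show ?thesis by (simp add: lin_ser_def b)
qed

text \<open>(z + a) / (z + b) = 1 + (a - b) / (z + b) with z = x1 - x2; in this form the support can
  be read off.\<close>

lemma ratio_inf_eq: "ratio_inf a b m n = (if m = 0 \<and> n = 0 then 1 else 0) + (a - b) * inv_lin_inf b m n"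
  using inv_lin_inf_rec[of b m n] by (simp add: ratio_inf_def lin_ser_mult algebra_simps)

lemma ratio_zero_eq: "b \<noteq> 0 \<Longrightarrow> ratio_zero a b m n = (if m = 0 \<and> n = 0 then 1 else 0) + (a - b) * inv_lin_zero b m n"
  using inv_lin_zero_rec[of b m n] by (simp add: ratio_zero_def lin_ser_mult algebra_simps)

lemma ratio_inf_supp: "ratio_inf a b m n \<noteq> 0 \<Longrightarrow> m \<le> 0 \<and> 0 \<le> n \<and> n \<le> - m"
  using inv_lin_inf_supp[of b m n] by (auto simp: ratio_inf_eq split: if_splits)

lemma ratio_zero_supp: "b \<noteq> 0 \<Longrightarrow> ratio_zero a b m n \<noteq> 0 \<Longrightarrow> 0 \<le> m \<and> 0 \<le> n"
  using inv_lin_zero_supp[of b m n] by (auto simp: ratio_zero_eq split: if_splits)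

context cvec
begin

text \<open>Clears the denominator: x1 - x2 + b times the product is (x1 - x2 + a) A, for either
  expansion of the inverse \<open>I\<close>. Finiteness makes the triple product
  associative.\<close>

lemma ser_mult_ratio:
  assumes rho: "\<And>m n. \<rho> m n = (if m = 0 \<and> n = 0 then 1 else 0) + (a - b) * I m n"
    and rec: "\<And>m n. I (m - 1) n - I m (n - 1) + b * I m n = (if m = 0 \<and> n = 0 then 1 else 0)"
    and fin: "\<And>m n. finite {(i, j). I i j \<noteq> 0 \<and> A (m - i) (n - j) \<noteq> 0}"
  shows "ser_mult s \<rho> A (m - 1) n - ser_mult s \<rho> A m (n - 1) + s b (ser_mult s \<rho> A m n) =
    A (m - 1) n - A m (n - 1) + s a (A m n)"
proof -
  let ?f = "\<lambda>m n (i, j). s (I i j) (A (m - i) (n - j))"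
  have f: "finite {x. ?f m n x \<noteq> 0}" for m n
    by (rule finite_subset[OF _ fin[of m n]]) auto
  have B: "ser_mult s \<rho> A m n = A m n + s (a - b) (Sum_any (?f m n))" for m n
  proof -
    have "ser_mult s \<rho> A m n = Sum_any (\<lambda>x::int \<times> int. (if x = (0, 0) then A m n else 0) + s (a - b) (?f m n x))"
      unfolding ser_mult_def
      by (intro arg_cong[of _ _ Sum_any] ext) (auto simp: rho scale_left_distrib split: if_splits)
    also have "\<dots> = Sum_any (\<lambda>x::int \<times> int. if x = (0, 0) then A m n else 0) + Sum_any (\<lambda>x. s (a - b) (?f m n x))"
      by (rule Sum_any.distrib) (auto intro: finite_supp_mono[OF f[of m n]] finite_subset[of _ "{(0, 0)}"])
    also have "Sum_any (\<lambda>x. s (a - b) (?f m n x)) = s (a - b) (Sum_any (?f m n))"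
      by (rule Sum_any_additive[OF f, symmetric]) (simp_all add: scale_right_distrib)
    finally show ?thesis by simp
  qed
  let ?g = "\<lambda>c d (i, j). s (I (i - c) (j - d)) (A (m - i) (n - j))"
  have g: "Sum_any (?f (m - c) (n - d)) = Sum_any (?g c d)" for c d
    using Sum_any_shift_prod[of "?f (m - c) (n - d)" c d] by (simp add: case_prod_unfold)
  have fg: "finite {x. ?g c d x \<noteq> 0}" for c d
  proof -
    have "{x. ?g c d x \<noteq> 0} \<subseteq> (\<lambda>(i, j). (i + c, j + d)) ` {x. ?f (m - c) (n - d) x \<noteq> 0}"
    proof
      fix x assume "x \<in> {x. ?g c d x \<noteq> 0}"
      then show "x \<in> (\<lambda>(i, j). (i + c, j + d)) ` {x. ?f (m - c) (n - d) x \<noteq> 0}"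
        by (intro image_eqI[of _ _ "(fst x - c, snd x - d)"]) (auto simp: algebra_simps split: prod.splits)
    qed
    then show ?thesis using f finite_subset by blast
  qed
  have "Sum_any (?f (m - 1) n) - Sum_any (?f m (n - 1)) + s b (Sum_any (?f m n)) = A m n"
  proof -
    have "Sum_any (?f (m - 1) n) - Sum_any (?f m (n - 1)) + s b (Sum_any (?f m n)) =
        Sum_any (?g 1 0) - Sum_any (?g 0 1) + Sum_any (\<lambda>x. s b (?g 0 0 x))"
      using g[of 1 0] g[of 0 1] g[of 0 0] Sum_any_additive[OF fg[of 0 0], of "s b"]
      by (simp add: scale_right_distrib)
    also have "\<dots> = Sum_any (\<lambda>x. ?g 1 0 x - ?g 0 1 x) + Sum_any (\<lambda>x. s b (?g 0 0 x))"
      by (simp only: Sum_any_diff[OF fg fg])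
    also have "\<dots> = Sum_any (\<lambda>x. ?g 1 0 x - ?g 0 1 x + s b (?g 0 0 x))"
    proof (rule Sum_any.distrib[symmetric])
      show "finite {x. ?g 1 0 x - ?g 0 1 x \<noteq> 0}"
        by (rule finite_subset[OF _ finite_UnI[OF fg[of 1 0] fg[of 0 1]]]) auto
      show "finite {x. s b (?g 0 0 x) \<noteq> 0}"
        by (rule finite_subset[OF _ fg[of 0 0]]) auto
    qed
    also have "\<dots> = Sum_any (\<lambda>x::int \<times> int. if x = (0, 0) then A m n else 0)"
    proof (intro arg_cong[of _ _ Sum_any] ext)
      fix x :: "int \<times> int"
      obtain i j where x: "x = (i, j)" by (cases x)
      have "?g 1 0 x - ?g 0 1 x + s b (?g 0 0 x) = s (I (i - 1) j - I i (j - 1) + b * I i j) (A (m - i) (n - j))"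
        by (simp add: x scale_left_distrib scale_left_diff_distrib)
      then show "?g 1 0 x - ?g 0 1 x + s b (?g 0 0 x) = (if x = (0, 0) then A m n else 0)"
        unfolding rec by (auto simp: x)
    qed
    finally show ?thesis by simp
  qed
  then have "s (a - b) (Sum_any (?f (m - 1) n)) - s (a - b) (Sum_any (?f m (n - 1))) + s b (s (a - b) (Sum_any (?f m n))) = s (a - b) (A m n)"
    by (metis (no_types, lifting) scale_left_commute scale_right_diff_distrib scale_right_distrib)
  then show ?thesis unfolding B
    by (simp add: scale_right_distrib scale_left_diff_distrib algebra_simps)
qed

lemma ser_mult_delta:
  "ser_mult s (delta_ser c) (\<lambda>m n. if m = 0 then x n else 0) m n = s c (x (m + n + 1))"
proof -
  have "ser_mult s (delta_ser c) (\<lambda>m n. if m = 0 then x n else 0) m n =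
      Sum_any (\<lambda>p. if p = (m, - m - 1) then s c (x (m + n + 1)) else 0)"
    unfolding ser_mult_def
    by (intro arg_cong[of _ _ Sum_any] ext) (auto simp: delta_ser_def algebra_simps split: if_splits)
  then show ?thesis by simp
qed


section \<open>Passing one field through another\<close>

definition star :: "('w \<Rightarrow> 'w series) \<Rightarrow> (int \<Rightarrow> 'w) \<Rightarrow> 'w series" where
  "star u B m = Sum_any (\<lambda>i. u (B i) (m - i))"

text \<open>\<open>star u B\<close> is \<open>u(y) B(y)\<close> for a Laurent polynomial \<open>B\<close> with vector coefficients.
  \<open>passes k c u a\<close>: inserting \<open>(y - x)\<^sup>k a(x)\<close> between \<open>u(y)\<close> and \<open>B(y)\<close> raises the degree in \<open>y\<close> by
  at most \<open>c\<close>, no matter how large the degree of \<open>B\<close> is.\<close>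

definition passes :: "nat \<Rightarrow> nat \<Rightarrow> ('w \<Rightarrow> 'w series) \<Rightarrow> ('w \<Rightarrow> 'w series) \<Rightarrow> bool" where
  "passes k c u a \<longleftrightarrow> (\<forall>B N. finite {i. B i \<noteq> 0} \<longrightarrow> (\<forall>m>N. star u B m = 0) \<longrightarrow>
     (\<forall>m n. m > N + int c \<longrightarrow> (dm ^^ k) (\<lambda>m n. star u (\<lambda>i. a (B i) n) m) m n = 0))"

lemma passesD: "passes k c u a \<Longrightarrow> finite {i. B i \<noteq> 0} \<Longrightarrow> (\<And>m. m > N \<Longrightarrow> star u B m = 0) \<Longrightarrow>
    m > N + int c \<Longrightarrow> (dm ^^ k) (\<lambda>m n. star u (\<lambda>i. a (B i) n) m) m n = 0"
  unfolding passes_def by blast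

lemma passes_Suc: "passes k c u a \<Longrightarrow> passes (Suc k) (Suc c) u a"
  unfolding passes_def by (auto simp: dm_def)

lemma passes_mono: "passes k c u a \<Longrightarrow> passes (k + d) (c + d) u a"
  by (induction d) (auto intro: passes_Suc)

lemma passes_mono2: "passes k c u a \<Longrightarrow> c \<le> c' \<Longrightarrow> passes k c' u a"
  unfolding passes_def by force

lemma star_sum:
  assumes "hom_laurent_inf s u" "finite S" "\<And>i. i \<notin> S \<Longrightarrow> B i = 0"
  shows "star u B m = (\<Sum>i\<in>S. u (B i) (m - i))"
  unfolding star_def by (rule Sum_any_superset) (simp_all add: assms hli_simps[OF assms(1)])

lemma star_diff:
  assumes "hom_laurent_inf s u" "finite {i. B i \<noteq> 0}" "finite {i. C i \<noteq> 0}"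
  shows "star u (\<lambda>i. B i - C i) m = star u B m - star u C m"
proof -
  let ?S = "{i. B i \<noteq> 0} \<union> {i. C i \<noteq> 0}"
  have S: "finite ?S" using assms by blast
  show ?thesis
    using star_sum[OF assms(1) S, of B m] star_sum[OF assms(1) S, of C m]
      star_sum[OF assms(1) S, of "\<lambda>i. B i - C i" m]
    by (simp add: hli_simps[OF assms(1)] sum_subtractf)
qed

lemma star_shift: "star u (\<lambda>i. B (i - 1)) m = star u B (m - 1)"
  unfolding star_def using Sum_any_shift[of "\<lambda>i. u (B (i - 1)) (m - i)" 1] by (simp add: algebra_simps)

lemma dm_pow_zero: "(dm ^^ k) (\<lambda>m n. 0) = (\<lambda>m n. 0)"
  by (induction k) (simp_all add: dm_def)

lemma finite_shift: "finite {i::int. B i \<noteq> 0} \<Longrightarrow> finite {i. B (i - 1) \<noteq> (0 :: 'w)}"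
proof -
  assume "finite {i. B i \<noteq> 0}"
  moreover have "{i. B (i - 1) \<noteq> 0} = (\<lambda>i. i + 1) ` {i. B i \<noteq> 0}" by (force simp: image_iff)
  ultimately show ?thesis by simp
qed

lemma finite_dm_pow:
  assumes "\<And>n. finite {i. A i n \<noteq> (0 :: 'w)}"
  shows "finite {i. (dm ^^ k) A i n \<noteq> 0}"
proof (induction k arbitrary: n)
  case (Suc k)
  have "finite {i. (dm ^^ k) A (i - 1) n \<noteq> 0}" by (rule finite_shift[OF Suc])
  then show ?case
    by (rule finite_subset[rotated, OF finite_UnI[OF _ Suc[of "n - 1"]]]) (auto simp: dm_def[of "(dm ^^ k) A"])
qed (use assms in simp)

lemma star_dm_pow:
  assumes "hom_laurent_inf s u" "\<And>n. finite {i. A i n \<noteq> 0}"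
  shows "(dm ^^ k) (\<lambda>m n. star u (\<lambda>i. A i n) m) = (\<lambda>m n. star u (\<lambda>i. (dm ^^ k) A i n) m)"
proof (induction k)
  case (Suc k)
  let ?A = "(dm ^^ k) A"
  have f: "finite {i. ?A i n \<noteq> 0}" for n by (rule finite_dm_pow) (rule assms)
  show ?case
    unfolding funpow.simps comp_apply Suc
    by (simp add: dm_def[of ?A] dm_def[of "\<lambda>m n. star u (\<lambda>i. ?A i n) m"]
        star_diff[OF assms(1) finite_shift[OF f] f] star_shift[of u "\<lambda>i. ?A i _"])
qed simp

lemma mer_tay_sum:
  assumes "finite S" "\<And>i. i \<in> S \<Longrightarrow> mer (A i)"
  shows "mer (\<lambda>l n. \<Sum>i\<in>S. A i l n) \<and> (\<forall>R n. tay (\<lambda>l n. \<Sum>i\<in>S. A i l n) R n = (\<Sum>i\<in>S. tay (A i) R n))"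
  using assms
proof (induction S)
  case empty
  have "merk 0 (\<lambda>l n::int. 0 :: 'w)" by (simp add: merk_def laurent_inf2_def)
  then show ?case by (auto simp: mer_def)
next
  case (insert i S)
  then show ?case by (simp add: mer_add tay_add)
qed

lemma star_tay:
  assumes u: "hom_laurent_inf s u" and S: "finite S" "\<And>i l n. i \<notin> S \<Longrightarrow> A i l n = 0" and A: "\<And>i. mer (A i)"
  shows "mer (\<lambda>l n. star u (\<lambda>i. A i l n) m)"
    "tay (\<lambda>l n. star u (\<lambda>i. A i l n) m) R n = star u (\<lambda>i. tay (A i) R n) m"
proof -
  have 1: "star u (\<lambda>i. A i l n) m = (\<Sum>i\<in>S. u (A i l n) (m - i))" for l n
    by (rule star_sum[OF u]) (use S in auto)
  have z: "tay (A i) R n = 0" if "i \<notin> S" for i R n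
  proof -
    have "A i = (\<lambda>l n. 0)" using S(2)[OF that] by blast
    then show ?thesis by simp
  qed
  have 2: "star u (\<lambda>i. tay (A i) R n) m = (\<Sum>i\<in>S. u (tay (A i) R n) (m - i))"
    by (rule star_sum[OF u]) (use S z in auto)
  have m: "mer (\<lambda>l n. u (A i l n) (m - i))" for i by (rule mer_map[OF hli_linear[OF u] A])
  show "mer (\<lambda>l n. star u (\<lambda>i. A i l n) m)"
    unfolding 1 using mer_tay_sum[OF S(1), of "\<lambda>i l n. u (A i l n) (m - i)"] m by blast
  have "tay (\<lambda>l n. u (A i l n) (m - i)) R n = u (tay (A i) R n) (m - i)" for i
    by (rule tay_map[OF hli_linear[OF u] A])
  then show "tay (\<lambda>l n. star u (\<lambda>i. A i l n) m) R n = star u (\<lambda>i. tay (A i) R n) m"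
    unfolding 1 2 using mer_tay_sum[OF S(1), of "\<lambda>i l n. u (A i l n) (m - i)"] m by simp
qed

lemma finite_image_supp:
  assumes "hom_laurent_inf s a" "finite {i. B i \<noteq> 0}"
  shows "finite {i. a (B i) n \<noteq> 0}"
  by (rule finite_supp_mono[OF assms(2)]) (simp add: hli_simps[OF assms(1)])

lemma passes_vac: "passes 0 0 u vac" if "hom_laurent_inf s u"
  unfolding passes_def
proof (intro allI impI)
  fix B :: "int \<Rightarrow> 'w" and N m n
  assume "\<forall>m>N. star u B m = 0" "m > N + int 0"
  moreover have "star u (\<lambda>i. 0) m = 0" by (simp add: star_def hli_simps[OF that])
  ultimately show "(dm ^^ 0) (\<lambda>m n. star u (\<lambda>i. vac (B i) n) m) m n = 0"
    by (cases "n = 0") (simp_all add: vac_def)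
qed

lemma passes_combine:
  assumes "hom_laurent_inf s u" "hom_laurent_inf s a" "hom_laurent_inf s b" "passes k c u a" "passes l d u b"
  shows "\<exists>k c. passes k c u (\<lambda>w n. s \<alpha> (a w n) - s \<beta> (b w n))"
proof -
  let ?K = "k + l" and ?C = "max (c + l) (d + k)"
  have a: "passes ?K ?C u a" using passes_mono2[OF passes_mono[OF assms(4), of l]] by simp
  have b: "passes ?K ?C u b" using passes_mono2[OF passes_mono[OF assms(5), of k]] by (simp add: add.commute)
  have "passes ?K ?C u (\<lambda>w n. s \<alpha> (a w n) - s \<beta> (b w n))"
    unfolding passes_def
  proof (intro allI impI)
    fix B :: "int \<Rightarrow> 'w" and N m n
    assume B: "finite {i. B i \<noteq> 0}" "\<forall>m>N. star u B m = 0" "m > N + int ?C"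
    have f: "finite {i. s \<alpha> (a (B i) n) \<noteq> 0}" "finite {i. s \<beta> (b (B i) n) \<noteq> 0}" for n
      by (rule finite_supp_mono[OF B(1)], simp add: hli_simps[OF assms(2)] hli_simps[OF assms(3)])+
    have sc: "star u (\<lambda>i. s \<gamma> (C i)) m = s \<gamma> (star u C m)" if "finite {i. C i \<noteq> 0}" for \<gamma> C m
      unfolding star_sum[OF assms(1) that, of C m, simplified]
      by (subst star_sum[OF assms(1) that]) (simp_all add: hli_simps[OF assms(1)] scale_sum_right)
    have "(\<lambda>m n. star u (\<lambda>i. s \<alpha> (a (B i) n) - s \<beta> (b (B i) n)) m) =
       (\<lambda>m n. s \<alpha> (star u (\<lambda>i. a (B i) n) m) - s \<beta> (star u (\<lambda>i. b (B i) n) m))"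
      by (simp add: star_diff[OF assms(1) f] sc finite_image_supp[OF assms(2) B(1)] finite_image_supp[OF assms(3) B(1)])
    then show "(dm ^^ ?K) (\<lambda>m n. star u (\<lambda>i. s \<alpha> (a (B i) n) - s \<beta> (b (B i) n)) m) m n = 0"
      using passesD[OF a B(1) _ B(3)] passesD[OF b B(1) _ B(3)] B(2)
      by (simp add: dm_pow_diff dm_pow_map[of "s _"] scale_right_diff_distrib)
  qed
  then show ?thesis by blast
qed

text \<open>The constant polynomial \<open>w\<close> in place of \<open>B\<close> gives the bound in
  x1; the bound in x2 is that of \<open>a w\<close>, raised by \<open>k\<close>.\<close>

lemma passes_merk:
  assumes "passes k c u a" "hom_laurent_inf s u" "hom_laurent_inf s a"
  shows "merk k (op_prod u a w)"
proof -
  define B where "B i = (if i = 0 then w else 0)" for i :: int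
  have B: "finite {i. B i \<noteq> 0}" by (rule finite_subset[of _ "{0}"]) (auto simp: B_def)
  have 1: "star u B m = u w m" for m
    using star_sum[OF assms(2), of "{0}" B m] by (simp add: B_def)
  have 2: "star u (\<lambda>i. a (B i) n) m = u (a w n) m" for m n
    using star_sum[OF assms(2), of "{0}" "\<lambda>i. a (B i) n" m] by (simp add: B_def hli_simps[OF assms(3)])
  obtain N where N: "\<forall>m>N. u w m = 0" using hli_upper[OF assms(2)] by blast
  obtain M where M: "\<forall>n>M. a w n = 0" using hli_upper[OF assms(3)] by blast
  show "merk k (op_prod u a w)"
    unfolding merk_def
  proof (rule laurent_inf2I)
    fix m n :: int assume "m > N + int c"
    then show "(dm ^^ k) (op_prod u a w) m n = 0"
      using passesD[OF assms(1) B, of N m n] N by (simp add: 1 2 op_prod_def)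
  next
    fix m n :: int assume "n > M + int k"
    then show "(dm ^^ k) (op_prod u a w) m n = 0"
      by (intro dm_pow_vanish2[of M]) (use M in \<open>simp_all add: op_prod_def hli_simps[OF assms(2)]\<close>)
  qed
qed

lemma passes_compat:
  "passes k c u a \<Longrightarrow> hom_laurent_inf s u \<Longrightarrow> hom_laurent_inf s a \<Longrightarrow> compat u a"
  unfolding compat_def using passes_merk by blast

text \<open>Analogue of Dong's lemma. Let y, x, z be the variables of \<open>u\<close>,
  \<open>t\<close>, \<open>a\<close>, and clear the pole of \<open>u\<close> against
  \<open>a\<close> first. Above degree \<open>M\<close> in y, passing \<open>t\<close> makes y and x
  act alike, so y - z acts as x - z and lowers \<open>R\<close> by one. The products vanish below
  \<open>R0\<close>, hence a further power \<open>j\<close> of y - z kills everything. The bound for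
  \<open>t\<close> is applied to (y - z)^k a(z) B(y), again a Laurent polynomial in y: this is why
  \<open>passes\<close> quantifies over all \<open>B\<close>.\<close>

lemma passes_fprod:
  assumes hli: "hom_laurent_inf s u" "hom_laurent_inf s t" "hom_laurent_inf s a"
    and ut: "passes 1 1 u t" and ua: "passes k c u a" and ta: "compat t a"
  shows "\<exists>k c. passes k c u (fprod R t a)"
proof -
  obtain R0 where R0: "\<And>R. R < R0 \<Longrightarrow> fprod R t a = (\<lambda>w n. 0)" using fprod_low[OF ta] by blast
  define j where "j = nat (R - R0 + 1)"
  have "passes (j + k) (c + 1 + j) u (fprod R t a)"
    unfolding passes_def
  proof (intro allI impI)
    fix B :: "int \<Rightarrow> 'w" and N m n
    assume B: "finite {i. B i \<noteq> 0}" "\<forall>m>N. star u B m = 0" and m: "m > N + int (c + 1 + j)"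
    define P where "P = (dm ^^ k) (\<lambda>i n. a (B i) n)"
    define K where "K m l n = star u (\<lambda>i. t (P i n) l) m" for m l n
    define W where "W R = (dm ^^ k) (\<lambda>m n. star u (\<lambda>i. fprod R t a (B i) n) m)" for R
    define M where "M = N + int c + 1"
    have fin: "finite {i. P i n \<noteq> 0}" for n
      unfolding P_def by (rule finite_dm_pow) (rule finite_image_supp[OF hli(3) B(1)])
    define S where "S = (\<lambda>m l n. star u (\<lambda>i. op_prod t a (B i) l n) m)"
    have z: "op_prod t a (B i) l n = 0" if "i \<notin> {i. B i \<noteq> 0}" for i l n
      using that by (simp add: op_prod_def hli_simps[OF hli(2)] hli_simps[OF hli(3)])
    note st = star_tay[OF hli(1) B(1), of "\<lambda>i. op_prod t a (B i)", OF z compatD[OF ta]]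
    have mS: "mer (S m)" for m unfolding S_def by (rule st(1))
    have KS: "(D13 ^^ k) S = K"
    proof (intro ext)
      fix m l n
      have f: "finite {i. t (a (B i) n) l \<noteq> 0}" for n
        by (rule finite_image_supp[OF hli(2) finite_image_supp[OF hli(3) B(1)]])
      have "(D13 ^^ k) S m l n = star u (\<lambda>i. (dm ^^ k) (\<lambda>i n. t (a (B i) n) l) i n) m"
        unfolding D13_pow S_def op_prod_def using star_dm_pow[OF hli(1), of "\<lambda>i n. t (a (B i) n) l" k] f by simp
      also have "(dm ^^ k) (\<lambda>i n. t (a (B i) n) l) = (\<lambda>i n. t (P i n) l)"
        unfolding P_def by (rule dm_pow_map[where f = "\<lambda>x. t x l"]) (simp add: hli_simps[OF hli(2)])
      finally show "(D13 ^^ k) S m l n = K m l n" by (simp add: K_def)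
    qed
    have mK: "mer (K m)" for m using tay_D13_pow[of S k, OF mS] by (simp add: KS)
    have WK: "W R m n = tay (K m) R n" for R m n
    proof -
      have "(\<lambda>m n. star u (\<lambda>i. fprod R t a (B i) n) m) = (\<lambda>m. tay (S m) R)"
        unfolding S_def fprod_def using st(2) by (simp add: fun_eq_iff)
      then show ?thesis
        unfolding W_def using tay_D13_pow[of S k R, OF mS] by (simp add: KS fun_eq_iff)
    qed
    have K: "K (m - 1) l n = K m (l - 1) n" if "m > M" for m l n
    proof -
      have "star u (\<lambda>i. P i n) m = 0" if "m > N + int c" for m
        using passesD[OF ua B(1) _ that, of n] B(2) star_dm_pow[OF hli(1), of "\<lambda>i n. a (B i) n" k]
          finite_image_supp[OF hli(3) B(1)] by (simp add: P_def fun_eq_iff)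
      then have "(dm ^^ 1) (\<lambda>m l. star u (\<lambda>i. t (P i n) l) m) m l = 0"
        by (intro passesD[OF ut fin[of n], of "N + int c"]) (use that M_def in auto)
      then show ?thesis by (simp add: K_def dm_def)
    qed
    have dW: "dm (W R) m n = W (R - 1) m n" if "m > M" for R m n
    proof -
      have "K (m - 1) = (\<lambda>l n. K m (l - 1) n)" using K[OF that] by blast
      then have "W R (m - 1) n = W R m (n - 1) + W (R - 1) m n"
        unfolding WK using tay_shift1[OF mK] by simp
      then show ?thesis by (simp add: dm_def)
    qed
    have "(dm ^^ j) (W R) m n = 0" if "R < R0 + int j" "m > M + int j" for j R m n
      using that
    proof (induction j arbitrary: R m)
      case 0
      then have "W R = (dm ^^ k) (\<lambda>m n. 0)"
        using R0 by (simp add: W_def star_def hli_simps[OF hli(1)])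
      then show ?case by (simp add: dm_pow_zero)
    next
      case (Suc j)
      have "(dm ^^ j) (\<lambda>m n. dm (W R) m n - W (R - 1) m n) m n = 0"
        by (rule dm_pow_vanish1[of M]) (use dW Suc.prems in auto)
      moreover have "(dm ^^ j) (W (R - 1)) m n = 0" by (rule Suc.IH) (use Suc.prems in auto)
      ultimately show ?case by (simp add: dm_pow_diff funpow_swap1)
    qed
    from this[of R j m n] m show "(dm ^^ (j + k)) (\<lambda>m n. star u (\<lambda>i. fprod R t a (B i) n) m) m n = 0"
      unfolding funpow_add comp_apply W_def[symmetric] by (simp add: j_def M_def)
  qed
  then show ?thesis by blast
qed


lemma t1_combine:
  assumes "good3 K" "good3 L"
  shows "t1 (\<lambda>i j n. s \<alpha> (K i j n) + s \<beta> (L i j n)) P R N = s \<alpha> (t1 K P R N) + s \<beta> (t1 L P R N)"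
proof -
  note K = good3D[OF assms(1)] and L = good3D[OF assms(2)]
  have sc: "mer (\<lambda>m n. s c (A m n))" if "mer A" for c A by (rule mer_map[OF linear_scale_s that])
  have "(\<lambda>i n. tay (\<lambda>j n. s \<alpha> (K i j n) + s \<beta> (L i j n)) R n) =
      (\<lambda>i n. s \<alpha> (tay (K i) R n) + s \<beta> (tay (L i) R n))"
    by (simp add: tay_add tay_scale sc K(2) L(2))
  then show ?thesis unfolding t1_def by (simp add: tay_add tay_scale sc K(3) L(3))
qed

text \<open>The hypotheses of \<open>fubini\<close>: no pole is left along y = x, and those along y
  = z and x = z have orders at most \<open>b\<close> and \<open>c\<close>.\<close>

definition nice :: "nat \<Rightarrow> nat \<Rightarrow> (int \<Rightarrow> 'w series2) \<Rightarrow> bool" where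
  "nice b c C \<longleftrightarrow> bdd3 ((D13 ^^ b) ((D23 ^^ c) C)) \<and> (\<forall>i. merk c (C i)) \<and> (\<forall>j. merk b (\<lambda>i n. C i j n))"

lemma nice_fubini: "nice b c C \<Longrightarrow> t1 C P R N = t1 (\<lambda>j i n. C i j n) R P N"
  unfolding nice_def using fubini by blast

lemma nice_low: "nice b c C \<Longrightarrow> P < - int b \<or> R < - int c \<Longrightarrow> t1 C P R N = 0"
  unfolding nice_def using t1_clear_poles[of b c C P R N] t1_low_bdd3[of _ "P + int b" "R + int c" N] by auto

lemma bdd3_diff: "bdd3 G \<Longrightarrow> bdd3 K \<Longrightarrow> bdd3 (\<lambda>i j n. G i j n - K i j n)"
  for G :: "int \<Rightarrow> 'w series2"
  unfolding bdd3_def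
proof (elim exE)
  fix M N assume "\<forall>i j n. i > M \<or> j > M \<or> n > M \<longrightarrow> G i j n = 0" "\<forall>i j n. i > N \<or> j > N \<or> n > N \<longrightarrow> K i j n = 0"
  then show "\<exists>N. \<forall>i j n. i > N \<or> j > N \<or> n > N \<longrightarrow> G i j n - K i j n = 0" by (intro exI[of _ "max M N"]) simp
qed

lemma bdd3_D12: "bdd3 G \<Longrightarrow> bdd3 (D12 G)" for G :: "int \<Rightarrow> 'w series2"
proof -
  assume "bdd3 G"
  then obtain N where N: "\<And>i j n. i > N \<or> j > N \<or> n > N \<Longrightarrow> G i j n = 0" unfolding bdd3_def by blast
  show ?thesis unfolding bdd3_def D12_def by (rule exI[of _ "N + 1"]) (use N in auto)
qed

lemma bdd3_scale: "bdd3 G \<Longrightarrow> bdd3 (\<lambda>i j n. s c (G i j n))" for G :: "int \<Rightarrow> 'w series2"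
  unfolding bdd3_def by (metis scale_zero_right)

lemma nice_D12: "nice b c C \<Longrightarrow> nice b c (D12 C)"
proof -
  assume C: "nice b c C"
  have "(D13 ^^ b) ((D23 ^^ c) (D12 C)) = D12 ((D13 ^^ b) ((D23 ^^ c) C))"
    using funpow_swap[of D12 D23 1 c C, OF D12_D23] funpow_swap[of D12 D13 1 b "(D23 ^^ c) C", OF D12_D13] by simp
  moreover have "merk c (D12 C i)" for i
    unfolding D12_def using C merk_shift[of c "C i" 1 0] by (auto simp: nice_def intro!: merk_diff)
  moreover have "merk b (\<lambda>i n. D12 C i j n)" for j
    unfolding D12_def using C merk_shift[of b "\<lambda>i n. C i j n" 1 0] by (auto simp: nice_def intro!: merk_diff)
  ultimately show ?thesis using C bdd3_D12 unfolding nice_def by auto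
qed

lemma nice_combine: "nice b c C \<Longrightarrow> nice b c K \<Longrightarrow> nice b c (\<lambda>i j n. s \<alpha> (C i j n) - s \<beta> (K i j n))"
proof -
  assume *: "nice b c C" "nice b c K"
  have "(D13 ^^ b) ((D23 ^^ c) (\<lambda>i j n. s \<alpha> (C i j n) - s \<beta> (K i j n))) =
     (\<lambda>i j n. s \<alpha> ((D13 ^^ b) ((D23 ^^ c) C) i j n) - s \<beta> ((D13 ^^ b) ((D23 ^^ c) K) i j n))"
    by (simp add: D13_pow D23_pow dm_pow_diff dm_pow_map[of "s _"] scale_right_diff_distrib)
  moreover have "merk c (\<lambda>j n. s \<alpha> (C i j n) - s \<beta> (K i j n))" for i
    using * by (auto simp: nice_def intro!: merk_diff merk_map[of "s _"] scale_right_diff_distrib)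
  moreover have "merk b (\<lambda>i n. s \<alpha> (C i j n) - s \<beta> (K i j n))" for j
    using * by (auto simp: nice_def intro!: merk_diff merk_map[of "s _"] scale_right_diff_distrib)
  ultimately show ?thesis using * unfolding nice_def by (auto intro!: bdd3_diff bdd3_scale)
qed

text \<open>\<open>passes\<close> is used twice: \<open>A\<close> is (y - z)^k a(z) w, viewed as a
  Laurent polynomial in y whose product with u(y) has bounded degree; then \<open>b\<close> is
  inserted between \<open>u\<close> and \<open>A\<close>.\<close>

lemma triple_y_bound:
  assumes hli: "hom_laurent_inf s u" "hom_laurent_inf s b" "hom_laurent_inf s a"
    and ua: "passes k c u a" and ub: "passes l d u b"
  shows "\<exists>N. \<forall>i>N. \<forall>j n. (D12 ^^ l) ((D13 ^^ k) (triple u b a w)) i j n = 0"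
proof -
  define B where "B i = (if i = 0 then w else 0)" for i :: int
  have B: "finite {i. B i \<noteq> 0}" by (rule finite_subset[of _ "{0}"]) (auto simp: B_def)
  have 1: "star u B m = u w m" for m
    using star_sum[OF hli(1), of "{0}" B m] by (simp add: B_def)
  obtain N where N: "\<And>m. m > N \<Longrightarrow> star u B m = 0" using hli_upper[OF hli(1)] 1 by metis
  define A where "A = (dm ^^ k) (\<lambda>i n. a (B i) n)"
  have finA: "finite {i. A i n \<noteq> 0}" for n
    unfolding A_def by (rule finite_dm_pow) (rule finite_image_supp[OF hli(3) B])
  have sA: "star u (\<lambda>i. A i n) m = 0" if "m > N + int c" for m n
    using passesD[OF ua B N that, of n] star_dm_pow[OF hli(1), of "\<lambda>i n. a (B i) n" k]
      finite_image_supp[OF hli(3) B] by (simp add: A_def fun_eq_iff)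
  have arrA: "(D13 ^^ k) (triple u b a w) m j n = star u (\<lambda>i. b (A i n) j) m" for m j n
  proof -
    have s0: "star u (\<lambda>i. b (a (B i) n) j) m = u (b (a w n) j) m" for m n
      using star_sum[OF hli(1), of "{0}" "\<lambda>i. b (a (B i) n) j" m]
      by (simp add: B_def hli_simps[OF hli(2)] hli_simps[OF hli(3)])
    have "finite {i. b (a (B i) n) j \<noteq> 0}" for n
      by (rule finite_image_supp[OF hli(2) finite_image_supp[OF hli(3) B]])
    then have "(D13 ^^ k) (triple u b a w) m j n = star u (\<lambda>i. (dm ^^ k) (\<lambda>i n. b (a (B i) n) j) i n) m"
      unfolding D13_pow triple_def s0[symmetric]
      using star_dm_pow[OF hli(1), of "\<lambda>i n. b (a (B i) n) j" k] by (simp add: fun_eq_iff)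
    also have "(dm ^^ k) (\<lambda>i n. b (a (B i) n) j) = (\<lambda>i n. b (A i n) j)"
      unfolding A_def by (rule dm_pow_map[where f = "\<lambda>x. b x j"]) (simp add: hli_simps[OF hli(2)])
    finally show ?thesis .
  qed
  have "(D12 ^^ l) ((D13 ^^ k) (triple u b a w)) m j n = 0" if "m > N + int c + int d" for m j n
    unfolding D12_pow arrA using passesD[OF ub finA sA that] .
  then show ?thesis by blast
qed

lemma triple_bdd3:
  assumes hli: "hom_laurent_inf s u" "hom_laurent_inf s b" "hom_laurent_inf s a"
    and ua: "passes k c u a" and ub: "passes l d u b" and ba: "\<And>w. merk e (op_prod b a w)"
  shows "bdd3 ((D12 ^^ l) ((D13 ^^ k) ((D23 ^^ e) (triple u b a w))))"
proof -
  obtain N where N: "\<And>i j n. i > N \<Longrightarrow> (D12 ^^ l) ((D13 ^^ k) (triple u b a w)) i j n = 0"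
    using triple_y_bound[OF hli ua ub, of w] by blast
  obtain M where M: "\<And>j n. j > M \<or> n > M \<Longrightarrow> (dm ^^ e) (op_prod b a w) j n = 0"
    using ba[of w] unfolding merk_def laurent_inf2_def by blast
  have "(D23 ^^ e) (triple u b a w) i j n = u ((dm ^^ e) (op_prod b a w) j n) i" for i j n
  proof -
    have "triple u b a w i = (\<lambda>j n. u (op_prod b a w j n) i)" by (simp add: triple_def op_prod_def)
    then show ?thesis
      unfolding D23_pow using dm_pow_map[where f = "\<lambda>x. u x i"] hli_simps(2)[OF hli(1)] by simp
  qed
  then show ?thesis
    using bdd3I[of N l k "triple u b a w" M e] N M hli_simps(3)[OF hli(1)] by auto
qed

lemma nice_triple:
  assumes hli: "hom_laurent_inf s u" "hom_laurent_inf s b" "hom_laurent_inf s a"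
    and ua: "passes k c u a" and ub: "passes l d u b" and ba: "\<And>w. merk e (op_prod b a w)"
  shows "nice k e ((D12 ^^ l) (triple u b a w))"
proof -
  have "(D13 ^^ k) ((D23 ^^ e) ((D12 ^^ l) (triple u b a w))) = (D12 ^^ l) ((D13 ^^ k) ((D23 ^^ e) (triple u b a w)))"
    by (simp add: funpow_swap[of D12 D23, OF D12_D23] funpow_swap[of D12 D13, OF D12_D13])
  moreover have "merk e ((D12 ^^ l) (triple u b a w) i)" for i
  proof -
    have 0: "triple u b a w i = (\<lambda>j n. u (op_prod b a w j n) i)" for i by (simp add: triple_def op_prod_def)
    have "merk e (triple u b a w i)" for i
      unfolding 0 by (rule merk_map[of "\<lambda>x. u x i"]) (simp_all add: hli_simps[OF hli(1)] ba)
    then show ?thesis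
    proof (induction l arbitrary: i)
      case (Suc l)
      let ?K = "(D12 ^^ l) (triple u b a w)"
      have "merk e (\<lambda>j n. ?K i (j - 1) n)" using merk_shift[of e "?K i" 1 0] Suc by simp
      then have "merk e (D12 ?K i)" unfolding D12_def[of ?K] using Suc by (intro merk_diff) auto
      then show ?case by simp
    qed simp
  qed
  moreover have "merk k (\<lambda>i n. (D12 ^^ l) (triple u b a w) i j n)" for j
  proof -
    obtain N where N: "\<And>i j n. i > N \<Longrightarrow> (D12 ^^ l) ((D13 ^^ k) (triple u b a w)) i j n = 0"
      using triple_y_bound[OF hli ua ub, of w] by blast
    have eq: "(dm ^^ k) (\<lambda>i n. (D12 ^^ l) (triple u b a w) i j n) i n = (D12 ^^ l) ((D13 ^^ k) (triple u b a w)) i j n" for i n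
      unfolding funpow_swap[of D12 D13, OF D12_D13] by (simp add: D13_pow)
    obtain M where M: "\<And>n. n > M \<Longrightarrow> a w n = 0" using hli_upper[OF hli(3)] by blast
    have z: "(D12 ^^ l) (triple u b a w) i j n = 0" if "n > M" for i j n
    proof -
      have "(\<lambda>i j. triple u b a w i j n) = (\<lambda>i j. 0)"
        using M[OF that] by (simp add: triple_def hli_simps[OF hli(1)] hli_simps[OF hli(2)])
      then show ?thesis by (simp add: D12_pow dm_pow_zero)
    qed
    have "(dm ^^ k) (\<lambda>i n. (D12 ^^ l) (triple u b a w) i j n) i n = 0" if "n > M + int k" for i n
      by (rule dm_pow_vanish2[OF _ that]) (rule z)
    then show ?thesis unfolding merk_def
      by (intro laurent_inf2I[of N _ "M + int k"]) (simp_all add: eq N)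
  qed
  ultimately show ?thesis unfolding nice_def using triple_bdd3[OF assms] by simp
qed


section \<open>Dividing by \<open>x\<^sub>1 - x\<^sub>2 + b\<close> near the origin\<close>

text \<open>Bounded below in the first exponent and, row by row, in the second: then each
  coefficient of the product with \<open>ratio_zero\<close> is a finite sum. The bound in
  \<open>quad\<close> is common to both exponents, hence symmetric in the variables.\<close>

definition lowP :: "'w series2 \<Rightarrow> bool" where
  "lowP A \<longleftrightarrow> (\<exists>p. \<forall>P<p. \<forall>R. A P R = 0) \<and> (\<forall>P. \<exists>r. \<forall>R<r. A P R = 0)"

definition quad :: "'w series2 \<Rightarrow> bool" where
  "quad A \<longleftrightarrow> (\<exists>p. \<forall>P R. P < p \<or> R < p \<longrightarrow> A P R = 0)"

lemma quad_lowP: "quad A \<Longrightarrow> lowP A" "quad A \<Longrightarrow> lowP (\<lambda>R P. A P R)"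
  unfolding quad_def lowP_def by blast+

lemma lowP_diff: "lowP A \<Longrightarrow> lowP B \<Longrightarrow> lowP (\<lambda>P R. A P R - B P R)"
proof -
  assume *: "lowP A" "lowP B"
  obtain p p' where p: "\<forall>P<p. \<forall>R. A P R = 0" "\<forall>P<p'. \<forall>R. B P R = 0" using * unfolding lowP_def by blast
  have "\<exists>r. \<forall>R<r. A P R - B P R = 0" for P
  proof -
    obtain r r' where "\<forall>R<r. A P R = 0" "\<forall>R<r'. B P R = 0" using * unfolding lowP_def by blast
    then show ?thesis by (intro exI[of _ "min r r'"]) simp
  qed
  moreover have "\<exists>p. \<forall>P<p. \<forall>R. A P R - B P R = 0" using p by (intro exI[of _ "min p p'"]) simp
  ultimately show ?thesis unfolding lowP_def by blast
qed

text \<open>As \<open>b\<close> is nonzero, each coefficient is determined by its neighbours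
  \<open>A (P - 1) R\<close> and \<open>A P (R - 1)\<close>; a double induction starts from the
  lower edges.\<close>

lemma lin_cancel:
  assumes b: "b \<noteq> 0" and low: "lowP A"
    and rec: "\<And>P R. A (P - 1) R - A P (R - 1) + s b (A P R) = 0"
  shows "A P R = 0"
proof -
  obtain p where p: "\<And>P R. P < p \<Longrightarrow> A P R = 0" using low unfolding lowP_def by blast
  have "\<forall>R. A (p + int i - 1) R = 0" for i
  proof (induction i)
    case (Suc i)
    let ?P = "p + int (Suc i) - 1"
    have z: "A (?P - 1) R = 0" for R using Suc by (simp add: algebra_simps)
    obtain r where r: "\<And>R. R < r \<Longrightarrow> A ?P R = 0" using low unfolding lowP_def by blast
    have J: "A ?P (r + int j - 1) = 0" for j
    proof (induction j)
      case (Suc j)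
      have "s b (A ?P (r + int (Suc j) - 1)) = 0"
        using rec[of ?P "r + int (Suc j) - 1"] z[of "r + int (Suc j) - 1"] Suc by (simp add: algebra_simps)
      then show ?case using b by simp
    qed (use r in simp)
    have "A ?P R = 0" if "R \<ge> r" for R
      using J[of "nat (R - r + 1)"] that by simp
    with r show ?case by (metis linorder_not_less)
  qed (use p in simp)
  from this[of "nat (P - p + 1)"] p show ?thesis by (cases "P < p") auto
qed

lemma ratio_zero_mult:
  fixes a :: complex
  assumes "b \<noteq> 0" "lowP A"
  defines "B \<equiv> ser_mult s (ratio_zero a b) A"
  shows "B (P - 1) R - B P (R - 1) + s b (B P R) = A (P - 1) R - A P (R - 1) + s a (A P R)"
    "lowP B" "quad A \<Longrightarrow> quad B" "finite {(i, j). s (ratio_zero a b i j) (A (P - i) (R - j)) \<noteq> 0}"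
proof -
  obtain p where p: "\<And>P R. P < p \<Longrightarrow> A P R = 0" using assms(2) unfolding lowP_def by blast
  obtain r where r: "\<And>P R. R < r P \<Longrightarrow> A P R = 0" using assms(2) unfolding lowP_def by metis
  have fin: "finite {(i, j). i \<ge> 0 \<and> j \<ge> 0 \<and> A (P - i) (R - j) \<noteq> 0}" for P R
  proof (rule finite_subset)
    show "{(i, j). i \<ge> 0 \<and> j \<ge> 0 \<and> A (P - i) (R - j) \<noteq> 0} \<subseteq> (SIGMA i:{0..P - p}. {0..R - r (P - i)})"
      using p r by (auto simp: not_less[symmetric])
  qed auto
  show "B (P - 1) R - B P (R - 1) + s b (B P R) = A (P - 1) R - A P (R - 1) + s a (A P R)"
    unfolding B_def
  proof (rule ser_mult_ratio[OF ratio_zero_eq[OF assms(1)] inv_lin_zero_rec[OF assms(1)]])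
    show "finite {(i, j). inv_lin_zero b i j \<noteq> 0 \<and> A (m - i) (n - j) \<noteq> 0}" for m n
      by (rule finite_subset[OF _ fin[of m n]]) (auto dest: inv_lin_zero_supp)
  qed
  show "finite {(i, j). s (ratio_zero a b i j) (A (P - i) (R - j)) \<noteq> 0}"
    by (rule finite_subset[OF _ fin[of P R]]) (auto dest: ratio_zero_supp[OF assms(1)])
  have zero: "B P R = 0" if "\<And>i j. i \<ge> 0 \<Longrightarrow> j \<ge> 0 \<Longrightarrow> A (P - i) (R - j) = 0" for P R
  proof -
    have "B P R = Sum_any (\<lambda>x::int \<times> int. 0)"
      unfolding B_def ser_mult_def
    proof (intro arg_cong[of _ _ Sum_any] ext)
      fix x :: "int \<times> int"
      obtain i j where x: "x = (i, j)" by (cases x)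
      show "(case x of (i, j) \<Rightarrow> s (ratio_zero a b i j) (A (P - i) (R - j))) = 0"
        using ratio_zero_supp[OF assms(1), of a i j] that[of i j] by (cases "ratio_zero a b i j = 0") (auto simp: x)
    qed
    then show ?thesis by simp
  qed
  show "lowP B"
    unfolding lowP_def
  proof (intro conjI allI)
    show "\<exists>p. \<forall>P<p. \<forall>R. B P R = 0" using zero p by (intro exI[of _ p]) auto
    fix P
    define r0 where "r0 = (if P < p then 0 else Min ((\<lambda>i. r (P - i)) ` {0..P - p}))"
    have "B P R = 0" if "R < r0" for R
    proof (rule zero)
      fix i j :: int assume ij: "i \<ge> 0" "j \<ge> 0"
      show "A (P - i) (R - j) = 0"
      proof (cases "P - i < p")
        case False
        then have "i \<in> {0..P - p}" using ij by simp
        then have "r0 \<le> r (P - i)" using False ij unfolding r0_def by (auto intro!: Min_le)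
        then show ?thesis using that ij by (intro r) simp
      qed (rule p)
    qed
    then show "\<exists>r. \<forall>R<r. B P R = 0" by blast
  qed
  show "quad B" if q: "quad A"
  proof -
    obtain c where "\<And>P R. P < c \<or> R < c \<Longrightarrow> A P R = 0" using q unfolding quad_def by blast
    then show ?thesis unfolding quad_def by (intro exI[of _ c]) (auto intro!: zero)
  qed
qed

text \<open>Uniqueness of the quotient. In the second alternative \<open>h\<close> is bounded with
  the variables in the other order; exchanging them turns x1 - x2 + b into minus (x1 - x2 - b), so
  cancellation applies with \<open>- b\<close>.\<close>

lemma ratio_zero_solve:
  assumes b: "b \<noteq> 0" and A: "lowP A"
    and rec: "\<And>P R. h (P - 1) R - h P (R - 1) + s b (h P R) = A (P - 1) R - A P (R - 1) + s a (A P R)"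
    and h: "quad h \<or> quad A \<and> lowP (\<lambda>R P. h P R)"
  shows "h P R = ser_mult s (ratio_zero a b) A P R"
proof -
  define B where "B = ser_mult s (ratio_zero a b) A"
  note B = ratio_zero_mult[OF b A, of a, folded B_def]
  have r: "(h (P - 1) R - B (P - 1) R) - (h P (R - 1) - B P (R - 1)) + s b (h P R - B P R) = 0" for P R
  proof -
    have "(h (P - 1) R - B (P - 1) R) - (h P (R - 1) - B P (R - 1)) + s b (h P R - B P R) =
        (h (P - 1) R - h P (R - 1) + s b (h P R)) - (B (P - 1) R - B P (R - 1) + s b (B P R))"
      by (simp add: scale_right_diff_distrib)
    then show ?thesis unfolding rec B(1) by simp
  qed
  from h have "h P R - B P R = 0"
  proof
    assume "quad h"
    then have "lowP (\<lambda>P R. h P R - B P R)" by (intro lowP_diff quad_lowP B)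
    from lin_cancel[OF b this] r show ?thesis by blast
  next
    assume *: "quad A \<and> lowP (\<lambda>R P. h P R)"
    then have "lowP (\<lambda>R P. h P R - B P R)" using lowP_diff[OF _ quad_lowP(2)[OF B(3)]] by blast
    moreover have "(h P (R - 1) - B P (R - 1)) - (h (P - 1) R - B (P - 1) R) + s (- b) (h P R - B P R) = 0" for P R
      using r[of P R] by (simp add: algebra_simps)
    ultimately show ?thesis using lin_cancel[of "- b" "\<lambda>R P. h P R - B P R" R P] b by simp
  qed
  then show ?thesis by (simp add: B_def)
qed

end

section \<open>The relations on \<open>W\<close>\<close>

locale dy_inf = cvec s for s :: "complex \<Rightarrow> 'w::ab_group_add \<Rightarrow> 'w" +
  fixes q :: complex and act :: "T \<Rightarrow> 'w \<Rightarrow> 'w"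
  assumes q_nonzero: "q \<noteq> 0" and DY: "DY_inf_module q s act"
begin

abbreviation cur :: "sl2_gen \<Rightarrow> 'w \<Rightarrow> 'w series" where
  "cur \<equiv> current act"

lemma hli_cur: "hom_laurent_inf s (cur u)"
  unfolding hom_laurent_inf_def
proof (intro conjI allI)
  fix n
  show "Vector_Spaces.linear s s (\<lambda>w. cur u w n)"
    using DY by (simp add: DY_inf_module_def T_module_def current_def)
next
  fix w
  obtain N where "\<forall>n<N. \<forall>u. act (gen u n) w = 0" using DY unfolding DY_inf_module_def by blast
  then show "\<exists>N. \<forall>n>N. cur u w n = 0"
    by (intro exI[of _ "- N"]) (simp add: current_def)
qed

lemmas cur_simps = hli_simps[OF hli_cur]

definition ratio_pair :: "sl2_gen \<Rightarrow> sl2_gen \<Rightarrow> complex \<Rightarrow> complex \<Rightarrow> bool" where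
  "ratio_pair u t a b \<longleftrightarrow> (u, t, a, b) \<in> {(E, E, q, - q), (F, F, - q, q), (H, E, q, - q), (H, F, - q, q)}"

lemma rels:
  "ratio_pair u t a b \<Longrightarrow> op_prod (cur u) (cur t) w = ser_mult s (ratio_inf a b) (op_rev_prod (cur t) (cur u) w)"
  "cur H (cur H w n) m = cur H (cur H w m) n"
  "cur E (cur F w n) m - cur F (cur E w m) n = - cur H w (m + n + 1)"
proof -
  have R: "\<forall>(L, R) \<in> DY_rels ratio_inf (- 1) q s act. L = R"
    using DY by (simp add: DY_inf_module_def)
  show "ratio_pair u t a b \<Longrightarrow> op_prod (cur u) (cur t) w = ser_mult s (ratio_inf a b) (op_rev_prod (cur t) (cur u) w)"
    using R by (auto simp: DY_rels_def Let_def ratio_pair_def fun_eq_iff)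
  have "op_prod (cur H) (cur H) = op_rev_prod (cur H) (cur H)"
    using R by (simp add: DY_rels_def Let_def)
  then show "cur H (cur H w n) m = cur H (cur H w m) n"
    by (simp add: op_prod_def op_rev_prod_def fun_eq_iff)
  have "(\<lambda>w m n. op_prod (cur E) (cur F) w m n - op_rev_prod (cur F) (cur E) w m n) =
       (\<lambda>w. ser_mult s (delta_ser (- 1)) (\<lambda>m n. if m = 0 then cur H w n else 0))"
    using R by (simp add: DY_rels_def Let_def)
  then have "op_prod (cur E) (cur F) w m n - op_rev_prod (cur F) (cur E) w m n =
      ser_mult s (delta_ser (- 1)) (\<lambda>m n. if m = 0 then cur H w n else 0) m n"
    by (simp add: fun_eq_iff)
  then show "cur E (cur F w n) m - cur F (cur E w m) n = - cur H w (m + n + 1)"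
    by (simp add: op_prod_def op_rev_prod_def ser_mult_delta)
qed

lemma ratio_pair_nz: "ratio_pair u t a b \<Longrightarrow> b \<noteq> 0"
  using q_nonzero by (auto simp: ratio_pair_def)

lemma sum_cur: "cur t (\<Sum>i\<in>S. g i) n = (\<Sum>i\<in>S. cur t (g i) n)"
  by (induction S rule: infinite_finite_induct) (simp_all add: cur_simps)

text \<open>\<open>ratio_inf\<close> has only nonpositive powers of y, so rewriting u(y) t(x) B(y)
  through t(x) u(y) B(y) does not raise the degree in y.\<close>

lemma passes_ratio:
  assumes "ratio_pair u t a b"
  shows "passes 0 0 (cur u) (cur t)"
  unfolding passes_def
proof (intro allI impI)
  fix B :: "int \<Rightarrow> 'w" and N m l
  assume B: "finite {i. B i \<noteq> 0}" "\<forall>m>N. star (cur u) B m = 0" "m > N + int 0"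
  let ?I = "{i. B i \<noteq> 0}"
  have "\<forall>i. \<exists>M. \<forall>n>M. cur u (B i) n = 0" using hli_upper[OF hli_cur] by blast
  then obtain M where M: "\<And>i n. n > M i \<Longrightarrow> cur u (B i) n = 0" by metis
  \<comment> \<open>One box \<open>Q\<close> has to contain the supports for all \<open>i\<close> at
    once, so that the sum over \<open>i\<close> can be moved inside \<open>cur t\<close>.\<close>
  define K where "K = (\<Sum>i\<in>?I. \<bar>M i + i - m\<bar>)"
  have K: "m - i - M i \<ge> - K" if "i \<in> ?I" for i
  proof -
    have "\<bar>M i + i - m\<bar> \<le> K" unfolding K_def by (rule member_le_sum) (use that B(1) in auto)
    then show ?thesis by linarith
  qed
  define Q where "Q = {- K..0} \<times> {0..K}"
  have "cur u (cur t (B i) l) (m - i) = (\<Sum>(p, j)\<in>Q. s (ratio_inf a b p j) (cur t (cur u (B i) (m - i - p)) (l - j)))"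
    if "i \<in> ?I" for i
  proof -
    have "cur u (cur t (B i) l) (m - i) = op_prod (cur u) (cur t) (B i) (m - i) l" by (simp add: op_prod_def)
    also have "\<dots> = Sum_any (\<lambda>(p, j). s (ratio_inf a b p j) (cur t (cur u (B i) (m - i - p)) (l - j)))"
      unfolding rels(1)[OF assms] ser_mult_def op_rev_prod_def ..
    also have "\<dots> = (\<Sum>(p, j)\<in>Q. s (ratio_inf a b p j) (cur t (cur u (B i) (m - i - p)) (l - j)))"
    proof (rule Sum_any_superset)
      fix x assume x: "x \<notin> Q"
      obtain p j where pj: "x = (p, j)" by (cases x)
      have "ratio_inf a b p j = 0 \<or> cur u (B i) (m - i - p) = 0"
      proof (rule ccontr)
        assume c: "\<not> ?thesis"
        then have "p \<le> 0" "0 \<le> j" "j \<le> - p" using ratio_inf_supp by blast+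
        moreover have "m - i - p \<le> M i" using c M by (meson linorder_not_less)
        ultimately have "(p, j) \<in> Q" using K[OF that] by (simp add: Q_def)
        with x pj show False by simp
      qed
      then show "(case x of (p, j) \<Rightarrow> s (ratio_inf a b p j) (cur t (cur u (B i) (m - i - p)) (l - j))) = 0"
        by (auto simp: pj cur_simps)
    qed (simp add: Q_def)
    finally show ?thesis .
  qed
  then have "star (cur u) (\<lambda>i. cur t (B i) l) m =
      (\<Sum>i\<in>?I. \<Sum>(p, j)\<in>Q. s (ratio_inf a b p j) (cur t (cur u (B i) (m - i - p)) (l - j)))"
    by (subst star_sum[OF hli_cur B(1)]) (simp_all add: cur_simps)
  also have "\<dots> = (\<Sum>(p, j)\<in>Q. s (ratio_inf a b p j) (cur t (\<Sum>i\<in>?I. cur u (B i) (m - p - i)) (l - j)))"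
    by (subst sum.swap) (auto intro!: sum.cong simp: sum_cur scale_sum_right algebra_simps)
  also have "\<dots> = 0"
  proof (rule sum.neutral, rule ballI)
    fix x assume "x \<in> Q"
    then obtain p j where pj: "x = (p, j)" "p \<le> 0" by (auto simp: Q_def)
    have "(\<Sum>i\<in>?I. cur u (B i) (m - p - i)) = star (cur u) B (m - p)"
      by (subst star_sum[OF hli_cur B(1)]) simp_all
    also have "\<dots> = 0" using B(2,3) pj(2) by simp
    finally show "(case x of (p, j) \<Rightarrow> s (ratio_inf a b p j) (cur t (\<Sum>i\<in>?I. cur u (B i) (m - p - i)) (l - j))) = 0"
      by (simp add: pj(1) cur_simps)
  qed
  finally show "(dm ^^ 0) (\<lambda>m n. star (cur u) (\<lambda>i. cur t (B i) n) m) m l = 0" by simp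
qed

section \<open>Currents passing through currents: commuting pairs, the bracket, and \<open>h\<close>
  on the right\<close>

lemma finite_cur: "finite {i. B i \<noteq> 0} \<Longrightarrow> finite {i. cur u (B i) n \<noteq> 0}"
  by (rule finite_image_supp[OF hli_cur])

lemma star_swap:
  assumes "finite {i. B i \<noteq> 0}" "\<And>w m. cur u (cur t w l) m = cur t (cur u w m) l"
  shows "star (cur u) (\<lambda>i. cur t (B i) l) m = cur t (star (cur u) B m) l"
  using star_sum[OF hli_cur assms(1), of B u m]
    star_sum[OF hli_cur assms(1), of "\<lambda>i. cur t (B i) l" u m]
  by (simp add: cur_simps sum_cur assms(2))

lemma passes_HH: "passes 0 0 (cur H) (cur H)"
  unfolding passes_def by (auto simp: star_swap rels(2) cur_simps)

lemma star_dm1: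
  "finite {i. B i \<noteq> 0} \<Longrightarrow> dm (\<lambda>m l. star (cur u) (\<lambda>i. cur t (B i) l) m) m l =
    (\<Sum>i\<in>{i. B i \<noteq> 0}. dm (op_prod (cur u) (cur t) (B i)) (m - i) l)"
  using star_sum[OF hli_cur, of "{i. B i \<noteq> 0}" "\<lambda>i. cur t (B i) _" u]
  by (simp add: dm_def cur_simps op_prod_def sum_subtractf algebra_simps)

text \<open>The delta term depends on \<open>m + n\<close> only and is therefore killed by x1 -
  x2.\<close>

lemma EF_commute: "dm (op_prod (cur E) (cur F) w) m n = dm (\<lambda>m n. cur F (cur E w m) n) m n"
  and FE_commute: "dm (op_prod (cur F) (cur E) w) m n = dm (\<lambda>m n. cur E (cur F w m) n) m n"
proof -
  have EF: "cur E (cur F w n) m = cur F (cur E w m) n - cur H w (m + n + 1)" for m n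
    using rels(3)[of w n m] by (simp add: algebra_simps)
  show "dm (op_prod (cur E) (cur F) w) m n = dm (\<lambda>m n. cur F (cur E w m) n) m n"
    "dm (op_prod (cur F) (cur E) w) m n = dm (\<lambda>m n. cur E (cur F w m) n) m n"
    unfolding dm_def op_prod_def EF by (simp_all add: algebra_simps)
qed

lemma passes_EF: "passes 1 1 (cur E) (cur F)" "passes 1 1 (cur F) (cur E)"
proof -
  have *: "passes 1 1 (cur u) (cur t)"
    if c: "\<And>w m n. dm (op_prod (cur u) (cur t) w) m n = dm (\<lambda>m n. cur t (cur u w m) n) m n" for u t
    unfolding passes_def
  proof (intro allI impI)
    fix B :: "int \<Rightarrow> 'w" and N m l
    assume B: "finite {i. B i \<noteq> 0}" "\<forall>m>N. star (cur u) B m = 0" "m > N + int 1"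
    let ?I = "{i. B i \<noteq> 0}"
    have st: "star (cur u) B m = (\<Sum>i\<in>?I. cur u (B i) (m - i))" for m
      by (rule star_sum[OF hli_cur B(1)]) simp
    have "(\<Sum>i\<in>?I. dm (\<lambda>m n. cur t (cur u (B i) m) n) (m - i) l) =
        cur t (star (cur u) B (m - 1)) l - cur t (star (cur u) B m) (l - 1)"
      unfolding st by (simp add: dm_def sum_subtractf sum_cur algebra_simps)
    then show "(dm ^^ 1) (\<lambda>m n. star (cur u) (\<lambda>i. cur t (B i) n) m) m l = 0"
      using B by (simp add: star_dm1 c cur_simps)
  qed
  show "passes 1 1 (cur E) (cur F)" by (rule *) (rule EF_commute)
  show "passes 1 1 (cur F) (cur E)" by (rule *) (rule FE_commute)
qed

text \<open>The relations give \<open>h(x\<^sub>1)e(x\<^sub>2)\<close> in terms of \<open>e(x\<^sub>2)h(x\<^sub>1)\<close>, but the coefficient is expanded in the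
  wrong region for moving \<open>e(x\<^sub>2)\<close> to the right. Here the modes of \<open>h\<close> are written as commutators
  of modes of \<open>e\<close> and \<open>f\<close>, through which \<open>e\<close> and \<open>f\<close> pass.\<close>

lemma passes_commutator:
  assumes "passes 0 0 (cur u) (cur a)" "passes 1 1 (cur u) (cur b)"
    and h: "\<And>w k. h w k = cur b (cur a w 0) (k - 1) - cur a (cur b w (k - 1)) 0"
  shows "passes 1 1 (cur u) h"
  unfolding passes_def
proof (intro allI impI)
  fix B :: "int \<Rightarrow> 'w" and N m k
  assume B: "finite {i. B i \<noteq> 0}" "\<forall>m>N. star (cur u) B m = 0" and m: "m > N + int 1"
  \<comment> \<open>In the first term the mode of \<open>a\<close> acts first (\<open>C\<close>), in
    the second that of \<open>b\<close> (\<open>A\<close>). Only \<open>b\<close> costs a factor y -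
    x, and as the exponent of \<open>a\<close> is fixed at 0, this factor acts on the exponent of
    \<open>b\<close> alone.\<close>
  define C where "C i = cur a (B i) 0" for i
  have C: "finite {i. C i \<noteq> 0}" unfolding C_def by (rule finite_cur[OF B(1)])
  have "star (cur u) C m = 0" if "m > N" for m
    using passesD[OF assms(1) B(1), of N m 0] B(2) that by (simp add: C_def[abs_def])
  then have 1: "(dm ^^ 1) (\<lambda>m l. star (cur u) (\<lambda>i. cur b (C i) l) m) m (k - 1) = 0"
    by (intro passesD[OF assms(2) C _ m]) auto
  define A where "A = (\<lambda>i l. cur b (B i) l)"
  have A: "finite {i. A i l \<noteq> 0}" for l unfolding A_def by (rule finite_cur[OF B(1)])
  have dA: "finite {i. dm A i l \<noteq> 0}" for l using finite_dm_pow[of A 1] A by simp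
  have "star (cur u) (\<lambda>i. dm A i (k - 1)) m = 0" if "m > N + 1" for m
    using passesD[OF assms(2) B(1), of N m "k - 1"] B(2) that star_dm_pow[OF hli_cur, of A 1 u] A
    by (simp add: A_def fun_eq_iff)
  then have "star (cur u) (\<lambda>i. cur a (dm A i (k - 1)) 0) m = 0"
    using passesD[OF assms(1) dA[of "k - 1"], of "N + 1" m 0] m by simp
  moreover have "(\<lambda>i. cur a (dm A i (k - 1)) 0) = (\<lambda>i. dm (\<lambda>i l. cur a (A i l) 0) i (k - 1))"
    by (simp add: dm_def cur_simps)
  moreover have Af: "finite {i. cur a (A i l) 0 \<noteq> 0}" for l by (rule finite_cur[OF A])
  ultimately have 2: "dm (\<lambda>m l. star (cur u) (\<lambda>i. cur a (A i l) 0) m) m (k - 1) = 0"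
    using star_dm_pow[OF hli_cur, of "\<lambda>i l. cur a (A i l) 0" 1 u] by (simp add: fun_eq_iff)
  have Cf: "finite {i. cur b (C i) l \<noteq> 0}" for l by (rule finite_cur[OF C])
  have hs: "star (cur u) (\<lambda>i. h (B i) k) m = star (cur u) (\<lambda>i. cur b (C i) (k - 1)) m - star (cur u) (\<lambda>i. cur a (A i (k - 1)) 0) m" for m k
    unfolding h using star_diff[OF hli_cur Cf Af] by (simp add: C_def A_def)
  from 1 2 show "(dm ^^ 1) (\<lambda>m n. star (cur u) (\<lambda>i. h (B i) n) m) m k = 0"
    by (simp add: dm_def hs)
qed

lemma passes_uminus:
  assumes "hom_laurent_inf s u" "hom_laurent_inf s a" "passes k c u (\<lambda>w n. - a w n)"
  shows "passes k c u a"
  unfolding passes_def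
proof (intro allI impI)
  fix B :: "int \<Rightarrow> 'w" and N m n
  assume B: "finite {i. B i \<noteq> 0}" "\<forall>m>N. star u B m = 0" and m: "m > N + int c"
  have "star u (\<lambda>i. a (B i) n) m = - star u (\<lambda>i. - a (B i) n) m" for m n
    using star_sum[OF assms(1) B(1), of "\<lambda>i. a (B i) n" m] star_sum[OF assms(1) B(1), of "\<lambda>i. - a (B i) n" m]
    by (simp add: hli_simps[OF assms(1)] hli_simps[OF assms(2)] sum_negf)
  then show "(dm ^^ k) (\<lambda>m n. star u (\<lambda>i. a (B i) n) m) m n = 0"
    using passesD[OF assms(3) B(1) _ m] B(2) dm_pow_map[of uminus k "\<lambda>m n. star u (\<lambda>i. - a (B i) n) m"] by simp
qed

lemma passes_EH: "passes 1 1 (cur E) (cur H)"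
proof (rule passes_commutator)
  show "passes 0 0 (cur E) (cur E)" by (rule passes_ratio[of E E q "- q"]) (simp add: ratio_pair_def)
  show "cur H w k = cur F (cur E w 0) (k - 1) - cur E (cur F w (k - 1)) 0" for w k
    using rels(3)[of w "k - 1" 0] by (simp add: algebra_simps)
qed (rule passes_EF)

lemma passes_FH: "passes 1 1 (cur F) (cur H)"
proof (rule passes_uminus[OF hli_cur hli_cur passes_commutator])
  show "passes 0 0 (cur F) (cur F)" by (rule passes_ratio[of F F "- q" q]) (simp add: ratio_pair_def)
  show "- cur H w k = cur E (cur F w 0) (k - 1) - cur F (cur E w (k - 1)) 0" for w k
    using rels(3)[of w 0 "k - 1"] by (simp add: algebra_simps)
qed (rule passes_EF)

text \<open>The uniform bounds 1 and 1 are what \<open>passes_fprod\<close> demands of the inner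
  current.\<close>

lemma passes_cur: "passes 1 1 (cur u) (cur t)"
proof -
  have 1: "passes 1 1 (cur u) (cur t)" if "ratio_pair u t a b" for a b
    using passes_Suc[OF passes_ratio[OF that]] by simp
  have 2: "passes 1 1 (cur H) (cur H)" using passes_Suc[OF passes_HH] by simp
  show ?thesis
    by (cases u; cases t) (use 1[of q "- q"] 1[of "- q" q] 2 passes_EF passes_EH passes_FH in \<open>simp_all add: ratio_pair_def\<close>)
qed


section \<open>The fields generated by the currents\<close>

text \<open>Only currents standing to the left of \<open>a\<close> are controlled, which suffices
  because words act by multiplying with currents from the left.\<close>

definition tame :: "('w \<Rightarrow> 'w series) \<Rightarrow> bool" where
  "tame a \<longleftrightarrow> hom_laurent_inf s a \<and> (\<forall>u. \<exists>k c. passes k c (cur u) a)"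

definition fp :: "int \<Rightarrow> sl2_gen \<Rightarrow> ('w \<Rightarrow> 'w series) \<Rightarrow> 'w \<Rightarrow> 'w series" where
  "fp R u a = fprod R (cur u) a"

lemma tame_hli: "tame a \<Longrightarrow> hom_laurent_inf s a"
  by (simp add: tame_def)

lemma tame_compat: "tame a \<Longrightarrow> compat (cur u) a"
  unfolding tame_def using passes_compat[OF _ hli_cur] by blast

lemma tame_vac: "tame vac"
  unfolding tame_def using hli_vac passes_vac[OF hli_cur] by blast

lemma tame_fp: "tame a \<Longrightarrow> tame (fp R u a)"
  unfolding tame_def fp_def using hli_fprod[OF hli_cur _ tame_compat] passes_fprod[OF hli_cur hli_cur _ passes_cur _ tame_compat]
  by (meson tame_def)

lemma tame_combine: "tame a \<Longrightarrow> tame b \<Longrightarrow> tame (\<lambda>w n. s \<alpha> (a w n) - s \<beta> (b w n))"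
proof -
  assume a: "tame a" and b: "tame b"
  have "hom_laurent_inf s (\<lambda>w n. s \<alpha> (a w n) - s \<beta> (b w n))"
    unfolding hom_laurent_inf_def
  proof (intro conjI allI)
    fix n show "Vector_Spaces.linear s s (\<lambda>w. s \<alpha> (a w n) - s \<beta> (b w n))"
      by (rule linearI)
        (simp_all add: hli_simps[OF tame_hli[OF a]] hli_simps[OF tame_hli[OF b]] scale_right_distrib
          scale_right_diff_distrib mult.commute)
  next
    fix w
    obtain M N where "\<forall>n>M. a w n = 0" "\<forall>n>N. b w n = 0"
      using hli_upper[OF tame_hli[OF a]] hli_upper[OF tame_hli[OF b]] by blast
    then show "\<exists>N. \<forall>n>N. s \<alpha> (a w n) - s \<beta> (b w n) = 0" by (intro exI[of _ "max M N"]) simp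
  qed
  moreover have "\<exists>k c. passes k c (cur u) (\<lambda>w n. s \<alpha> (a w n) - s \<beta> (b w n))" for u
    using passes_combine[OF hli_cur tame_hli[OF a] tame_hli[OF b]] a b unfolding tame_def by blast
  ultimately show ?thesis unfolding tame_def by blast
qed

lemma fp_combine:
  assumes "tame a" "tame b"
  shows "fp R u (\<lambda>w n. s \<alpha> (a w n) - s \<beta> (b w n)) w n = s \<alpha> (fp R u a w n) - s \<beta> (fp R u b w n)"
proof -
  have "op_prod (cur u) (\<lambda>w n. s \<alpha> (a w n) - s \<beta> (b w n)) w =
      (\<lambda>m n. s \<alpha> (op_prod (cur u) a w m n) - s \<beta> (op_prod (cur u) b w m n))"
    by (simp add: op_prod_def cur_simps)
  then show ?thesis
    unfolding fp_def fprod_def using compatD[OF tame_compat[OF assms(1)]] compatD[OF tame_compat[OF assms(2)]]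
    by (simp add: tay_diff tay_scale mer_map[OF linear_scale_s])
qed

lemma fp_zero: "fp R u (\<lambda>w n. 0) = (\<lambda>w n. 0)"
  unfolding fp_def by (rule fprod_zero[OF hli_cur])

lemma fp_low: "tame a \<Longrightarrow> \<exists>c. \<forall>R<c. fp R u a = (\<lambda>w n. 0)"
  unfolding fp_def by (rule fprod_low[OF tame_compat])

lemma good3_cur: "tame a \<Longrightarrow> good3 (triple (cur u) (cur t) a w)"
  by (rule good3_triple[OF passes_compat[OF passes_cur hli_cur hli_cur] tame_compat tame_compat[OF tame_fp[unfolded fp_def]] hli_cur])

lemma t1_cur: "tame a \<Longrightarrow> t1 (triple (cur u) (cur t) a w) P R N = fp P u (fp R t a) w N"
  unfolding fp_def by (rule t1_triple[OF passes_compat[OF passes_cur hli_cur hli_cur] tame_compat hli_cur])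

section \<open>The defining relations between modes acting on fields\<close>

lemma fp_lowP:
  assumes "tame a"
  shows "lowP (\<lambda>P R. fp R t (fp P u a) w N)"
proof -
  obtain c where c: "\<And>P. P < c \<Longrightarrow> fp P u a = (\<lambda>w n. 0)" using fp_low[OF assms, of u] by blast
  have "\<exists>r. \<forall>R<r. fp R t (fp P u a) w N = 0" for P
    using fp_low[OF tame_fp[OF assms], of t P u] by force
  moreover have "\<exists>p. \<forall>P<p. \<forall>R. fp R t (fp P u a) w N = 0" using c by (intro exI[of _ c]) (simp add: fp_zero)
  ultimately show ?thesis unfolding lowP_def by blast
qed

lemma nice_cur:
  assumes "passes l d (cur u) (cur t)" "tame a"
  obtains k e where "\<And>w. nice k e ((D12 ^^ l) (triple (cur u) (cur t) a w))"
proof -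
  obtain k c where k: "passes k c (cur u) a" using assms(2) unfolding tame_def by blast
  obtain e c' where e: "passes e c' (cur t) a" using assms(2) unfolding tame_def by blast
  have "nice k e ((D12 ^^ l) (triple (cur u) (cur t) a w))" for w
    by (rule nice_triple[OF hli_cur hli_cur tame_hli[OF assms(2)] k assms(1)
        passes_merk[OF e hli_cur tame_hli[OF assms(2)]]])
  with that show ?thesis by blast
qed

text \<open>Without a pole along y = x, the pole orders along y = z and x = z bound both exponents
  at once.\<close>

lemma quad_cur:
  assumes "passes 0 d (cur u) (cur t)" "tame a"
  shows "quad (\<lambda>P R. fp P u (fp R t a) w N)"
proof -
  obtain k e where n: "\<And>w. nice k e (triple (cur u) (cur t) a w)" using nice_cur[OF assms] by auto
  show ?thesis unfolding quad_def t1_cur[OF assms(2), symmetric]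
    by (rule exI[of _ "min (- int k) (- int e)"]) (use nice_low[OF n] in auto)
qed

text \<open>\<open>C\<close> is (y - x + b) u(y) t(x) applied to the third field at z. On
  \<open>W\<close> it equals the same with (y - x + a) t(x) u(y), and having no pole along y = x it
  may be expanded in either order; the two expansions are the two sides.\<close>

lemma ratio_rec:
  assumes r: "ratio_pair u t a b" and x: "tame x"
  shows "fp (P - 1) u (fp R t x) w N - fp P u (fp (R - 1) t x) w N + s b (fp P u (fp R t x) w N) =
    fp R t (fp (P - 1) u x) w N - fp (R - 1) t (fp P u x) w N + s a (fp R t (fp P u x) w N)"
proof -
  define S where "S = triple (cur u) (cur t) x w"
  define S' where "S' = triple (cur t) (cur u) x w"
  define C where "C = (\<lambda>i j n. s 1 (D12 S i j n) + s b (S i j n))"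
  have g: "good3 S" "good3 S'" unfolding S_def S'_def by (rule good3_cur[OF x])+
  obtain k e where "\<And>w. nice k e (triple (cur u) (cur t) x w)"
    using nice_cur[OF passes_ratio[OF r] x] by auto
  then have n: "nice k e S" by (simp add: S_def)
  have "C = (\<lambda>i j n. s 1 (D12 S i j n) - s (- b) (S i j n))" by (simp add: C_def)
  then have nC: "nice k e C" using nice_combine[OF nice_D12[OF n] n, of 1 "- b"] by simp
  \<comment> \<open>Exchanging the first two variables turns y - x into its negative, whence the
    factor -1.\<close>
  have swap: "(\<lambda>j i n. C i j n) = (\<lambda>i j n. s (- 1) (D12 S' i j n) + s a (S' i j n))"
  proof (intro ext)
    fix j i n
    define v where "v = x w n"
    obtain M where M: "\<And>m. m > M \<Longrightarrow> cur u v m = 0" using hli_upper[OF hli_cur] by blast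
    have fin: "finite {(p, j). inv_lin_inf b p j \<noteq> 0 \<and> op_rev_prod (cur t) (cur u) v (m - p) (l - j) \<noteq> 0}" for m l
    proof (rule finite_subset)
      show "{(p, j). inv_lin_inf b p j \<noteq> 0 \<and> op_rev_prod (cur t) (cur u) v (m - p) (l - j) \<noteq> 0}
          \<subseteq> {m - M..0} \<times> {0..M - m}"
      proof
        fix y assume y: "y \<in> {(p, j). inv_lin_inf b p j \<noteq> 0 \<and> op_rev_prod (cur t) (cur u) v (m - p) (l - j) \<noteq> 0}"
        then obtain p j' where pj: "y = (p, j')" "inv_lin_inf b p j' \<noteq> 0" "cur t (cur u v (m - p)) (l - j') \<noteq> 0"
          by (auto simp: op_rev_prod_def)
        from inv_lin_inf_supp[OF pj(2)] have "p < 0" "0 \<le> j'" "j' < - p" by auto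
        moreover have "m - p \<le> M" using pj(3) M cur_simps(3) by (metis linorder_not_less)
        ultimately show "y \<in> {m - M..0} \<times> {0..M - m}" using pj(1) by auto
      qed
    qed simp
    have "op_prod (cur u) (cur t) v (i - 1) j - op_prod (cur u) (cur t) v i (j - 1) + s b (op_prod (cur u) (cur t) v i j)
      = op_rev_prod (cur t) (cur u) v (i - 1) j - op_rev_prod (cur t) (cur u) v i (j - 1) + s a (op_rev_prod (cur t) (cur u) v i j)"
      unfolding rels(1)[OF r]
      by (rule ser_mult_ratio[OF ratio_inf_eq inv_lin_inf_rec fin])
    then show "C i j n = s (- 1) (D12 S' j i n) + s a (S' j i n)"
      by (simp add: C_def D12_def S_def S'_def triple_def v_def op_prod_def op_rev_prod_def)
  qed
  have "t1 C P R N = s 1 (t1 (D12 S) P R N) + s b (t1 S P R N)"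
    unfolding C_def by (rule t1_combine[OF good3_D(1)[OF g(1)] g(1)])
  moreover have "t1 C P R N = s (- 1) (t1 (D12 S') R P N) + s a (t1 S' R P N)"
    unfolding nice_fubini[OF nC] swap by (rule t1_combine[OF good3_D(1)[OF g(2)] g(2)])
  ultimately show ?thesis
    unfolding t1_D12[OF g(1)] t1_D12[OF g(2)] unfolding S_def S'_def t1_cur[OF x] by simp
qed

lemma ratio_rel:
  assumes r: "ratio_pair u t a b" and x: "tame x"
  shows "fp P u (fp R t x) w N = ser_mult s (ratio_zero a b) (\<lambda>P R. fp R t (fp P u x) w N) P R"
  by (rule ratio_zero_solve[where h = "\<lambda>P R. fp P u (fp R t x) w N",
        OF ratio_pair_nz[OF r] fp_lowP[OF x] ratio_rec[OF r x]])
    (use quad_cur[OF passes_ratio[OF r] x] in blast)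

text \<open>The relation is symmetric up to renaming the variables, so it also holds in the other order.\<close>

lemma ratio_rel_rev:
  assumes r: "ratio_pair u t a b" and x: "tame x"
  shows "fp P t (fp R u x) w N = ser_mult s (ratio_zero a b) (\<lambda>P R. fp R u (fp P t x) w N) P R"
proof (rule ratio_zero_solve[where h = "\<lambda>P R. fp P t (fp R u x) w N",
      OF ratio_pair_nz[OF r] fp_lowP[OF x]])
  \<comment> \<open>Because of this, inverting the ratio and exchanging the variables gives the same
    ratio back.\<close>
  have ab: "a = - b" using r by (auto simp: ratio_pair_def)
  show "fp (P - 1) t (fp R u x) w N - fp P t (fp (R - 1) u x) w N + s b (fp P t (fp R u x) w N) =
    fp R u (fp (P - 1) t x) w N - fp (R - 1) u (fp P t x) w N + s a (fp R u (fp P t x) w N)" for P R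
    using ratio_rec[OF r x, of R P w N] by (simp add: ab algebra_simps)
  show "quad (\<lambda>P R. fp P t (fp R u x) w N) \<or>
    quad (\<lambda>P R. fp R u (fp P t x) w N) \<and> lowP (\<lambda>R P. fp P t (fp R u x) w N)"
    using quad_cur[OF passes_ratio[OF r] x, of w N] fp_lowP[OF x, of t u w N] unfolding quad_def by blast
qed

lemma HH_rel: "tame x \<Longrightarrow> fp P H (fp R H x) w N = fp R H (fp P H x) w N"
proof -
  assume x: "tame x"
  obtain k e where "\<And>w. nice k e (triple (cur H) (cur H) x w)"
    using nice_cur[OF passes_HH x] by auto
  moreover have "(\<lambda>j i n. triple (cur H) (cur H) x w i j n) = triple (cur H) (cur H) x w"
    by (simp add: triple_def fun_eq_iff rels(2))
  ultimately show ?thesis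
    using nice_fubini[of k e "triple (cur H) (cur H) x w" P R N] t1_cur[OF x] by simp
qed

text \<open>A residue at x1 = x2, by telescoping. For small \<open>j\<close> the factor
  \<open>cur F\<close> vanishes; for large \<open>j\<close> only the commutator
  \<open>- cur H\<close> is left, and since it enters at the upper end its sign is reversed.\<close>

lemma fp_EF: "fp (- 1) E (cur F) = cur H"
proof (intro ext)
  fix w N
  have m: "merk 1 (op_prod (cur E) (cur F) w)"
    by (rule passes_merk[OF passes_EF(1) hli_cur hli_cur])
  define c where "c j = cur E (cur F w (N - 1 - j)) j" for j
  obtain M where M: "\<And>n. n > M \<Longrightarrow> cur F w n = 0" using hli_upper[OF hli_cur] by blast
  obtain L where L: "\<And>n. n > L \<Longrightarrow> cur E w n = 0" using hli_upper[OF hli_cur] by blast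
  have "fp (- 1) E (cur F) w N = Sum_any (\<lambda>j. s (ib j 0) (dm (op_prod (cur E) (cur F) w) j (N - j)))"
    by (simp add: fp_def fprod_def tay_eq[OF m] tay0_def)
  also have "\<dots> = Sum_any (\<lambda>j. c (j - 1) - c j)"
    by (intro arg_cong[of _ _ Sum_any] ext) (simp add: ib_def c_def dm_def op_prod_def algebra_simps)
  also have "\<dots> = 0 - (- cur H w N)"
  proof (rule Sum_any_telescope)
    show "c j = 0" if "j < N - 1 - M" for j using M[of "N - 1 - j"] that by (simp add: c_def cur_simps)
    show "c j = - cur H w N" if "j \<ge> L + 1" for j
      using rels(3)[of w "N - 1 - j" j] L[of j] that by (simp add: c_def cur_simps)
  qed
  finally show "fp (- 1) E (cur F) w N = cur H w N" by simp
qed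

lemma int_const: "(\<And>P. y (P - 1) = y P) \<Longrightarrow> y P = y (Q :: int)"
proof -
  assume y: "\<And>P. y (P - 1) = y P"
  have "y (P + int i) = y P" for P i
  proof (induction i)
    case (Suc i)
    then show ?case using y[of "P + int (Suc i)"] by simp
  qed simp
  from this[of P "nat (Q - P)"] this[of Q "nat (P - Q)"] show ?thesis by (cases "P \<le> Q") auto
qed

text \<open>Since (y - x) e(y) f(x) = (y - x) f(x) e(y), the commutator of modes depends on
  \<open>P + R\<close> only. It is the jump of the function \<open>y\<close> along a line of
  constant \<open>P + R\<close>; summing the differences restricts (y - x) e(y) f(x) to y = x, where
  \<open>fp_EF\<close> identifies it with \<open>h\<close>.\<close>

lemma EF_rel:
  assumes x: "tame x"
  shows "fp P E (fp R F x) w N - fp R F (fp P E x) w N = fp (P + R + 1) H x w N"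
proof -
  define S where "S = triple (cur E) (cur F) x w"
  define S' where "S' = triple (cur F) (cur E) x w"
  have g: "good3 S" "good3 S'" unfolding S_def S'_def by (rule good3_cur[OF x])+
  obtain k e where "\<And>w. nice k e ((D12 ^^ 1) (triple (cur E) (cur F) x w))"
    using nice_cur[OF passes_EF(1) x] by blast
  then have n: "nice k e (D12 S)" by (simp add: S_def)
  have swap: "(\<lambda>j i n. D12 S i j n) = (\<lambda>i j n. s (- 1) (D12 S' i j n) + s 0 (S' i j n))"
  proof (intro ext)
    fix j i n
    show "D12 S i j n = s (- 1) (D12 S' j i n) + s 0 (S' j i n)"
      using EF_commute[of "x w n" i j] by (simp add: D12_def S_def S'_def triple_def dm_def op_prod_def)
  qed
  define n0 where "n0 = P + R + 1"
  define y where "y Q = fp Q E (fp (n0 - 1 - Q) F x) w N" for Q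
  define y' where "y' Q = fp (n0 - 1 - Q) F (fp Q E x) w N" for Q
  have d: "t1 (D12 S) Q (n0 - Q) N = y (Q - 1) - y Q" for Q
    unfolding t1_D12[OF g(1)] unfolding S_def t1_cur[OF x] y_def by (simp add: algebra_simps)
  have d': "t1 (D12 S) Q (n0 - Q) N = y' (Q - 1) - y' Q" for Q
    unfolding nice_fubini[OF n] swap t1_combine[OF good3_D(1)[OF g(2)] g(2)] t1_D12[OF g(2)]
    unfolding S'_def t1_cur[OF x] y'_def by (simp add: algebra_simps)
  define \<kappa> where "\<kappa> = y P - y' P"
  have k: "y Q - y' Q = \<kappa>" for Q
    unfolding \<kappa>_def by (rule int_const[of "\<lambda>Q. y Q - y' Q"]) (use d d' in \<open>simp add: algebra_simps\<close>)
  obtain c where c: "\<And>R. R < c \<Longrightarrow> fp R F x = (\<lambda>w n. 0)" using fp_low[OF x, of F] by blast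
  obtain c' where c': "\<And>R. R < c' \<Longrightarrow> fp R E x = (\<lambda>w n. 0)" using fp_low[OF x, of E] by blast
  have "Sum_any (\<lambda>Q. y (Q - 1) - y Q) = \<kappa> - 0"
  proof (rule Sum_any_telescope)
    show "y Q = \<kappa>" if "Q < c'" for Q using k[of Q] c'[OF that] by (simp add: y'_def fp_zero)
    show "y Q = 0" if "Q \<ge> n0 - c" for Q using c[of "n0 - 1 - Q"] that by (simp add: y_def fp_zero)
  qed
  then have "\<kappa> = Sum_any (\<lambda>Q. t1 (D12 S) Q (n0 - Q) N)" by (simp add: d)
  also have "\<dots> = t2 (D12 S) 0 n0 N"
  proof (rule Sum_any_t1[OF good3_D(1)[OF g(1)]])
    show "laurent_inf2 (\<lambda>i j. D12 S i j n)" for n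
    proof -
      have "merk 1 (op_prod (cur E) (cur F) (x w n))"
        by (rule passes_merk[OF passes_EF(1) hli_cur hli_cur])
      moreover have "(\<lambda>i j. D12 S i j n) = dm (op_prod (cur E) (cur F) (x w n))"
        by (simp add: D12_def S_def triple_def dm_def op_prod_def)
      ultimately show ?thesis by (simp add: merk_def)
    qed
    show "bdd3 ((D13 ^^ k) ((D23 ^^ e) (D12 S)))" using n by (simp add: nice_def)
  qed
  also have "\<dots> = fp n0 H x w N"
    unfolding t2_D12[OF g(1)] unfolding S_def using fp_EF by (simp add: t2_triple fp_def)
  finally show ?thesis unfolding \<kappa>_def y_def y'_def n0_def by simp
qed

end

section \<open>The action of the tensor algebra on fields\<close>

definition wd :: "(sl2_gen \<times> int) list \<Rightarrow> T" where
  "wd ws = Poly_Mapping.single (Word ws) 1"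

lemma wd_Nil: "wd [] = 1"
  by (simp add: wd_def flip: zero_word_def)

lemma wd_append: "wd (v @ w) = wd v * wd w"
  by (simp add: wd_def mult_single plus_word_def)

lemma wd_Cons: "wd ((u, n) # w) = gen u n * wd w"
  using wd_append[of "[(u, n)]" w] by (simp add: wd_def gen_def)

lemma single_wd: "Poly_Mapping.single x c = T_scale c (wd (letters x))"
  by (simp add: wd_def T_scale_def mult_single)

lemma T_wd_induct [case_names scale add]:
  assumes "\<And>c ws. P (T_scale c (wd ws))" "\<And>a b. P a \<Longrightarrow> P b \<Longrightarrow> P (a + b)"
  shows "P (a :: T)"
  by (induction a rule: T_single_induct) (simp_all add: single_wd assms)

context dy_inf
begin

primrec Phw :: "(sl2_gen \<times> int) list \<Rightarrow> 'w \<Rightarrow> 'w series" where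
  "Phw [] = vac"
| "Phw (l # ws) = fp (- snd l - 1) (fst l) (Phw ws)"

definition Phi :: "T \<Rightarrow> 'w \<Rightarrow> 'w series" where
  "Phi a w n = (\<Sum>x\<in>Poly_Mapping.keys a. s (Poly_Mapping.lookup a x) (Phw (letters x) w n))"

lemma Phi_superset:
  "finite A \<Longrightarrow> Poly_Mapping.keys a \<subseteq> A \<Longrightarrow> Phi a w n = (\<Sum>x\<in>A. s (Poly_Mapping.lookup a x) (Phw (letters x) w n))"
  unfolding Phi_def by (rule sum.mono_neutral_left) (auto simp: in_keys_iff)

lemma Phi_add: "Phi (a + b) = (\<lambda>w n. Phi a w n + Phi b w n)"
proof (intro ext)
  fix w n
  let ?A = "Poly_Mapping.keys a \<union> Poly_Mapping.keys b"
  have "Poly_Mapping.keys (a + b) \<subseteq> ?A" by (rule Poly_Mapping.keys_add)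
  then show "Phi (a + b) w n = Phi a w n + Phi b w n"
    by (simp add: Phi_superset[of ?A] lookup_add scale_left_distrib sum.distrib)
qed

lemma Phi_single: "Phi (Poly_Mapping.single x c) = (\<lambda>w n. s c (Phw (letters x) w n))"
  by (intro ext) (simp add: Phi_superset[of "{x}"])

lemma Phi_wd: "Phi (wd ws) = Phw ws"
  by (simp add: wd_def Phi_single)

lemma Phi_zero: "Phi 0 = (\<lambda>w n. 0)"
  by (intro ext) (simp add: Phi_def)

lemma Phi_scale: "Phi (T_scale c a) = (\<lambda>w n. s c (Phi a w n))"
proof (induction a rule: T_single_induct)
  case (single x d)
  have "T_scale c (Poly_Mapping.single x d) = Poly_Mapping.single x (c * d)"
    by (simp add: T_scale_def mult_single)
  then show ?case by (simp add: Phi_single)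
qed (simp add: T_scale_simps Phi_add scale_right_distrib)

lemma Phi_uminus: "Phi (- a) = (\<lambda>w n. - Phi a w n)"
proof -
  have "- a = T_scale (- 1) a" by (simp add: T_scale_def single_uminus)
  then show ?thesis by (simp add: Phi_scale)
qed

lemma Phi_diff: "Phi (a - b) = (\<lambda>w n. Phi a w n - Phi b w n)"
  using Phi_add[of a "- b"] by (simp add: Phi_uminus)

lemma Phi_sum: "Phi (\<Sum>i\<in>S. g i) = (\<lambda>w n. \<Sum>i\<in>S. Phi (g i) w n)"
  by (induction S rule: infinite_finite_induct) (simp_all add: Phi_zero Phi_add)

lemma tame_Phw: "tame (Phw ws)"
  by (induction ws) (simp_all add: tame_vac tame_fp)

lemma tame_Phi: "tame (Phi a)"
proof (induction a rule: T_single_induct)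
  case (single x c)
  show ?case
    using tame_combine[OF tame_Phw[of "letters x"] tame_Phw[of "letters x"], of c 0] by (simp add: Phi_single)
next
  case (add a b)
  then show ?case using tame_combine[of "Phi a" "Phi b" 1 "- 1"] by (simp add: Phi_add)
qed

lemma Phi_gen: "Phi (gen u n * a) = fp (- n - 1) u (Phi a)"
proof (induction a rule: T_single_induct)
  case (single x c)
  have "gen u n * Poly_Mapping.single x c = Poly_Mapping.single (Word ((u, n) # letters x)) c"
    by (simp add: gen_def mult_single plus_word_def)
  then show ?case
    using fp_combine[OF tame_Phw[of "letters x"] tame_Phw[of "letters x"], of "- n - 1" u c 0]
    by (simp add: Phi_single fun_eq_iff)
next
  case (add a b)
  then show ?case
    using fp_combine[OF tame_Phi[of a] tame_Phi[of b], of "- n - 1" u 1 "- 1"]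
    by (simp add: distrib_left Phi_add fun_eq_iff)
qed

lemma Phi_mult_zero:
  assumes "Phi b = (\<lambda>w n. 0)"
  shows "Phi (a * b) = (\<lambda>w n. 0)"
proof (induction a rule: T_wd_induct)
  case (scale c ws)
  have "Phi (wd ws * b) = (\<lambda>w n. 0)"
  proof (induction ws)
    case (Cons l ws)
    then show ?case by (cases l) (simp add: wd_Cons Phi_gen fp_zero mult.assoc)
  qed (simp add: wd_Nil assms)
  then show ?case by (simp add: T_scale_mult_left Phi_scale)
qed (simp add: distrib_right Phi_add)

text \<open>The factor \<open>- n\<close> of \<open>T_der\<close> on a letter is the
  \<open>R + 1\<close> of \<open>fder_fprod\<close> at \<open>R = - n - 1\<close>; the vacuum field
  is constant.\<close>

lemma fder_Phi: "fder (Phi a) = Phi (T_der a)"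
proof (induction a rule: T_single_induct)
  case (single x c)
  have "fder (Phw ws) = Phi (der_word ws)" for ws
  proof (induction ws)
    case Nil
    have "fder vac w n = 0" for w n by (cases "n = - 1") (simp_all add: fder_def vac_def)
    then show ?case by (simp add: Phi_zero fun_eq_iff)
  next
    case (Cons l ws)
    obtain u k where l: "l = (u, k)" by (cases l)
    have "Phi (der_word (l # ws)) =
        (\<lambda>w n. s (- of_int k) (fp (- k) u (Phw ws) w n) + fp (- k - 1) u (fder (Phw ws)) w n)"
      by (simp add: l Phi_add Phi_scale T_scale_mult_left Phi_gen Cons Phi_wd flip: wd_def)
    moreover have "fder (Phw (l # ws)) = (\<lambda>w n. s (of_int (- k)) (fp (- k) u (Phw ws) w n) + fp (- k - 1) u (fder (Phw ws)) w n)"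
      using fder_fprod[OF hli_cur tame_compat[OF tame_Phw], of "- k - 1" u ws]
      by (simp add: l fp_def fun_eq_iff)
    ultimately show ?case by simp
  qed
  then have "Phi (T_der (Poly_Mapping.single x c)) = (\<lambda>w n. s c (fder (Phw (letters x)) w n))"
    by (simp add: T_der_single Phi_scale)
  then show ?case
    by (simp add: Phi_single fun_eq_iff fder_def scale_left_commute)
next
  case (add a b)
  then show ?case by (simp add: T_der_add Phi_add fder_def fun_eq_iff scale_right_distrib)
qed

section \<open>Exchanging letters, and words of positive degree\<close>

text \<open>The finite set \<open>S\<close> must not depend on \<open>w\<close> and
  \<open>N\<close>, so that the relation can be stated for elements of \<open>T\<close>; its bounds
  come from products that vanish as fields.\<close>

lemma exchange_ratio:
  assumes b: "b \<noteq> 0" and x: "tame x"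
    and rel: "\<And>w N. fp P u (fp R t x) w N = ser_mult s (ratio_zero a b) (\<lambda>P R. fp R t (fp P u x) w N) P R"
  shows "\<exists>S. finite S \<and> (\<forall>p\<in>S. 0 \<le> fst p \<and> 0 \<le> snd p) \<and>
    (\<forall>w N. fp P u (fp R t x) w N = (\<Sum>(i, j)\<in>S. s (ratio_zero a b i j) (fp (R - j) t (fp (P - i) u x) w N)))"
proof -
  obtain c where c: "\<And>Q. Q < c \<Longrightarrow> fp Q u x = (\<lambda>w n. 0)" using fp_low[OF x, of u] by blast
  have "\<exists>r. \<forall>R<r. fp R t (fp Q u x) = (\<lambda>w n. 0)" for Q using fp_low[OF tame_fp[OF x]] by blast
  then obtain r where r: "\<And>Q R. R < r Q \<Longrightarrow> fp R t (fp Q u x) = (\<lambda>w n. 0)" by metis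
  define S where "S = (SIGMA i:{0..P - c}. {0..R - r (P - i)})"
  have "fp P u (fp R t x) w N = (\<Sum>(i, j)\<in>S. s (ratio_zero a b i j) (fp (R - j) t (fp (P - i) u x) w N))" for w N
    unfolding rel ser_mult_def
  proof (rule Sum_any_superset)
    fix y assume y: "y \<notin> S"
    obtain i j where ij: "y = (i, j)" by (cases y)
    consider "i < 0 \<or> j < 0" | "P - i < c" | "R - j < r (P - i)"
      using y unfolding S_def ij by fastforce
    then have "ratio_zero a b i j = 0 \<or> fp (R - j) t (fp (P - i) u x) w N = 0"
    proof cases
      case 1
      then show ?thesis using ratio_zero_supp[OF b, of a i j] by linarith
    qed (simp_all add: c r fp_zero)
    then show "(case y of (i, j) \<Rightarrow> s (ratio_zero a b i j) (fp (R - j) t (fp (P - i) u x) w N)) = 0"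
      by (auto simp: ij)
  qed (simp add: S_def)
  then show ?thesis by (intro exI[of _ S]) (auto simp: S_def)
qed

text \<open>One form for all nine ordered pairs of generators: the shifts are nonnegative, so no
  letter loses degree, and the \<open>H\<close> term keeps the total degree. Stated on
  \<open>T\<close>, it can be multiplied by any word on the left
  (\<open>Phi_mult_zero\<close>).\<close>

lemma exchange:
  "\<exists>S c d. finite S \<and> (\<forall>p\<in>S. 0 \<le> fst p \<and> 0 \<le> snd p) \<and>
    Phi (gen u n * (gen t m * b) -
      ((\<Sum>(i, j)\<in>S. T_scale (c i j) (gen t (m + j) * (gen u (n + i) * b))) + T_scale d (gen H (m + n) * b))) = (\<lambda>w n. 0)"
proof -
  let ?x = "Phi b"
  let ?P = "- n - 1" and ?R = "- m - 1"
  have x: "tame ?x" by (rule tame_Phi)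
  have 1: "?thesis" if S: "finite S" "\<forall>p\<in>S. 0 \<le> fst p \<and> 0 \<le> snd p"
    and eq': "\<And>w N. fp ?P u (fp ?R t ?x) w N = (\<Sum>(i, j)\<in>S. s (c i j) (fp (?R - j) t (fp (?P - i) u ?x) w N)) + s d (fp (?P + ?R + 1) H ?x w N)"
    for S c d
  proof (intro exI conjI)
    have "?P + ?R + 1 = ?R - n" by simp
    note eq = eq'[unfolded this]
    have e: "- (m + j) - 1 = ?R - j" "- (n + i) - 1 = ?P - i" for i j by simp_all
    have pe: "Phi (T_scale (c i j) (gen t (m + j) * (gen u (n + i) * b))) w N =
        s (c i j) (fp (?R - j) t (fp (?P - i) u ?x) w N)" for i j w N
      unfolding Phi_scale Phi_gen e ..
    show "Phi (gen u n * (gen t m * b) -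
      ((\<Sum>(i, j)\<in>S. T_scale (c i j) (gen t (m + j) * (gen u (n + i) * b))) + T_scale d (gen H (m + n) * b))) = (\<lambda>w n. 0)"
      unfolding Phi_diff Phi_add Phi_sum Phi_scale Phi_gen e eq
      by (simp only: case_prod_unfold pe diff_self)
  qed (use S in auto)
  have 2: "?thesis" if "\<And>w N. fp ?P u (fp ?R t ?x) w N = fp ?R t (fp ?P u ?x) w N + s d (fp (?P + ?R + 1) H ?x w N)" for d
    by (rule 1[of "{(0, 0)}" "\<lambda>_ _. 1" d]) (simp_all add: that)
  have 3: ?thesis if bb: "bb \<noteq> 0" and rel: "\<And>w N. fp ?P u (fp ?R t ?x) w N = ser_mult s (ratio_zero aa bb) (\<lambda>P R. fp R t (fp P u ?x) w N) ?P ?R" for aa bb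
  proof -
    obtain S where S: "finite S" "\<forall>p\<in>S. 0 \<le> fst p \<and> 0 \<le> snd p"
      and eq: "\<And>w N. fp ?P u (fp ?R t ?x) w N =
        (\<Sum>(i, j)\<in>S. s (ratio_zero aa bb i j) (fp (?R - j) t (fp (?P - i) u ?x) w N))"
      using exchange_ratio[OF bb x rel] by blast
    show ?thesis by (rule 1[OF S, of "ratio_zero aa bb" 0]) (simp only: eq scale_zero_left add_0_right)
  qed
  have 4: ?thesis if "ratio_pair u t aa bb \<or> ratio_pair t u aa bb" for aa bb
    using that
  proof
    assume r: "ratio_pair u t aa bb"
    show ?thesis by (rule 3[OF ratio_pair_nz[OF r] ratio_rel[OF r x]])
  next
    assume r: "ratio_pair t u aa bb"
    show ?thesis by (rule 3[OF ratio_pair_nz[OF r] ratio_rel_rev[OF r x]])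
  qed
  have EF: "fp ?P E (fp ?R F ?x) w N = fp ?R F (fp ?P E ?x) w N + s 1 (fp (?P + ?R + 1) H ?x w N)" for w N
    using EF_rel[OF x, of ?P ?R w N] by (simp add: algebra_simps)
  have FE: "fp ?P F (fp ?R E ?x) w N = fp ?R E (fp ?P F ?x) w N + s (- 1) (fp (?P + ?R + 1) H ?x w N)" for w N
    using EF_rel[OF x, of ?R ?P w N] by (simp add: algebra_simps)
  have HH: "fp ?P H (fp ?R H ?x) w N = fp ?R H (fp ?P H ?x) w N + s 0 (fp (?P + ?R + 1) H ?x w N)" for w N
    using HH_rel[OF x, of ?P ?R w N] by simp
  consider "u = E" "t = F" | "u = F" "t = E" | "u = H" "t = H"
    | "ratio_pair u t q (- q) \<or> ratio_pair t u q (- q)" | "ratio_pair u t (- q) q \<or> ratio_pair t u (- q) q"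
    by (cases u; cases t) (auto simp: ratio_pair_def)
  then show ?thesis
  proof cases
    case 1
    show ?thesis by (rule 2[of 1]) (simp only: 1 EF)
  next
    case fe: 2
    show ?thesis by (rule 2[of "- 1"]) (simp only: fe FE)
  next
    case 3
    show ?thesis by (rule 2[of 0]) (simp only: 3 HH)
  qed (rule 4, assumption)+
qed

text \<open>The product of a current with the vacuum field has no pole, as \<open>passes_vac\<close>
  costs no factor.\<close>

lemma fp_vac_low: "R < 0 \<Longrightarrow> fp R u vac = (\<lambda>w n. 0)"
proof -
  assume "R < 0"
  moreover have "merk 0 (op_prod (cur u) vac w)" for w
    by (rule passes_merk[OF passes_vac[OF hli_cur] hli_cur hli_vac])
  ultimately show ?thesis by (intro ext) (simp add: fp_def fprod_def tay_low[of 0])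
qed

text \<open>A letter of nonnegative degree is moved to the right until it meets the vacuum; no exchange
  lowers the total degree, and the bracket \<open>[e, f]\<close> shortens the word.\<close>

lemma Phi_positive_word: "(\<Sum>(u, k)\<leftarrow>ws. k) \<ge> 1 \<Longrightarrow> Phi (wd ws) = (\<lambda>w n. 0)"
proof (induction "length ws" arbitrary: ws rule: less_induct)
  case less
  define deg where "deg = (\<lambda>ws :: (sl2_gen \<times> int) list. \<Sum>(u, k)\<leftarrow>ws. k)"
  have deg: "deg (v @ w) = deg v + deg w" "deg ((u, k) # w) = k + deg w" "deg [] = 0" for v w u k
    by (simp_all add: deg_def)
  have IH: "Phi (wd v) = (\<lambda>w n. 0)" if "length v < length ws" "deg v \<ge> 1" for v
    using less that by (simp add: deg_def)
  \<comment> \<open>Inner induction on the letters to the right of the moved one, for all prefixes,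
    since exchanged letters join the prefix. The \<open>H\<close> term is shorter and falls under
    the outer induction on the length.\<close>
  have move: "Phi (wd (pre @ (u, n) # post)) = (\<lambda>w n. 0)"
    if "n \<ge> 0" "length (pre @ (u, n) # post) = length ws" "deg (pre @ (u, n) # post) \<ge> 1" for pre u n post
    using that
  proof (induction post arbitrary: pre u n)
    case Nil
    have "Phi (wd [(u, n)]) = (\<lambda>w n. 0)" using Nil by (simp add: Phi_wd fp_vac_low)
    then show ?case unfolding wd_append by (rule Phi_mult_zero)
  next
    case (Cons l post)
    obtain t m where l: "l = (t, m)" by (cases l)
    obtain S c d where S: "finite S" "\<And>i j. (i, j) \<in> S \<Longrightarrow> 0 \<le> i \<and> 0 \<le> j"
      and Z: "Phi (gen u n * (gen t m * wd post) -
        ((\<Sum>(i, j)\<in>S. T_scale (c i j) (gen t (m + j) * (gen u (n + i) * wd post))) + T_scale d (gen H (m + n) * wd post))) = (\<lambda>w n. 0)"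
      using exchange[of u n t m "wd post"] by force
    have 1: "Phi (wd pre * (gen t (m + j) * (gen u (n + i) * wd post))) = (\<lambda>w n. 0)" if "(i, j) \<in> S" for i j
    proof -
      have "Phi (wd ((pre @ [(t, m + j)]) @ (u, n + i) # post)) = (\<lambda>w n. 0)"
        by (rule Cons.IH) (use S(2)[OF that] Cons.prems in \<open>simp_all add: l deg\<close>)
      then show ?thesis by (simp add: wd_append wd_Cons mult.assoc)
    qed
    have 2: "Phi (wd pre * (gen H (m + n) * wd post)) = (\<lambda>w n. 0)"
    proof -
      have "Phi (wd (pre @ (H, m + n) # post)) = (\<lambda>w n. 0)"
        by (rule IH) (use Cons.prems in \<open>simp_all add: l deg\<close>)
      then show ?thesis by (simp add: wd_append wd_Cons)
    qed
    have 3: "Phi (\<Sum>p\<in>S. wd pre * (case p of (i, j) \<Rightarrow> T_scale (c i j) (gen t (m + j) * (gen u (n + i) * wd post)))) = (\<lambda>w n. 0)"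
      unfolding Phi_sum
    proof (intro ext sum.neutral ballI)
      fix w N p assume "p \<in> S"
      then show "Phi (wd pre * (case p of (i, j) \<Rightarrow> T_scale (c i j) (gen t (m + j) * (gen u (n + i) * wd post)))) w N = 0"
        by (cases p) (simp add: T_scale_mult_right Phi_scale 1)
    qed
    have "Phi (wd pre * (gen u n * (gen t m * wd post))) = (\<lambda>w n. 0)"
      using Phi_mult_zero[OF Z, of "wd pre"] 2 3
      by (simp add: right_diff_distrib distrib_left Phi_diff Phi_add T_scale_mult_right Phi_scale sum_distrib_left fun_eq_iff)
    then show ?case by (simp add: l wd_append wd_Cons)
  qed
  have "\<exists>x\<in>set ws. snd x \<ge> 0"
  proof (rule ccontr)
    assume "\<not> ?thesis"
    then have "deg ws \<le> 0" by (induction ws) (auto simp: deg_def)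
    with less.prems show False by (simp add: deg_def)
  qed
  then obtain u n pre post where "ws = pre @ (u, n) # post" "n \<ge> 0"
    by (metis in_set_conv_decomp prod.collapse)
  with move less.prems show ?case by (simp add: deg_def)
qed

lemma Phi_T_plus: "a \<in> T_plus \<Longrightarrow> Phi a = (\<lambda>w n. 0)"
proof -
  interpret T: module T_scale
    using vector_space_T_scale[folded module_iff_vector_space] .
  have "T.subspace {a. Phi a = (\<lambda>w n. 0)}"
    by (rule T.subspaceI) (simp_all add: Phi_zero Phi_add Phi_scale)
  moreover have "(\<Union>n\<in>{1..}. T_hom n) \<subseteq> {a. Phi a = (\<lambda>w n. 0)}"
  proof
    fix a assume "a \<in> (\<Union>n\<in>{1..}. T_hom n)"
    then have "(\<Sum>(u, k)\<leftarrow>letters x. k) \<ge> 1" if "x \<in> Poly_Mapping.keys a" for x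
      using that by (auto simp: T_hom_def)
    then have "Phw (letters x) w n = 0" if "x \<in> Poly_Mapping.keys a" for x w n
      using Phi_positive_word[of "letters x"] that by (simp add: Phi_wd)
    then show "a \<in> {a. Phi a = (\<lambda>w n. 0)}" by (simp add: Phi_def fun_eq_iff)
  qed
  ultimately show "a \<in> T_plus \<Longrightarrow> Phi a = (\<lambda>w n. 0)"
    unfolding T_plus_def using T.span_minimal by blast
qed

text \<open>The kernel of \<open>Phi\<close> is a left ideal, contains \<open>T_plus\<close>, and is
  stable under \<open>T_der\<close>, which corresponds to differentiation of fields.\<close>

lemma Phi_J: "a \<in> J_ideal \<Longrightarrow> Phi a = (\<lambda>w n. 0)"
proof -
  let ?K = "{a. Phi a = (\<lambda>w n. 0)}"
  have der: "(T_der ^^ i) a \<in> ?K" if "a \<in> T_plus" for i a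
  proof (induction i)
    case 0
    then show ?case using Phi_T_plus[OF that] by simp
  next
    case (Suc i)
    then show ?case using fder_Phi[of "(T_der ^^ i) a"] by (simp add: fder_def fun_eq_iff)
  qed
  have "J_ideal \<subseteq> ?K"
    unfolding J_ideal_def
    by (rule hull_minimal)
      (use der in \<open>auto simp: T_left_ideal_def Phi_zero Phi_add Phi_mult_zero\<close>)
  then show "a \<in> J_ideal \<Longrightarrow> Phi a = (\<lambda>w n. 0)" by blast
qed

section \<open>Descent to \<open>T / J\<close> and to the defining relations of
  \<open>V_q\<close>\<close>

definition Psi :: "TJ \<Rightarrow> 'w \<Rightarrow> 'w series" where
  "Psi x = Phi (rep_TJ x)"

lemma TJ_cases: obtains a where "x = abs_TJ a"
  by (metis Quotient3_TJ Quotient3_abs_rep)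

lemma Psi_abs: "Psi (abs_TJ a) = Phi a"
proof -
  have "rep_TJ (abs_TJ a) - a \<in> J_ideal"
    by (metis J_rel_def Quotient3_TJ Quotient3_abs_rep TJ.abs_eq_iff)
  from Phi_J[OF this] show ?thesis by (simp add: Psi_def Phi_diff fun_eq_iff)
qed

lemma Psi_add: "Psi (x + y) w n = Psi x w n + Psi y w n"
proof -
  obtain a b where ab: "x = abs_TJ a" "y = abs_TJ b" by (meson TJ_cases)
  then have "x + y = abs_TJ (a + b)" by (simp add: plus_TJ.abs_eq)
  then show ?thesis by (simp add: ab Psi_abs Phi_add)
qed

lemma Psi_zero: "Psi 0 w n = 0"
  using Psi_add[of 0 0 w n] by simp

lemma Psi_diff: "Psi (x - y) w n = Psi x w n - Psi y w n"
  using Psi_add[of "x - y" y w n] by simp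

lemma Psi_act: "Psi (TJ_act a x) = Phi (a * rep_TJ x)"
  by (simp add: TJ_act_def Psi_abs)

lemma Psi_scale: "Psi (TJ_scale c x) w n = s c (Psi x w n)"
proof -
  have "Poly_Mapping.single 0 c * rep_TJ x = T_scale c (rep_TJ x)" by (simp add: T_scale_def)
  then show ?thesis unfolding TJ_scale_def Psi_act by (simp add: Phi_scale Psi_def)
qed

lemma Psi_current: "Psi (current TJ_act u x k) = fp k u (Psi x)"
  unfolding current_def Psi_act Phi_gen by (simp add: Psi_def)

lemma TJ_current_low: "\<exists>c. \<forall>k<c. \<forall>u. current TJ_act u x k = 0"
proof -
  obtain N where N: "\<forall>n>N. \<forall>u. TJ_act (gen u n) x = 0" using TJ_restricted by blast
  show ?thesis by (rule exI[of _ "- N - 1"]) (use N in \<open>simp add: current_def\<close>)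
qed

text \<open>The relations have been proved for the fields \<open>Psi x\<close> with the same
  expansions as in \<open>V_q\<close>. The sum in the ratio relations has to be carried through
  \<open>Psi\<close>; \<open>TJ_current_low\<close> makes it finite in \<open>T / J\<close>.\<close>

lemma Psi_kernel: "x \<in> Vq_kernel q \<Longrightarrow> Psi x = (\<lambda>w n. 0)"
proof -
  have vs: "vector_space TJ_scale" using T_module_TJ by (simp add: T_module_def Vector_Spaces.linear_iff)
  interpret TJ: cvec TJ_scale using vs by (simp add: cvec_def)
  have cur0: "current TJ_act u 0 k = 0" for u k
  proof -
    have "current TJ_act u (0 + 0) k = current TJ_act u 0 k + current TJ_act u 0 k"
      using T_module_TJ by (simp only: current_def T_module_def Vector_Spaces.linear_iff)
    then show ?thesis by simp
  qed
  let ?N = "{x. Psi x = (\<lambda>w n. 0)}"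
  have sub: "TJ_submodule ?N"
    unfolding TJ_submodule_def
  proof (intro conjI ballI allI)
    show "TJ_act a x \<in> ?N" if "x \<in> ?N" for a x
      using that Phi_mult_zero[of "rep_TJ x" a] by (simp add: Psi_act) (simp add: Psi_def)
  qed (simp_all add: Psi_add Psi_zero fun_eq_iff)
  have ratio: "Psi (op_prod (current TJ_act u) (current TJ_act t) x m n -
      ser_mult TJ_scale (ratio_zero a b) (op_rev_prod (current TJ_act t) (current TJ_act u) x) m n) = (\<lambda>w n. 0)"
    if r: "ratio_pair u t a b" for u t a b x m n
  proof -
    let ?g = "\<lambda>(i, j). TJ_scale (ratio_zero a b i j) (current TJ_act t (current TJ_act u x (m - i)) (n - j))"
    obtain c where c: "\<And>k. k < c \<Longrightarrow> current TJ_act u x k = 0" using TJ_current_low[of x] by blast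
    have "\<forall>k. \<exists>c. \<forall>l<c. current TJ_act t (current TJ_act u x k) l = 0" using TJ_current_low by blast
    then obtain r where r': "\<And>k l. l < r k \<Longrightarrow> current TJ_act t (current TJ_act u x k) l = 0" by metis
    have fin: "finite {y. ?g y \<noteq> 0}"
    proof (rule finite_subset)
      show "{y. ?g y \<noteq> 0} \<subseteq> (SIGMA i:{0..m - c}. {0..n - r (m - i)})"
      proof
        fix y assume y: "y \<in> {y. ?g y \<noteq> 0}"
        obtain i j where ij: "y = (i, j)" by (cases y)
        from y have nz: "ratio_zero a b i j \<noteq> 0" "current TJ_act t (current TJ_act u x (m - i)) (n - j) \<noteq> 0"
          by (auto simp: ij)
        then have "\<not> m - i < c" "\<not> n - j < r (m - i)" using c r' cur0 by metis+
        with ratio_zero_supp[OF ratio_pair_nz[OF r] nz(1)] show "y \<in> (SIGMA i:{0..m - c}. {0..n - r (m - i)})"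
          by (simp add: ij)
      qed
    qed simp
    have "Psi (Sum_any ?g) w N = Sum_any (\<lambda>y. Psi (?g y) w N)" for w N
      by (rule Sum_any_additive[OF fin]) (simp_all add: Psi_add Psi_zero)
    then have "Psi (Sum_any ?g) w N = ser_mult s (ratio_zero a b) (\<lambda>P R. fp R t (fp P u (Psi x)) w N) m n" for w N
      by (simp add: ser_mult_def case_prod_unfold Psi_scale Psi_current)
    then show ?thesis
      using ratio_rel[OF r tame_Phi[of "rep_TJ x", folded Psi_def]]
      by (intro ext) (simp add: Psi_diff op_prod_def op_rev_prod_def Psi_current ser_mult_def)
  qed
  have gens: "Psi (L x m n - R x m n) = (\<lambda>w n. 0)"
    if "(L, R) \<in> DY_rels ratio_zero 1 q TJ_scale TJ_act" for L R x m n
  proof -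
    have t: "tame (Psi x)" by (simp add: Psi_def tame_Phi)
    have HH: "Psi (op_prod (current TJ_act H) (current TJ_act H) x m n - op_rev_prod (current TJ_act H) (current TJ_act H) x m n) = (\<lambda>w n. 0)"
      by (intro ext) (simp add: Psi_diff op_prod_def op_rev_prod_def Psi_current HH_rel[OF t, of m n])
    have EF: "Psi (op_prod (current TJ_act E) (current TJ_act F) x m n - op_rev_prod (current TJ_act F) (current TJ_act E) x m n
      - ser_mult TJ_scale (delta_ser 1) (\<lambda>m n. if m = 0 then current TJ_act H x n else 0) m n) = (\<lambda>w n. 0)"
      unfolding TJ.ser_mult_delta
      by (intro ext) (simp add: Psi_diff op_prod_def op_rev_prod_def Psi_current EF_rel[OF t, of m n])
    from that show ?thesis
      using ratio[of E E q "- q" x m n] ratio[of F F "- q" q x m n] ratio[of H E q "- q" x m n] ratio[of H F "- q" q x m n] HH EF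
      by (auto simp: DY_rels_def Let_def ratio_pair_def)
  qed
  have "Vq_kernel q \<subseteq> ?N"
    unfolding Vq_kernel_def by (rule hull_minimal) (use gens sub in auto)
  then show "x \<in> Vq_kernel q \<Longrightarrow> Psi x = (\<lambda>w n. 0)" by blast
qed

end

section \<open>Modules at infinity\<close>

lemma binom_ser_Suc:
  "binom_ser c (int (Suc k)) i j = binom_ser c (int k) (i - 1) j + c * binom_ser c (int k) i (j - 1)"
proof -
  consider "j < 0" | "j = 0" | l where "j = int (Suc l)"
    by (metis int_cases3 not0_implies_Suc of_nat_0_less_iff less_irrefl neg_less_0_iff_less zero_less_iff_neq_zero)
  then show ?thesis
  proof cases
    case 3
    have "of_int (int (Suc k)) gchoose Suc l = (of_int (int k) gchoose l) + (of_int (int k) gchoose Suc l :: complex)"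
      using gbinomial_Suc_Suc[of "of_nat k :: complex" l] by (simp add: add.commute)
    moreover have "nat j = Suc l" "nat (j - 1) = l" using 3 by auto
    ultimately show ?thesis using 3 by (auto simp: binom_ser_def algebra_simps)
  qed (auto simp: binom_ser_def)
qed

lemma binom_ser_supp: "binom_ser c (int k) i j \<noteq> 0 \<Longrightarrow> 0 \<le> j \<and> j \<le> int k \<and> i = int k - j"
proof -
  assume *: "binom_ser c (int k) i j \<noteq> 0"
  then have j: "0 \<le> j" "i + j = int k" "(of_int (int k) gchoose nat j :: complex) \<noteq> 0"
    by (auto simp: binom_ser_def split: if_splits)
  then have "of_nat (k choose nat j) \<noteq> (0 :: complex)" unfolding binomial_gbinomial by simp
  then have "\<not> k < nat j" using binomial_eq_0[of k "nat j"] by auto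
  with j show ?thesis by linarith
qed

context cvec
begin

lemma ser_mult_binom_Suc:
  "ser_mult s (binom_ser c (int (Suc k))) A m n =
    ser_mult s (binom_ser c (int k)) A (m - 1) n + s c (ser_mult s (binom_ser c (int k)) A m (n - 1))"
proof -
  let ?b = "binom_ser c (int k)"
  have fin: "finite {x. ?b (fst x - p) (snd x - r) \<noteq> 0}" for p r
  proof (rule finite_subset)
    show "{x. ?b (fst x - p) (snd x - r) \<noteq> 0} \<subseteq> {p..int k + p} \<times> {r..int k + r}"
    proof
      fix x assume "x \<in> {x. ?b (fst x - p) (snd x - r) \<noteq> 0}"
      then show "x \<in> {p..int k + p} \<times> {r..int k + r}"
        using binom_ser_supp[of c k "fst x - p" "snd x - r"] by (cases x) auto
    qed
  qed simp
  have shift: "ser_mult s ?b A (m - p) (n - r) = Sum_any (\<lambda>x. s (?b (fst x - p) (snd x - r)) (A (m - fst x) (n - snd x)))" for p r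
    unfolding ser_mult_def
    using Sum_any_shift_prod[of "\<lambda>(i, j). s (?b i j) (A (m - p - i) (n - r - j))" p r] by simp
  have fs: "finite {x. s (d * ?b (fst x - p) (snd x - r)) (A (m - fst x) (n - snd x)) \<noteq> 0}" for p r d
    by (rule finite_supp_mono[OF fin[of p r]]) simp
  have "ser_mult s (binom_ser c (int (Suc k))) A m n =
     Sum_any (\<lambda>x. s (1 * ?b (fst x - 1) (snd x - 0)) (A (m - fst x) (n - snd x)) + s (c * ?b (fst x - 0) (snd x - 1)) (A (m - fst x) (n - snd x)))"
    unfolding ser_mult_def binom_ser_Suc by (simp add: case_prod_unfold scale_left_distrib)
  also have "\<dots> = Sum_any (\<lambda>x. s (1 * ?b (fst x - 1) (snd x - 0)) (A (m - fst x) (n - snd x))) +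
      Sum_any (\<lambda>x. s (c * ?b (fst x - 0) (snd x - 1)) (A (m - fst x) (n - snd x)))"
    by (rule Sum_any.distrib[OF fs fs])
  also have "Sum_any (\<lambda>x. s (1 * ?b (fst x - 1) (snd x - 0)) (A (m - fst x) (n - snd x))) = ser_mult s ?b A (m - 1) n"
    using shift[of 1 0] by simp
  also have "Sum_any (\<lambda>x. s (c * ?b (fst x - 0) (snd x - 1)) (A (m - fst x) (n - snd x))) = s c (ser_mult s ?b A m (n - 1))"
  proof -
    have "s c (Sum_any (\<lambda>x. s (1 * ?b (fst x - 0) (snd x - 1)) (A (m - fst x) (n - snd x)))) =
        Sum_any (\<lambda>x. s c (s (1 * ?b (fst x - 0) (snd x - 1)) (A (m - fst x) (n - snd x))))"
      by (rule Sum_any_additive[OF fs]) (rule scale_right_distrib, rule scale_zero_right)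
    then show ?thesis unfolding shift[of 0 1, simplified] by simp
  qed
  finally show ?thesis .
qed

lemma ser_mult_binom_0: "ser_mult s (binom_ser c (int 0)) A m n = A m n"
proof -
  have "binom_ser c (int 0) i j = (if i = 0 \<and> j = 0 then 1 else 0)" for i j
  proof (cases "i = 0 \<and> j = 0")
    case True
    then show ?thesis by (simp add: binom_ser_def)
  next
    case False
    have "binom_ser c (int 0) i j = 0"
    proof (rule ccontr)
      assume "binom_ser c (int 0) i j \<noteq> 0"
      from binom_ser_supp[OF this] have "j = 0" "i = 0" by linarith+
      with False show False by blast
    qed
    with False show ?thesis by (simp only: if_False)
  qed
  then have "ser_mult s (binom_ser c (int 0)) A m n = Sum_any (\<lambda>x::int \<times> int. if x = (0, 0) then A m n else 0)"
    unfolding ser_mult_def by (intro arg_cong[of _ _ Sum_any] ext) (simp add: case_prod_unfold prod_eq_iff)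
  then show ?thesis by simp
qed

lemma ser_mult_dm: "ser_mult s (binom_ser (- 1) (int k)) A = (dm ^^ k) A"
  and ser_mult_pm: "ser_mult s (binom_ser 1 (int k)) A = (pm ^^ k) A"
proof -
  show "ser_mult s (binom_ser (- 1) (int k)) A = (dm ^^ k) A"
    by (induction k) (use ser_mult_binom_0[of "- 1"] in \<open>simp_all add: fun_eq_iff ser_mult_binom_Suc[of "- 1"] dm_def del: of_nat_Suc\<close>)
  show "ser_mult s (binom_ser 1 (int k)) A = (pm ^^ k) A"
    by (induction k) (use ser_mult_binom_0[of 1] in \<open>simp_all add: fun_eq_iff ser_mult_binom_Suc[of 1] pm_def del: of_nat_Suc\<close>)
qed

lemma deriv1_pow: "(deriv1 s ^^ i) a m n = s (pochhammer (of_int (m + 1)) i) (a (m + int i) n)"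
proof (induction i arbitrary: m)
  case (Suc i)
  then show ?case by (simp add: deriv1_def pochhammer_rec add_ac)
qed simp

text \<open>The i-th derivative divided by i! has binomial coefficients as weights; the index shift
  by \<open>i\<close> accounts for the exponents lowered by differentiation.\<close>

lemma shift_subst_tay0:
  assumes "laurent_inf2 a"
  shows "shift_subst s a = tay0 a"
proof (intro ext)
  fix i n
  show "shift_subst s a i n = tay0 a i n"
  proof (cases "i < 0")
    case True
    then show ?thesis by (simp add: shift_subst_def tay0_def)
  next
    case False
    define g where "g m = s (pochhammer (of_int (m + 1)) (nat i)) (a (m + i) (n - m))" for m
    have fin: "finite {m. g m \<noteq> 0}"
    proof -
      have "finite ((\<lambda>j. j - i) ` {j. s (pochhammer (of_int (j - i + 1)) (nat i)) (a j (n + i - j)) \<noteq> 0})"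
        by (rule finite_imageI[OF tay0_finite[OF assms]])
      then show ?thesis
        by (rule finite_subset[rotated]) (auto simp: g_def image_iff algebra_simps intro!: exI[of _ "_ + i"])
    qed
    have "shift_subst s a i n = s (1 / fact (nat i)) (Sum_any g)"
      using False by (simp add: shift_subst_def diag_def deriv1_pow g_def)
    also have "\<dots> = Sum_any (\<lambda>m. s (1 / fact (nat i)) (g m))"
      by (rule Sum_any_additive[OF fin]) (simp_all add: scale_right_distrib)
    also have "\<dots> = Sum_any (\<lambda>j. s (1 / fact (nat i)) (g (j - i)))"
      using Sum_any_shift[of "\<lambda>m. s (1 / fact (nat i)) (g m)" "- i"] by simp
    also have "\<dots> = tay0 a i n"
      unfolding tay0_def
      by (intro arg_cong[of _ _ Sum_any] ext)
        (use False in \<open>simp add: g_def ib_def gbinomial_pochhammer' of_nat_nat algebra_simps\<close>)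
    finally show ?thesis .
  qed
qed

text \<open>Every \<open>k\<close> that clears the pole yields the same expansion after division by
  x0^k. The \<open>k\<close> of the axiom is therefore confined to \<open>compat\<close>, and
  associativity becomes one equation for each \<open>R\<close>.\<close>

lemma module_at_infinity_iff:
  "module_at_infinity sV Y v0 s YW \<longleftrightarrow>
    (\<forall>w n. Vector_Spaces.linear sV s (\<lambda>v. YW v w n)) \<and>
    (\<forall>v. hom_laurent_inf s (YW v)) \<and> YW v0 = vac \<and>
    (\<forall>u v. compat (YW u) (YW v) \<and> (\<forall>R. YW (Y u v R) = fprod R (YW u) (YW v)))"
proof -
  have "(\<exists>k::nat. \<forall>w. let a = ser_mult s (binom_ser (- 1) (int k)) (op_prod (YW u) (YW v) w) in
         laurent_inf2 a \<and> (\<lambda>i n. YW (Y u v (i - int k)) w n) = shift_subst s a) \<longleftrightarrow>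
      compat (YW u) (YW v) \<and> (\<forall>R. YW (Y u v R) = fprod R (YW u) (YW v))" (is "?L = ?R") for u v
  proof -
    have sub: "(\<lambda>i n. YW (Y u v (i - int k)) w n) = shift_subst s ((dm ^^ k) (op_prod (YW u) (YW v) w))
        \<longleftrightarrow> (\<forall>R n. YW (Y u v R) w n = fprod R (YW u) (YW v) w n)"
      if "merk k (op_prod (YW u) (YW v) w)" for k w
    proof -
      have "shift_subst s ((dm ^^ k) (op_prod (YW u) (YW v) w)) i n = fprod (i - int k) (YW u) (YW v) w n" for i n
        using that tay_eq[OF that, of "i - int k" n] by (simp add: shift_subst_tay0 merk_def fprod_def)
      then show ?thesis by (auto simp: fun_eq_iff) (metis add_diff_cancel)
    qed
    show ?thesis
    proof
      assume ?L
      then obtain k where k: "\<And>w. merk k (op_prod (YW u) (YW v) w) \<and>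
          (\<lambda>i n. YW (Y u v (i - int k)) w n) = shift_subst s ((dm ^^ k) (op_prod (YW u) (YW v) w))"
        by (auto simp: Let_def ser_mult_dm merk_def)
      then have "YW (Y u v R) w n = fprod R (YW u) (YW v) w n" for R w n using sub[of k w] by blast
      with k show ?R unfolding compat_def by (auto simp: fun_eq_iff)
    next
      assume R: ?R
      then obtain k where k: "\<And>w. merk k (op_prod (YW u) (YW v) w)" unfolding compat_def by blast
      then show ?L using sub[OF k] R by (intro exI[of _ k]) (auto simp: Let_def ser_mult_dm merk_def)
    qed
  qed
  then show ?thesis
    unfolding module_at_infinity_def using vector_space_axioms by (auto simp: fun_eq_iff vac_def)
qed

lemma plus_subst_psub:
  assumes "\<And>P R. R < R0 \<Longrightarrow> A P R = 0"
  shows "plus_subst s A m n = psub A m n"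
proof -
  define J where "J = nat (n - R0)"
  have "plus_subst s A m n = (\<Sum>x\<in>(\<lambda>j. (m + int j, int j)) ` {..J}. (\<lambda>(p, j). s (binom_ser 1 p m j) (A p (n - j))) x)"
    unfolding plus_subst_def
  proof (rule Sum_any_superset)
    fix x :: "int \<times> int" assume x: "x \<notin> (\<lambda>j. (m + int j, int j)) ` {..J}"
    obtain p j where pj: "x = (p, j)" by (cases x)
    have "binom_ser 1 p m j = 0 \<or> A p (n - j) = 0"
    proof (rule ccontr)
      assume c: "\<not> ?thesis"
      then have "0 \<le> j" "p = m + j" by (auto simp: binom_ser_def split: if_splits)
      moreover have "\<not> n - j < R0" using c assms by blast
      ultimately have "x = (m + int (nat j), int (nat j))" "nat j \<le> J" by (auto simp: pj J_def)
      with x show False by blast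
    qed
    then show "(case x of (p, j) \<Rightarrow> s (binom_ser 1 p m j) (A p (n - j))) = 0" by (auto simp: pj)
  qed simp
  also have "\<dots> = (\<Sum>j\<le>J. s (of_int (m + int j) gchoose j) (A (m + int j) (n - int j)))"
    by (subst sum.reindex) (auto simp: inj_on_def binom_ser_def)
  also have "\<dots> = psub A m n"
    by (rule psub_sum[of R0 A, OF assms, symmetric]) (simp_all add: J_def)
  finally show ?thesis .
qed

end

text \<open>The lower bound on \<open>R\<close> makes the sum in \<open>psub\<close> finite, so a
  linear map between two spaces commutes with it.\<close>

lemma psub_image:
  assumes V: "cvec sV" and W: "cvec sW"
    and f: "\<And>x y. f (x + y) = f x + f y" "\<And>c x. f (sV c x) = sW c (f x)"
    and low: "\<And>P R. R < R0 \<Longrightarrow> A P R = 0"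
  shows "f (cvec.psub sV A m n) = cvec.psub sW (\<lambda>P R. f (A P R)) m n"
proof -
  have f0: "f 0 = 0" using f(1)[of 0 0] by simp
  have fs: "f (\<Sum>j\<in>S. g j) = (\<Sum>j\<in>S. f (g j))" for S :: "nat set" and g
    by (induction S rule: infinite_finite_induct) (simp_all add: f f0)
  define J where "J = nat (n - R0)"
  have "cvec.psub sV A m n = (\<Sum>j\<le>J. sV (of_int (m + int j) gchoose j) (A (m + int j) (n - int j)))"
    by (rule cvec.psub_sum[OF V, of R0]) (simp_all add: low J_def)
  moreover have "cvec.psub sW (\<lambda>P R. f (A P R)) m n =
      (\<Sum>j\<le>J. sW (of_int (m + int j) gchoose j) (f (A (m + int j) (n - int j))))"
    by (rule cvec.psub_sum[OF W, of R0]) (simp_all add: low f0 J_def)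
  ultimately show ?thesis by (simp add: fs f)
qed

section \<open>Existence and uniqueness of the module structure\<close>

locale dy_vq = dy_inf s q act for s :: "complex \<Rightarrow> 'w::ab_group_add \<Rightarrow> 'w" and q act +
  fixes sV :: "complex \<Rightarrow> 'v::ab_group_add \<Rightarrow> 'v" and actV :: "T \<Rightarrow> 'v \<Rightarrow> 'v" and pr :: "TJ \<Rightarrow> 'v"
    and Y :: "'v \<Rightarrow> 'v \<Rightarrow> 'v series"
  assumes Vq: "is_Vq q sV actV pr" and nva: "nonlocal_vertex_algebra sV Y (pr TJ_one)"
    and Y_gen: "\<forall>u. Y (Vq_gen actV pr u) = current actV u"
begin

text \<open>A preimage in \<open>T\<close> is chosen; \<open>phi_pr\<close> removes the choice by
  means of \<open>Psi_kernel\<close>.\<close>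

definition phi :: "'v \<Rightarrow> 'w \<Rightarrow> 'w series" where
  "phi v = Phi (SOME a. pr (abs_TJ a) = v)"

lemma pr_linear: "pr (x + y) = pr x + pr y" "pr (x - y) = pr x - pr y" "pr (TJ_scale c x) = sV c (pr x)"
proof -
  interpret l: Vector_Spaces.linear TJ_scale sV pr using Vq by (simp add: is_Vq_def)
  show "pr (x + y) = pr x + pr y" "pr (x - y) = pr x - pr y" "pr (TJ_scale c x) = sV c (pr x)"
    by (fact l.add l.diff l.scale)+
qed

lemma V_cases: obtains a where "v = pr (abs_TJ a)"
proof -
  obtain x where "v = pr x" using Vq unfolding is_Vq_def by (metis surjD)
  moreover obtain a where "x = abs_TJ a" by (rule TJ_cases)
  ultimately show ?thesis using that by blast
qed

lemma phi_pr: "phi (pr (abs_TJ a)) = Phi a"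
proof -
  define b where "b = (SOME b. pr (abs_TJ b) = pr (abs_TJ a))"
  have "pr (abs_TJ b) = pr (abs_TJ a)" unfolding b_def by (rule someI[of _ a]) simp
  then have "pr (abs_TJ b - abs_TJ a) = 0" by (simp add: pr_linear)
  then have "abs_TJ b - abs_TJ a \<in> Vq_kernel q" using Vq unfolding is_Vq_def by blast
  from Psi_kernel[OF this] have "Phi b = Phi a"
    using Psi_diff[of "abs_TJ b" "abs_TJ a"] by (simp add: Psi_abs fun_eq_iff)
  then show ?thesis by (simp add: phi_def b_def)
qed

lemma phi_add: "phi (x + y) = (\<lambda>w n. phi x w n + phi y w n)"
proof -
  obtain a b where ab: "x = pr (abs_TJ a)" "y = pr (abs_TJ b)" by (meson V_cases)
  then have "x + y = pr (abs_TJ (a + b))" by (simp add: pr_linear flip: plus_TJ.abs_eq)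
  then show ?thesis by (simp add: ab phi_pr Phi_add)
qed

lemma phi_scale: "phi (sV c x) = (\<lambda>w n. s c (phi x w n))"
proof -
  obtain a where a: "x = pr (abs_TJ a)" by (rule V_cases)
  then have "sV c x = pr (abs_TJ (T_scale c a))"
    by (simp add: TJ_scale_def TJ_act_abs T_scale_def flip: pr_linear)
  then show ?thesis by (simp add: a phi_pr Phi_scale)
qed

lemma phi_zero: "phi 0 = (\<lambda>w n. 0)"
  using phi_add[of 0 0] by (simp add: fun_eq_iff)

lemma pr_act: "actV a (pr (abs_TJ b)) = pr (abs_TJ (a * b))"
proof -
  have "actV a (pr (abs_TJ b)) = pr (TJ_act a (abs_TJ b))" using Vq by (simp add: is_Vq_def)
  then show ?thesis by (simp add: TJ_act_abs)
qed

lemma TJ_one_eq: "TJ_one = abs_TJ 1"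
  by (simp add: TJ_one_def)

lemma act_vac: "actV a (pr TJ_one) = pr (abs_TJ a)"
  by (simp add: TJ_one_eq pr_act)

lemma phi_vac: "phi (pr TJ_one) = vac"
  using Phi_wd[of "[]"] by (simp add: TJ_one_eq phi_pr wd_Nil)

lemma phi_gen: "phi (actV (gen u n) v) = fp (- n - 1) u (phi v)"
proof -
  obtain a where a: "v = pr (abs_TJ a)" by (rule V_cases)
  show ?thesis by (simp add: a pr_act phi_pr Phi_gen)
qed

lemma phi_current: "phi (current actV u v k) = fp k u (phi v)"
  by (simp add: current_def phi_gen)

lemma fp_vac: "fp 0 u vac = cur u"
proof (intro ext)
  fix w n
  have m: "merk 0 (op_prod (cur u) vac w)"
    by (rule passes_merk[OF passes_vac[OF hli_cur] hli_cur hli_vac])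
  have "fp 0 u vac w n = Sum_any (\<lambda>j. s (ib j 0) (op_prod (cur u) vac w j (n - j)))"
    by (simp add: fp_def fprod_def tay_eq[OF m] tay0_def)
  also have "\<dots> = Sum_any (\<lambda>j. if j = n then cur u w n else 0)"
    by (intro arg_cong[of _ _ Sum_any] ext) (simp add: ib_def op_prod_def vac_def cur_simps)
  finally show "fp 0 u vac w n = cur u w n" by simp
qed

lemma phi_Vq_gen: "phi (Vq_gen actV pr u) = cur u"
  by (simp add: Vq_gen_def phi_gen phi_vac fp_vac)

lemma tame_phi: "tame (phi v)"
  by (simp add: phi_def tame_Phi)

lemma vsV: "cvec sV"
  using Vq by (simp add: is_Vq_def T_module_def Vector_Spaces.linear_iff cvec_def)

lemma Y_left: "Y (u + u') v n = Y u v n + Y u' v n" "Y (sV c u) v n = sV c (Y u v n)" "Y 0 v n = 0"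
proof -
  have l: "Vector_Spaces.linear sV sV (\<lambda>u. Y u v n)" using nva by (simp add: nonlocal_vertex_algebra_def)
  then interpret l: Vector_Spaces.linear sV sV "\<lambda>u. Y u v n" .
  show "Y (u + u') v n = Y u v n + Y u' v n" "Y (sV c u) v n = sV c (Y u v n)" "Y 0 v n = 0"
    by (fact l.add l.scale l.zero)+
qed

lemma Y_right_zero: "Y u 0 n = 0"
proof -
  have "Vector_Spaces.linear sV sV (\<lambda>v. Y u v n)"
    using nva by (simp add: nonlocal_vertex_algebra_def hom_laurent_def)
  then interpret l: Vector_Spaces.linear sV sV "\<lambda>v. Y u v n" .
  show ?thesis by (fact l.zero)
qed

lemma Y_low: "\<exists>N. \<forall>n<N. Y u v n = 0"
  using nva by (simp add: nonlocal_vertex_algebra_def hom_laurent_def)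

definition good :: "'v \<Rightarrow> bool" where
  "good u \<longleftrightarrow> (\<forall>v. compat (phi u) (phi v) \<and> (\<forall>R. phi (Y u v R) = fprod R (phi u) (phi v)))"

lemma good_vac: "good (pr TJ_one)"
proof -
  have "Y (pr TJ_one) v R = (if R = 0 then v else 0)" for v R
    using nva by (simp add: nonlocal_vertex_algebra_def)
  then show ?thesis
    unfolding good_def phi_vac
    using compat_vac[OF tame_hli[OF tame_phi]] fprod_vac[OF tame_hli[OF tame_phi]]
    by (auto simp: phi_zero fun_eq_iff)
qed

lemma good_add: "good u \<Longrightarrow> good u' \<Longrightarrow> good (u + u')"
proof -
  assume *: "good u" "good u'"
  show "good (u + u')"
    unfolding good_def
  proof (intro allI conjI)
    fix v R
    have c: "compat (phi u) (phi v)" "compat (phi u') (phi v)" using * by (auto simp: good_def)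
    have op: "op_prod (phi (u + u')) (phi v) w = (\<lambda>m n. op_prod (phi u) (phi v) w m n + op_prod (phi u') (phi v) w m n)" for w
      by (simp add: op_prod_def phi_add)
    obtain k l where k: "\<And>w. merk k (op_prod (phi u) (phi v) w)" "\<And>w. merk l (op_prod (phi u') (phi v) w)"
      using c unfolding compat_def by blast
    have "merk (max k l) (op_prod (phi (u + u')) (phi v) w)" for w
      unfolding op by (intro merk_add) (auto intro: merk_mono[OF k(1)] merk_mono[OF k(2)])
    then show "compat (phi (u + u')) (phi v)" unfolding compat_def by blast
    show "phi (Y (u + u') v R) = fprod R (phi (u + u')) (phi v)"
      using * compatD[OF c(1)] compatD[OF c(2)]
      by (simp add: Y_left phi_add[of "Y u v R"] good_def fun_eq_iff fprod_def op tay_add)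
  qed
qed

lemma good_scale: "good u \<Longrightarrow> good (sV c u)"
proof -
  assume *: "good u"
  show "good (sV c u)"
    unfolding good_def
  proof (intro allI conjI)
    fix v R
    have c: "compat (phi u) (phi v)" using * by (auto simp: good_def)
    have op: "op_prod (phi (sV c u)) (phi v) w = (\<lambda>m n. s c (op_prod (phi u) (phi v) w m n))" for w
      by (simp add: op_prod_def phi_scale)
    obtain k where k: "\<And>w. merk k (op_prod (phi u) (phi v) w)" using c unfolding compat_def by blast
    have "merk k (op_prod (phi (sV c u)) (phi v) w)" for w
      unfolding op by (rule merk_map[of "s c", OF scale_right_diff_distrib k])
    then show "compat (phi (sV c u)) (phi v)" unfolding compat_def by blast
    show "phi (Y (sV c u) v R) = fprod R (phi (sV c u)) (phi v)"
      using * compatD[OF c]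
      by (simp add: Y_left phi_scale[of _ "Y u v R"] good_def fun_eq_iff fprod_def op tay_scale)
  qed
qed

text \<open>\<open>h\<close> is the common term: its \<open>psub\<close> agrees with the iterated
  product \<open>L\<close> after \<open>k\<close> factors x0 + x2, and with \<open>M\<close> after
  \<open>r\<close> factors. The exponent \<open>k\<close> is the pole of the current against
  \<open>phi v\<close>, while \<open>r\<close> comes from the weak associativity of
  \<open>V_q\<close>; having independent origins, they are added.\<close>

lemma good_gen:
  assumes u: "good u"
  shows "good (actV (gen t n) u)"
  unfolding good_def
proof (intro allI)
  fix v
  define m where "m = - n - 1"
  let ?g = "Vq_gen actV pr t" and ?a = "phi u" and ?x = "phi v"
  have u': "actV (gen t n) u = Y ?g u m" using Y_gen by (simp add: current_def m_def)
  have phi_Y: "phi (Y ?g z k) = fp k t (phi z)" for z k using Y_gen by (simp add: phi_current)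
  have gu: "compat ?a ?x" "\<And>R. phi (Y u v R) = fprod R ?a ?x" using u by (auto simp: good_def)
  obtain k c where k: "passes k c (cur t) ?x" using tame_phi[of v] unfolding tame_def by blast
  obtain l d where l: "passes l d (cur t) ?a" using tame_phi[of u] unfolding tame_def by blast
  obtain e where e: "\<And>w. merk e (op_prod ?a ?x w)" using gu(1) unfolding compat_def by blast
  note hx = tame_hli[OF tame_phi[of v]] and ha = tame_hli[OF tame_phi[of u]]
  let ?S = "\<lambda>w. triple (cur t) ?a ?x w"
  have bdd: "bdd3 ((D12 ^^ l) ((D13 ^^ k) ((D23 ^^ e) (?S w))))" for w
    by (rule triple_bdd3[OF hli_cur ha hx k l e])
  have ml: "merk l (\<lambda>i j. ?S w i j n)" for w n
    using passes_merk[OF l hli_cur ha, of "?x w n"] by (simp add: triple_def op_prod_def)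
  have g3: "good3 (?S w)" for w
  proof (rule good3_triple[OF tame_compat[OF tame_phi] gu(1) _ hli_cur])
    \<comment> \<open>Tameness alone says nothing about the product of two arbitrary tame fields;
      this one is tame because it equals \<open>phi (Y u v R)\<close>.\<close>
    show "compat (cur t) (fprod R ?a ?x)" for R
      using tame_compat[OF tame_phi[of "Y u v R"]] by (simp add: gu(2))
  qed
  \<comment> \<open>\<open>K\<close> depends on the pole orders only, so it is uniform in
    \<open>w\<close> although the degree bound of the triple is not.\<close>
  obtain K where "\<And>w. merk K (tay12 (?S w) m)" using tay12_merk[of l l k e m] ml bdd by blast
  then have "compat (phi (Y ?g u m)) ?x"
    unfolding compat_def phi_Y fp_def tay12_triple by blast
  moreover have "phi (Y (Y ?g u m) v n) w N = fprod n (fprod m (cur t) ?a) ?x w N" for m n w N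
  proof -
    define L where "L m n = fprod n (fprod m (cur t) ?a) ?x w N" for m n
    define M where "M m n = phi (Y (Y ?g u m) v n) w N" for m n
    define h where "h P R = phi (Y ?g (Y u v R) P) w N" for P R
    have t1: "t1 (?S w) P R N = h P R" for P R
      unfolding t1_triple[OF tame_compat[OF tame_phi] gu(1) hli_cur] h_def phi_Y gu(2) fp_def ..
    have "t2 (?S w) m n N = L m n" for m n unfolding t2_triple L_def ..
    then have hL: "(pm ^^ k) (psub h) = (pm ^^ k) L"
      using psub_t1_t2[OF g3 bdd, of w N] by (simp add: t1)
    obtain r where "ser_mult sV (binom_ser 1 (int r)) (plus_subst sV (op_prod (Y ?g) (Y u) v)) =
        ser_mult sV (binom_ser 1 (int r)) (\<lambda>i n. Y (Y ?g u i) v n)"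
      using nva unfolding nonlocal_vertex_algebra_def by blast
    then have "(pm ^^ r) (plus_subst sV (op_prod (Y ?g) (Y u) v)) = (pm ^^ r) (\<lambda>i n. Y (Y ?g u i) v n)"
      by (simp add: cvec.ser_mult_pm[OF vsV])
    then have "(pm ^^ r) (\<lambda>i n. phi (plus_subst sV (op_prod (Y ?g) (Y u) v) i n) w N) = (pm ^^ r) M"
      unfolding M_def using pm_pow_map[of "\<lambda>v. phi v w N" r] by (simp add: phi_add)
    moreover have "(\<lambda>i n. phi (plus_subst sV (op_prod (Y ?g) (Y u) v) i n) w N) = psub h"
    proof (intro ext)
      fix i n
      obtain R0 where R0: "\<And>R. R < R0 \<Longrightarrow> Y u v R = 0" using Y_low by blast
      have low: "op_prod (Y ?g) (Y u) v P R = 0" if "R < R0" for P R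
        using R0[OF that] by (simp add: op_prod_def Y_right_zero)
      have "phi (cvec.psub sV (op_prod (Y ?g) (Y u) v) i n) w N = psub (\<lambda>P R. phi (op_prod (Y ?g) (Y u) v P R) w N) i n"
        by (rule psub_image[OF vsV cvec_axioms _ _ low]) (simp_all add: phi_add phi_scale)
      moreover have "plus_subst sV (op_prod (Y ?g) (Y u) v) i n = cvec.psub sV (op_prod (Y ?g) (Y u) v) i n"
        by (rule cvec.plus_subst_psub[OF vsV low])
      ultimately show "phi (plus_subst sV (op_prod (Y ?g) (Y u) v) i n) w N = psub h i n"
        by (simp add: op_prod_def h_def[abs_def])
    qed
    ultimately have hM: "(pm ^^ r) (psub h) = (pm ^^ r) M" by simp
    have sw: "(pm ^^ k) ((pm ^^ r) A) = (pm ^^ r) ((pm ^^ k) A)" for A :: "'w series2"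
      by (rule funpow_swap) (rule refl)
    have "(pm ^^ (k + r)) M = (pm ^^ k) ((pm ^^ r) (psub h))" by (simp add: funpow_add hM)
    also have "\<dots> = (pm ^^ r) ((pm ^^ k) L)" by (simp only: sw hL)
    also have "\<dots> = (pm ^^ (k + r)) L" by (simp only: sw funpow_add comp_apply)
    finally have D: "(pm ^^ (k + r)) (\<lambda>m n. M m n - L m n) = (\<lambda>m n. 0)"
      by (simp add: pm_pow_diff)
    obtain m1 where m1: "\<And>m. m < m1 \<Longrightarrow> Y ?g u m = 0" using Y_low by blast
    obtain m2 where m2: "\<And>m. m < m2 \<Longrightarrow> fprod m (cur t) ?a = (\<lambda>w n. 0)"
      using fprod_low[OF tame_compat[OF tame_phi]] by blast
    \<comment> \<open>Both terms vanish for small \<open>m\<close> whatever \<open>n\<close> is, the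
      one-sided bound under which x0 + x2 can be cancelled.\<close>
    have "M m n - L m n = 0" for m n
    proof (rule pm_cancel[OF _ D, of "min m1 m2"])
      fix m n assume "m < min m1 m2"
      then show "M m n - L m n = 0"
        by (simp add: M_def L_def m1 m2 Y_left phi_zero fprod_def op_prod_def)
    qed
    then show ?thesis by (simp add: M_def L_def)
  qed
  then have "phi (Y (Y ?g u m) v R) = fprod R (phi (Y ?g u m)) ?x" for R
    by (simp add: phi_Y fp_def fun_eq_iff)
  ultimately show "compat (phi (actV (gen t n) u)) ?x \<and> (\<forall>R. phi (Y (actV (gen t n) u) v R) = fprod R (phi (actV (gen t n) u)) ?x)"
    unfolding u' by blast
qed

lemma actV_simps: "actV (a * b) v = actV a (actV b v)" "actV (a + b) v = actV a v + actV b v"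
  "actV (T_scale c a) v = sV c (actV a v)" "actV 1 v = v"
  using Vq by (simp_all add: is_Vq_def T_module_def Vector_Spaces.linear_iff)

text \<open>Every vector is the image of an element of \<open>T\<close>, hence a linear combination
  of words applied to the vacuum.\<close>

lemma V_induct [case_names vac gen add scale]:
  assumes "P (pr TJ_one)" "\<And>u n v. P v \<Longrightarrow> P (actV (gen u n) v)"
    "\<And>u v. P u \<Longrightarrow> P v \<Longrightarrow> P (u + v)" "\<And>c v. P v \<Longrightarrow> P (sV c v)"
  shows "P v"
proof -
  have "P (actV a (pr TJ_one))" for a
  proof (induction a rule: T_wd_induct)
    case (scale c ws)
    have "P (actV (wd ws) (pr TJ_one))"
    proof (induction ws)
      case (Cons l ws)
      then show ?case using assms(2) by (cases l) (simp add: wd_Cons actV_simps)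
    qed (simp add: wd_Nil actV_simps assms(1))
    then show ?case by (simp add: actV_simps assms(4))
  qed (simp add: actV_simps assms(3))
  then show ?thesis by (metis V_cases act_vac)
qed

lemma good: "good u"
  by (induction u rule: V_induct) (simp_all add: good_vac good_gen good_add good_scale)

lemma module_at_infinity_phi: "module_at_infinity sV Y (pr TJ_one) s phi"
  unfolding module_at_infinity_iff
proof (intro conjI allI)
  show "Vector_Spaces.linear sV s (\<lambda>v. phi v w n)" for w n
    using vsV vector_space_axioms by (simp add: Vector_Spaces.linear_iff cvec_def phi_add phi_scale)
qed (use good in \<open>simp_all add: good_def tame_hli[OF tame_phi] phi_vac\<close>)

lemma module_at_infinity_unique:
  assumes YW: "module_at_infinity sV Y (pr TJ_one) s YW" and gens: "\<And>u. YW (Vq_gen actV pr u) = cur u"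
  shows "YW = phi"
proof
  fix v
  note m = YW[unfolded module_at_infinity_iff]
  have lin: "YW (x + y) w n = YW x w n + YW y w n" "YW (sV c x) w n = s c (YW x w n)" for x y c w n
    using m by (simp_all add: Vector_Spaces.linear_iff)
  show "YW v = phi v"
  proof (induction v rule: V_induct)
    case vac
    show ?case using m by (simp add: phi_vac)
  next
    case (gen u n v)
    have "actV (gen u n) v = Y (Vq_gen actV pr u) v (- n - 1)" using Y_gen by (simp add: current_def)
    then have "YW (actV (gen u n) v) = fprod (- n - 1) (YW (Vq_gen actV pr u)) (YW v)" using m by simp
    then show ?case by (simp add: gens gen phi_gen fp_def)
  next
    case (add u v)
    then show ?case by (simp add: fun_eq_iff lin phi_add)
  next
    case (scale c v)
    then show ?case by (simp add: fun_eq_iff lin phi_scale)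
  qed
qed

end

theorem theorem4p10:
  fixes q :: complex
    and sW :: "complex \<Rightarrow> 'w::ab_group_add \<Rightarrow> 'w" and actW :: "T \<Rightarrow> 'w \<Rightarrow> 'w"
    and sV :: "complex \<Rightarrow> 'v::ab_group_add \<Rightarrow> 'v" and actV :: "T \<Rightarrow> 'v \<Rightarrow> 'v"
    and pr :: "TJ \<Rightarrow> 'v" and Y :: "'v \<Rightarrow> 'v \<Rightarrow> 'v series"
  assumes "q \<noteq> 0"
    and "DY_inf_module q sW actW"
    and "is_Vq q sV actV pr"
    and "weak_quantum_vertex_algebra sV Y (pr TJ_one)"
    and "\<forall>u. Y (Vq_gen actV pr u) = current actV u"
  shows "\<exists>!YW :: 'v \<Rightarrow> 'w \<Rightarrow> 'w series.
           module_at_infinity sV Y (pr TJ_one) sW YW \<and>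
           YW (Vq_gen actV pr E) = current actW E \<and>
           YW (Vq_gen actV pr F) = current actW F \<and>
           YW (Vq_gen actV pr H) = current actW H"
proof -
  have "vector_space sW"
    using assms(2) by (simp add: DY_inf_module_def T_module_def Vector_Spaces.linear_iff)
  then interpret dy_vq sW q actW sV actV pr Y
    using assms by (simp add: dy_vq_def dy_vq_axioms_def dy_inf_def dy_inf_axioms_def cvec_def weak_quantum_vertex_algebra_def)
  show ?thesis
  proof (rule ex1I[of _ phi])
    show "module_at_infinity sV Y (pr TJ_one) sW phi \<and> phi (Vq_gen actV pr E) = current actW E \<and>
       phi (Vq_gen actV pr F) = current actW F \<and> phi (Vq_gen actV pr H) = current actW H"
      by (simp add: module_at_infinity_phi phi_Vq_gen)
  next
    fix YW :: "'v \<Rightarrow> 'w \<Rightarrow> 'w series"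
    assume YW: "module_at_infinity sV Y (pr TJ_one) sW YW \<and> YW (Vq_gen actV pr E) = current actW E \<and>
       YW (Vq_gen actV pr F) = current actW F \<and> YW (Vq_gen actV pr H) = current actW H"
    have "YW (Vq_gen actV pr u) = current actW u" for u using YW by (cases u) auto
    with YW show "YW = phi" using module_at_infinity_unique by blast
  qed
qed

end
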